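(* Let $X$ be a curve of genus $g$ over a finite field $\mathbb{F}$ with canonical divisor $K$, let $C$ be a divisor and $P$ a rational point. Suppose $G=K+C=A+B+Z$ with divisors $A,B$ and an effective divisor $Z\geq 0$. Let $S$ be the set consisting of $P$ and the points in the support of $Z$. Then \[ \gamma_P(C;S)\;\geq\;\#\Delta_P(\leq A,C)+\#\Delta_P(\leq B,C). \]
   Context: $X$ is an absolutely irreducible smooth projective curve over a finite field $\mathbb{F}$; $L(E)=\{f : (f)+E\geq 0\}\cup\{0\}$; divisors are considered up to linear equivalence. For a rational point $P$, $\Gamma_P=\{A : L(A)\neq L(A-P)\}$. For a finite set $S$ of rational points containing $P$, $\Gamma_S=\bigcap_{Q\in S}\Gamma_Q$, $\Gamma_P(C;S)=\{A\in\Gamma_S : A-C\in\Gamma_P\}$, and $\gamma_P(C;S)$ is the minimal degree of a divisor in $\Gamma_P(C;S)$. For divisors $B,C$, $\Delta_P(\leq B,C)=\{B+iP : i\leq 0,\ B+iP\in\Gamma_P,\ B-C+iP\notin\Gamma_P\}$ (a set of classes indexed by the integers $i\le 0$). *)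

theory Defs
  imports
    Complex_Main
    "HOL-Library.FuncSet"
    "HOL-Library.Poly_Mapping"
    "HOL-Computational_Algebra.Polynomial"
begin

text \<open>
  An absolutely irreducible smooth projective curve over the finite field \<open>'f\<close> is given by its
  function field \<open>'k\<close>, together with the embedding \<open>\<iota>\<close> of \<open>'f\<close> as field of constants
  (the abstract nonsingular complete curve of a function field). Its closed points are the
  normalized discrete valuations of \<open>'k\<close> over \<open>'f\<close>.
\<close>

definition algebraic_over :: "('f::field \<Rightarrow> 'k::field) \<Rightarrow> 'k \<Rightarrow> bool" where
  "algebraic_over \<iota> x \<longleftrightarrow> (\<exists>p. p \<noteq> 0 \<and> poly (map_poly \<iota> p) x = 0)"

definition simple_subfield :: "('f::field \<Rightarrow> 'k::field) \<Rightarrow> 'k \<Rightarrow> 'k set" where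
  "simple_subfield \<iota> x =
    {poly (map_poly \<iota> p) x / poly (map_poly \<iota> q) x | p q. poly (map_poly \<iota> q) x \<noteq> 0}"

definition finite_over :: "'k::field set \<Rightarrow> bool" where
  "finite_over M \<longleftrightarrow>
    (\<exists>B. finite B \<and> (\<forall>y. \<exists>c. (\<forall>b\<in>B. c b \<in> M) \<and> y = (\<Sum>b\<in>B. c b * b)))"

text \<open>
  Since \<open>'f\<close> is perfect, absolute irreducibility of the curve amounts to \<open>'f\<close> being algebraically
  closed in the function field, which is the last condition.
\<close>

locale curve =
  fixes \<iota> :: "'f::{field,finite} \<Rightarrow> 'k::field"
  assumes const_add: "\<iota> (a + b) = \<iota> a + \<iota> b"
    and const_mult: "\<iota> (a * b) = \<iota> a * \<iota> b"
    and const_one: "\<iota> 1 = 1"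
    and transcendence_degree_one:
      "\<exists>x. \<not> algebraic_over \<iota> x \<and> finite_over (simple_subfield \<iota> x)"
    and full_constant_field: "algebraic_over \<iota> x \<Longrightarrow> x \<in> range \<iota>"

text \<open>
  A point \<open>Q\<close> is its order function: \<open>Q f\<close> is the order of \<open>f \<noteq> 0\<close> at \<open>Q\<close>. The order of \<open>0\<close>,
  mathematically infinite, is set to the dummy value \<open>0\<close>, so that every point is represented by
  exactly one function; all uses of \<open>Q f\<close> treat \<open>f = 0\<close> separately.
\<close>

type_synonym 'k point = "'k \<Rightarrow> int"

definition points :: "('f::field \<Rightarrow> 'k::field) \<Rightarrow> 'k point set" where
  "points \<iota> = {v. v 0 = 0 \<and> surj v
    \<and> (\<forall>x y. x \<noteq> 0 \<longrightarrow> y \<noteq> 0 \<longrightarrow> v (x * y) = v x + v y)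
    \<and> (\<forall>x y. x \<noteq> 0 \<longrightarrow> y \<noteq> 0 \<longrightarrow> x + y \<noteq> 0 \<longrightarrow> min (v x) (v y) \<le> v (x + y))
    \<and> (\<forall>c. c \<noteq> 0 \<longrightarrow> v (\<iota> c) = 0)}"

definition ord_ge :: "'k::field point \<Rightarrow> int \<Rightarrow> 'k \<Rightarrow> bool" where
  "ord_ge Q n f \<longleftrightarrow> f = 0 \<or> n \<le> Q f"

text \<open>
  \<open>B\<close> is a set of representatives of an \<open>'f\<close>-basis of the residue field of \<open>Q\<close>, the quotient of
  the elements of order at least \<open>0\<close> by those of order at least \<open>1\<close>.
\<close>

definition residue_basis :: "('f::field \<Rightarrow> 'k::field) \<Rightarrow> 'k point \<Rightarrow> 'k set \<Rightarrow> bool" where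
  "residue_basis \<iota> Q B \<longleftrightarrow> finite B \<and> (\<forall>b\<in>B. ord_ge Q 0 b) \<and>
    (\<forall>y. ord_ge Q 0 y \<longrightarrow>
      (\<exists>!c. c \<in> B \<rightarrow>\<^sub>E UNIV \<and> ord_ge Q 1 (y - (\<Sum>b\<in>B. \<iota> (c b) * b))))"

definition point_degree :: "('f::field \<Rightarrow> 'k::field) \<Rightarrow> 'k point \<Rightarrow> nat" where
  "point_degree \<iota> Q = (THE n. \<exists>B. residue_basis \<iota> Q B \<and> card B = n)"

definition rational_points :: "('f::field \<Rightarrow> 'k::field) \<Rightarrow> 'k point set" where
  "rational_points \<iota> = {Q \<in> points \<iota>. point_degree \<iota> Q = 1}"

type_synonym 'k divisor = "'k point \<Rightarrow>\<^sub>0 int"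

definition divisors :: "('f::field \<Rightarrow> 'k::field) \<Rightarrow> 'k divisor set" where
  "divisors \<iota> = {D. Poly_Mapping.keys D \<subseteq> points \<iota>}"

definition effective :: "'k divisor \<Rightarrow> bool" where
  "effective D \<longleftrightarrow> (\<forall>Q. 0 \<le> Poly_Mapping.lookup D Q)"

definition divisor_degree :: "('f::field \<Rightarrow> 'k::field) \<Rightarrow> 'k divisor \<Rightarrow> int" where
  "divisor_degree \<iota> D = (\<Sum>Q\<in>Poly_Mapping.keys D. Poly_Mapping.lookup D Q * int (point_degree \<iota> Q))"

definition linearly_equivalent ::
    "('f::field \<Rightarrow> 'k::field) \<Rightarrow> 'k divisor \<Rightarrow> 'k divisor \<Rightarrow> bool" where
  "linearly_equivalent \<iota> D E \<longleftrightarrow>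
    (\<exists>f. f \<noteq> 0 \<and> (\<forall>Q\<in>points \<iota>. Poly_Mapping.lookup D Q = Poly_Mapping.lookup E Q + Q f))"

definition riemann_roch_space :: "('f::field \<Rightarrow> 'k::field) \<Rightarrow> 'k divisor \<Rightarrow> 'k set" where
  "riemann_roch_space \<iota> E =
    {f. f \<noteq> 0 \<and> (\<forall>Q\<in>points \<iota>. 0 \<le> Q f + Poly_Mapping.lookup E Q)} \<union> {0}"

definition genus :: "('f::field \<Rightarrow> 'k::field) \<Rightarrow> nat" where
  "genus \<iota> = (GREATEST n. \<exists>A\<in>divisors \<iota>.
    int n = divisor_degree \<iota> A + 1
      - int (vector_space.dim (\<lambda>c f. \<iota> c * f) (riemann_roch_space \<iota> A)))"

text \<open>
  Canonical divisors are the divisors of nonzero Weil differentials. Adeles carry arbitrary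
  values at arguments that are not points; this is harmless, since a functional vanishing on
  some \<open>bounded_adeles \<iota> D\<close> does not depend on these values.
\<close>

definition adeles :: "('f::field \<Rightarrow> 'k::field) \<Rightarrow> ('k point \<Rightarrow> 'k) set" where
  "adeles \<iota> = {\<alpha>. finite {Q \<in> points \<iota>. \<not> ord_ge Q 0 (\<alpha> Q)}}"

definition bounded_adeles ::
    "('f::field \<Rightarrow> 'k::field) \<Rightarrow> 'k divisor \<Rightarrow> ('k point \<Rightarrow> 'k) set" where
  "bounded_adeles \<iota> D = {\<alpha> \<in> adeles \<iota>. \<forall>Q\<in>points \<iota>. ord_ge Q (- Poly_Mapping.lookup D Q) (\<alpha> Q)}"

definition adele_functional ::
    "('f::field \<Rightarrow> 'k::field) \<Rightarrow> (('k point \<Rightarrow> 'k) \<Rightarrow> 'f) \<Rightarrow> bool" where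
  "adele_functional \<iota> \<omega> \<longleftrightarrow>
    (\<forall>\<alpha>\<in>adeles \<iota>. \<forall>\<beta>\<in>adeles \<iota>. \<omega> (\<lambda>Q. \<alpha> Q + \<beta> Q) = \<omega> \<alpha> + \<omega> \<beta>) \<and>
    (\<forall>c. \<forall>\<alpha>\<in>adeles \<iota>. \<omega> (\<lambda>Q. \<iota> c * \<alpha> Q) = c * \<omega> \<alpha>)"

definition vanishes_at ::
    "('f::field \<Rightarrow> 'k::field) \<Rightarrow> (('k point \<Rightarrow> 'k) \<Rightarrow> 'f) \<Rightarrow> 'k divisor \<Rightarrow> bool" where
  "vanishes_at \<iota> \<omega> D \<longleftrightarrow> (\<forall>\<alpha>\<in>bounded_adeles \<iota> D. \<forall>f. \<omega> (\<lambda>Q. \<alpha> Q + f) = 0)"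

definition weil_differential ::
    "('f::field \<Rightarrow> 'k::field) \<Rightarrow> (('k point \<Rightarrow> 'k) \<Rightarrow> 'f) \<Rightarrow> bool" where
  "weil_differential \<iota> \<omega> \<longleftrightarrow>
    adele_functional \<iota> \<omega> \<and> (\<exists>D\<in>divisors \<iota>. vanishes_at \<iota> \<omega> D)"

definition divisor_of_differential ::
    "('f::field \<Rightarrow> 'k::field) \<Rightarrow> (('k point \<Rightarrow> 'k) \<Rightarrow> 'f) \<Rightarrow> 'k divisor \<Rightarrow> bool" where
  "divisor_of_differential \<iota> \<omega> W \<longleftrightarrow> W \<in> divisors \<iota> \<and> vanishes_at \<iota> \<omega> W \<and>
    (\<forall>D\<in>divisors \<iota>. vanishes_at \<iota> \<omega> D \<longrightarrow> effective (W - D))"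

definition canonical_divisor :: "('f::field \<Rightarrow> 'k::field) \<Rightarrow> 'k divisor \<Rightarrow> bool" where
  "canonical_divisor \<iota> W \<longleftrightarrow>
    (\<exists>\<omega>. weil_differential \<iota> \<omega> \<and> (\<exists>\<alpha>\<in>adeles \<iota>. \<omega> \<alpha> \<noteq> 0)
       \<and> divisor_of_differential \<iota> \<omega> W)"

text \<open>
  The sets below consist of divisors rather than of divisor classes. The first three are closed
  under linear equivalence of divisors; in \<open>Delta_le\<close>, different \<open>i\<close> give different degrees,
  hence different classes.
\<close>

definition Gamma_pt :: "('f::field \<Rightarrow> 'k::field) \<Rightarrow> 'k point \<Rightarrow> 'k divisor set" where
  "Gamma_pt \<iota> Q =
    {A \<in> divisors \<iota>. riemann_roch_space \<iota> A \<noteq> riemann_roch_space \<iota> (A - Poly_Mapping.single Q 1)}"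

definition Gamma_set :: "('f::field \<Rightarrow> 'k::field) \<Rightarrow> 'k point set \<Rightarrow> 'k divisor set" where
  "Gamma_set \<iota> S = (\<Inter>Q\<in>S. Gamma_pt \<iota> Q)"

definition Gamma_rel ::
    "('f::field \<Rightarrow> 'k::field) \<Rightarrow> 'k point \<Rightarrow> 'k divisor \<Rightarrow> 'k point set \<Rightarrow> 'k divisor set" where
  "Gamma_rel \<iota> P C S = {A \<in> Gamma_set \<iota> S. A - C \<in> Gamma_pt \<iota> P}"

definition gamma_min ::
    "('f::field \<Rightarrow> 'k::field) \<Rightarrow> 'k point \<Rightarrow> 'k divisor \<Rightarrow> 'k point set \<Rightarrow> int" where
  "gamma_min \<iota> P C S = (LEAST d. \<exists>A\<in>Gamma_rel \<iota> P C S. d = divisor_degree \<iota> A)"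

definition Delta_le ::
    "('f::field \<Rightarrow> 'k::field) \<Rightarrow> 'k point \<Rightarrow> 'k divisor \<Rightarrow> 'k divisor \<Rightarrow> 'k divisor set" where
  "Delta_le \<iota> P B C =
    {B + Poly_Mapping.single P i | i. i \<le> 0 \<and> B + Poly_Mapping.single P i \<in> Gamma_pt \<iota> P
       \<and> B - C + Poly_Mapping.single P i \<notin> Gamma_pt \<iota> P}"

end

theory Submission
  imports Defs "HOL-Library.Function_Algebras" "HOL-Library.Cardinality"
begin

text \<open>
  The field of constants has a finite number \<open>q\<close> of elements, so all dimensions below are logarithms
  to base \<open>q\<close> of indices of additive groups.

  Let \<open>D\<close> lie in \<open>\<Gamma>\<^sub>P(C;S)\<close>. Multiplication by a function of \<open>L(D)\<close> that does not vanish at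
  \<open>Q \<in> S\<close> as a section embeds \<open>L(M - D)/L(M - D - Q)\<close> into \<open>L(M)/L(M - Q)\<close>, so
  \<open>\<phi>(M) = l(M) - l(M - D)\<close> does not decrease along a chain of divisors that grows by points of \<open>S\<close>.
  It takes values between \<open>0\<close> and \<open>deg D\<close>, and it jumps when \<open>P\<close> is added and the new divisor \<open>M\<close>
  satisfies \<open>M \<in> \<Gamma>\<^sub>P\<close> and \<open>M - C \<notin> \<Gamma>\<^sub>P\<close>, because then also \<open>M - D \<notin> \<Gamma>\<^sub>P\<close>. In the chain
  \<open>\<dots>, A - P, A, \<dots>, A + Z, A + Z + P, \<dots>\<close> the jumps up to \<open>A\<close> are counted by \<open>\<Delta>\<^sub>P(\<le> A, C)\<close>, and
  those after \<open>A + Z\<close> by \<open>\<Delta>\<^sub>P(\<le> B, C)\<close>, since \<open>M \<in> \<Gamma>\<^sub>P\<close> is equivalent to \<open>K + P - M \<notin> \<Gamma>\<^sub>P\<close>.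

  This duality and the bound \<open>\<phi> \<le> deg D\<close> rest on Weil's proof of the Riemann-Roch theorem.
\<close>

subsection \<open>Indices of additive subgroups\<close>

text \<open>The points of the curve are bare valuations, so even finite residue fields and the
  existence of poles have to be produced. Most of this comes from one estimate,
  \<open>card_incongruent_bound\<close>: if a subgroup R of the function field is stable under w,
  then w R has index at most q to the power \<open>N * e\<close> in R, where \<open>N\<close> is the
  degree of the field over the rational functions in \<open>x\<close> and \<open>e\<close> measures
  w in a basis. It gives finite residue fields, discrete valuation rings and the degree bound for
  zeros. Zorn's lemma gives poles, hence the finiteness of L(0).

  With logarithms of indices, exact sequences become Lagrange's theorem and linear dependence
  becomes the pigeonhole principle. For \<phi> \<le> deg D, Riemann-Roch enters as the invariance of
  l(M) - i(M) - deg M, where i(M) is the logarithm of the index of A(M) + k in the adeles: D has a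
  nonzero section, so i(M) \<le> i(M - D). Weil differentials serve the duality alone, since
  canonical divisors are defined through them.\<close>

definition add_subgroup :: "'a::ab_group_add set \<Rightarrow> bool" where
  "add_subgroup U \<longleftrightarrow> 0 \<in> U \<and> (\<forall>x\<in>U. \<forall>y\<in>U. x - y \<in> U)"

lemma add_subgroupI: "0 \<in> U \<Longrightarrow> (\<And>x y. x \<in> U \<Longrightarrow> y \<in> U \<Longrightarrow> x - y \<in> U) \<Longrightarrow> add_subgroup U"
  by (simp add: add_subgroup_def)

lemma add_subgroup_0: "add_subgroup U \<Longrightarrow> 0 \<in> U"
  by (simp add: add_subgroup_def)

lemma add_subgroup_diff: "add_subgroup U \<Longrightarrow> x \<in> U \<Longrightarrow> y \<in> U \<Longrightarrow> x - y \<in> U"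
  by (simp add: add_subgroup_def)

lemma add_subgroup_uminus: "add_subgroup U \<Longrightarrow> x \<in> U \<Longrightarrow> - x \<in> U"
  using add_subgroup_diff[of U 0 x] add_subgroup_0[of U] by simp

lemma add_subgroup_add: "add_subgroup U \<Longrightarrow> x \<in> U \<Longrightarrow> y \<in> U \<Longrightarrow> x + y \<in> U"
  using add_subgroup_diff[of U x "- y"] add_subgroup_uminus[of U y] by simp

lemma add_subgroup_zero: "add_subgroup {0}"
  by (simp add: add_subgroup_def)

lemma add_subgroup_Int: "add_subgroup U \<Longrightarrow> add_subgroup V \<Longrightarrow> add_subgroup (U \<inter> V)"
  by (simp add: add_subgroup_def)

lemma add_subgroup_mult_image:
  fixes w :: "'a::comm_ring"
  assumes "add_subgroup R"
  shows "add_subgroup ((*) w ` R)"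
proof (rule add_subgroupI)
  show "0 \<in> (*) w ` R" using add_subgroup_0[OF assms] by force
  fix r s assume "r \<in> (*) w ` R" "s \<in> (*) w ` R"
  then obtain a b where "a \<in> R" "b \<in> R" "r - s = w * (a - b)" by (auto simp: algebra_simps)
  then show "r - s \<in> (*) w ` R" using add_subgroup_diff[OF assms] by blast
qed

definition sum_set :: "'a::ab_group_add set \<Rightarrow> 'a set \<Rightarrow> 'a set" where
  "sum_set U V = {u + v | u v. u \<in> U \<and> v \<in> V}"

lemma sum_setI: "u \<in> U \<Longrightarrow> v \<in> V \<Longrightarrow> u + v \<in> sum_set U V"
  by (auto simp: sum_set_def)

lemma sum_setE:
  assumes "x \<in> sum_set U V"
  obtains u v where "u \<in> U" "v \<in> V" "x = u + v"
  using assms by (auto simp: sum_set_def)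

lemma sum_set_left: "add_subgroup V \<Longrightarrow> u \<in> U \<Longrightarrow> u \<in> sum_set U V"
  using sum_setI[of u U 0 V] add_subgroup_0 by force

lemma sum_set_right: "add_subgroup U \<Longrightarrow> v \<in> V \<Longrightarrow> v \<in> sum_set U V"
  using sum_setI[of 0 U v V] add_subgroup_0 by force

lemma sum_set_mono: "U \<subseteq> U' \<Longrightarrow> V \<subseteq> V' \<Longrightarrow> sum_set U V \<subseteq> sum_set U' V'"
  by (auto simp: sum_set_def)

lemma add_subgroup_sum_set:
  assumes "add_subgroup U" "add_subgroup V"
  shows "add_subgroup (sum_set U V)"
proof (rule add_subgroupI)
  show "0 \<in> sum_set U V"
    using sum_set_left assms add_subgroup_0 by blast
  fix x y assume "x \<in> sum_set U V" "y \<in> sum_set U V"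
  then obtain u v u' v' where *: "u \<in> U" "v \<in> V" "u' \<in> U" "v' \<in> V" "x = u + v" "y = u' + v'"
    by (elim sum_setE)
  then have "x - y = (u - u') + (v - v')" by simp
  then show "x - y \<in> sum_set U V"
    using * assms by (metis sum_setI add_subgroup_diff)
qed

text \<open>The subgroup comes first, the set it is counted in second. \<open>V\<close> need not
  contain \<open>U\<close>, so bounds on incongruent elements can be stated before any inclusion is
  known.\<close>

definition cosets :: "'a::ab_group_add set \<Rightarrow> 'a set \<Rightarrow> 'a set set" where
  "cosets U V = (\<lambda>v. (+) v ` U) ` V"

lemma coset_eq_iff:
  assumes "add_subgroup U"
  shows "(+) v ` U = (+) w ` U \<longleftrightarrow> v - w \<in> U"
proof
  assume "(+) v ` U = (+) w ` U"
  moreover have "v \<in> (+) v ` U"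
    using add_subgroup_0[OF assms] by force
  ultimately show "v - w \<in> U" by auto
next
  have sub: "(+) a ` U \<subseteq> (+) b ` U" if "a - b \<in> U" for a b
  proof
    fix x assume "x \<in> (+) a ` U"
    then obtain u where u: "u \<in> U" "x = a + u" by auto
    then have "x = b + ((a - b) + u)" by simp
    then show "x \<in> (+) b ` U"
      using add_subgroup_add[OF assms that u(1)] by blast
  qed
  assume "v - w \<in> U"
  moreover from this have "w - v \<in> U"
    using add_subgroup_uminus[OF assms] by fastforce
  ultimately show "(+) v ` U = (+) w ` U" using sub by blast
qed

definition transversal :: "'a::ab_group_add set \<Rightarrow> 'a set \<Rightarrow> 'a set \<Rightarrow> bool" where
  "transversal U V T \<longleftrightarrow> T \<subseteq> V \<and> (\<forall>s\<in>T. \<forall>t\<in>T. s - t \<in> U \<longrightarrow> s = t)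
     \<and> (\<forall>v\<in>V. \<exists>t\<in>T. v - t \<in> U)"

lemma transversal_bij:
  assumes "add_subgroup U" "transversal U V T"
  shows "bij_betw (\<lambda>v. (+) v ` U) T (cosets U V)"
  unfolding bij_betw_def
proof
  show "inj_on (\<lambda>v. (+) v ` U) T"
    using assms by (auto simp: inj_on_def coset_eq_iff transversal_def)
  show "(\<lambda>v. (+) v ` U) ` T = cosets U V"
  proof
    show "(\<lambda>v. (+) v ` U) ` T \<subseteq> cosets U V"
      using assms(2) by (auto simp: cosets_def transversal_def)
    show "cosets U V \<subseteq> (\<lambda>v. (+) v ` U) ` T"
    proof
      fix X assume "X \<in> cosets U V"
      then obtain v where v: "v \<in> V" "X = (+) v ` U" by (auto simp: cosets_def)
      then obtain t where "t \<in> T" "v - t \<in> U" using assms(2) by (auto simp: transversal_def)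
      then show "X \<in> (\<lambda>v. (+) v ` U) ` T" using v coset_eq_iff[OF assms(1)] by blast
    qed
  qed
qed

lemma transversal_exists:
  assumes "add_subgroup U"
  obtains T where "transversal U V T"
proof -
  define r where "r X = (SOME v. v \<in> V \<and> X = (+) v ` U)" for X
  have r: "r X \<in> V \<and> X = (+) (r X) ` U" if "X \<in> cosets U V" for X
  proof -
    have "\<exists>v. v \<in> V \<and> X = (+) v ` U" using that unfolding cosets_def by blast
    then show ?thesis unfolding r_def by (rule someI_ex)
  qed
  have "transversal U V (r ` cosets U V)"
    unfolding transversal_def
  proof (intro conjI ballI impI)
    show "r ` cosets U V \<subseteq> V" using r by blast
  next
    fix s t assume "s \<in> r ` cosets U V" "t \<in> r ` cosets U V" and d: "s - t \<in> U"
    then obtain X Y where XY: "X \<in> cosets U V" "Y \<in> cosets U V" "s = r X" "t = r Y" by blast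
    have "(+) s ` U = (+) t ` U" using d coset_eq_iff[OF assms] by blast
    then have "X = Y" using r[OF XY(1)] r[OF XY(2)] XY(3,4) by argo
    then show "s = t" using XY by simp
  next
    fix v assume "v \<in> V"
    then have *: "(+) v ` U \<in> cosets U V" unfolding cosets_def by blast
    then have "(+) v ` U = (+) (r ((+) v ` U)) ` U" using r by blast
    then have "v - r ((+) v ` U) \<in> U" unfolding coset_eq_iff[OF assms] .
    then show "\<exists>t\<in>r ` cosets U V. v - t \<in> U" using * by blast
  qed
  then show thesis by (rule that)
qed

lemma card_transversal:
  assumes "add_subgroup U" "transversal U V T"
  shows "card T = card (cosets U V)" "finite T \<longleftrightarrow> finite (cosets U V)"
  using transversal_bij[OF assms] bij_betw_same_card bij_betw_finite by blast+

lemma cosets_nonempty: "add_subgroup V \<Longrightarrow> cosets U V \<noteq> {}"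
  using add_subgroup_0 by (force simp: cosets_def)

lemma card_cosets_pos: "add_subgroup V \<Longrightarrow> finite (cosets U V) \<Longrightarrow> 0 < card (cosets U V)"
  using cosets_nonempty by (auto simp: card_gt_0_iff)

text \<open>A transversal consists of incongruent elements; if it were infinite or too large, a
  finite part of it would break the bound. Finiteness of an index is thus reduced to an estimate for
  finite sets.\<close>

lemma cosets_bounded:
  assumes "add_subgroup U"
    and bound: "\<And>T. finite T \<Longrightarrow> T \<subseteq> V \<Longrightarrow> (\<And>s t. s \<in> T \<Longrightarrow> t \<in> T \<Longrightarrow> s - t \<in> U \<Longrightarrow> s = t)
      \<Longrightarrow> card T \<le> n"
  shows "finite (cosets U V)" "card (cosets U V) \<le> n"
proof -
  obtain T where T: "transversal U V T" using transversal_exists[OF assms(1)] .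
  have sub: "card T' \<le> n" if "finite T'" "T' \<subseteq> T" for T'
  proof (rule bound)
    show "T' \<subseteq> V" using that T by (auto simp: transversal_def)
    show "s = t" if "s \<in> T'" "t \<in> T'" "s - t \<in> U" for s t
      using T that \<open>T' \<subseteq> T\<close> unfolding transversal_def by blast
  qed fact
  have "finite T"
  proof (rule ccontr)
    assume "infinite T"
    then obtain T' where "T' \<subseteq> T" "finite T'" "card T' = Suc n"
      using infinite_arbitrarily_large by blast
    then show False using sub[of T'] by simp
  qed
  then show "finite (cosets U V)" "card (cosets U V) \<le> n"
    using sub[of T] card_transversal[OF assms(1) T] by auto
qed

lemma card_incongruent_le:
  assumes "add_subgroup U" "finite (cosets U V)" "T \<subseteq> V"
    and "\<And>s t. s \<in> T \<Longrightarrow> t \<in> T \<Longrightarrow> s - t \<in> U \<Longrightarrow> s = t"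
  shows "finite T" "card T \<le> card (cosets U V)"
proof -
  have inj: "inj_on (\<lambda>v. (+) v ` U) T"
    using assms(4) by (auto simp: inj_on_def coset_eq_iff[OF assms(1)])
  have sub: "(\<lambda>v. (+) v ` U) ` T \<subseteq> cosets U V"
    using assms(3) by (auto simp: cosets_def)
  show "finite T" using inj sub assms(2) by (meson finite_imageD finite_subset)
  show "card T \<le> card (cosets U V)" using card_inj_on_le[OF inj sub assms(2)] .
qed

text \<open>Additivity of \<open>f\<close> is not assumed: incongruent elements only have to stay
  incongruent, so that a finite incongruent set has an image of the same size.\<close>

lemma index_inj:
  assumes "add_subgroup U" "add_subgroup U'" "finite (cosets U' V')"
    and "\<And>v. v \<in> V \<Longrightarrow> f v \<in> V'"
    and "\<And>v w. v \<in> V \<Longrightarrow> w \<in> V \<Longrightarrow> f v - f w \<in> U' \<Longrightarrow> v - w \<in> U"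
  shows "finite (cosets U V)" "card (cosets U V) \<le> card (cosets U' V')"
proof -
  have "card T \<le> card (cosets U' V')"
    if T: "finite T" "T \<subseteq> V" "\<And>s t. s \<in> T \<Longrightarrow> t \<in> T \<Longrightarrow> s - t \<in> U \<Longrightarrow> s = t" for T
  proof -
    have eq: "s = t" if "s \<in> T" "t \<in> T" "f s - f t \<in> U'" for s t
      using that T assms(5) by blast
    then have "inj_on f T"
      using add_subgroup_0[OF assms(2)] by (auto simp: inj_on_def)
    then have "card T = card (f ` T)" by (simp add: card_image)
    also have "\<dots> \<le> card (cosets U' V')"
      using T(2) assms(4) eq by (intro card_incongruent_le[OF assms(2,3)]) auto
    finally show ?thesis .
  qed
  from cosets_bounded[OF assms(1) this]
  show "finite (cosets U V)" "card (cosets U V) \<le> card (cosets U' V')" by blast+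
qed

text \<open>A choice \<open>g\<close> of preimages modulo \<open>U'\<close> separates the classes of
  \<open>U'\<close>, so \<open>index_inj\<close> applies to \<open>g\<close> in the opposite
  direction.\<close>

lemma index_surj:
  assumes "add_subgroup U" "add_subgroup U'" "finite (cosets U V)"
    and "\<And>v w. v \<in> V \<Longrightarrow> w \<in> V \<Longrightarrow> v - w \<in> U \<Longrightarrow> f v - f w \<in> U'"
    and surj: "\<And>v'. v' \<in> V' \<Longrightarrow> \<exists>v\<in>V. v' - f v \<in> U'"
  shows "finite (cosets U' V')" "card (cosets U' V') \<le> card (cosets U V)"
proof -
  define g where "g v' = (SOME v. v \<in> V \<and> v' - f v \<in> U')" for v'
  have g: "g v' \<in> V \<and> v' - f (g v') \<in> U'" if "v' \<in> V'" for v'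
  proof -
    have "\<exists>v. v \<in> V \<and> v' - f v \<in> U'" using surj[OF that] by blast
    then show ?thesis unfolding g_def by (rule someI_ex)
  qed
  have "v - w \<in> U'" if "v \<in> V'" "w \<in> V'" "g v - g w \<in> U" for v w
  proof -
    have "f (g v) - f (g w) \<in> U'" using that g assms(4) by blast
    then have "(v - f (g v)) + (f (g v) - f (g w)) - (w - f (g w)) \<in> U'"
      using g that assms(2) by (meson add_subgroup_add add_subgroup_diff)
    then show ?thesis by simp
  qed
  note index_inj[OF assms(2,1,3) _ this, of V']
  then show "finite (cosets U' V')" "card (cosets U' V') \<le> card (cosets U V)"
    using g by blast+
qed

lemma index_iso:
  assumes "add_subgroup U" "add_subgroup U'"
    and "\<And>v. v \<in> V \<Longrightarrow> f v \<in> V'"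
    and "\<And>v w. v \<in> V \<Longrightarrow> w \<in> V \<Longrightarrow> f v - f w \<in> U' \<longleftrightarrow> v - w \<in> U"
    and "\<And>v'. v' \<in> V' \<Longrightarrow> \<exists>v\<in>V. v' - f v \<in> U'"
  shows "finite (cosets U' V') \<longleftrightarrow> finite (cosets U V)" "card (cosets U' V') = card (cosets U V)"
proof -
  have 1: "finite (cosets U V) \<and> card (cosets U V) \<le> card (cosets U' V')" if "finite (cosets U' V')"
    using index_inj[OF assms(1,2) that, of V f] assms(3,4) by blast
  have 2: "finite (cosets U' V') \<and> card (cosets U' V') \<le> card (cosets U V)" if "finite (cosets U V)"
    using index_surj[OF assms(1,2) that, of f V'] assms(4,5) by blast
  show "finite (cosets U' V') \<longleftrightarrow> finite (cosets U V)" using 1 2 by blast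
  show "card (cosets U' V') = card (cosets U V)"
    using 1 2 by (metis card.infinite le_antisym)
qed

text \<open>The sums \<open>s + t\<close> of elements of two transversals form a transversal of the
  whole tower. In the infinite case the product formula survives because \<open>card\<close> is then
  0 on both sides.\<close>

lemma index_tower:
  assumes "add_subgroup U" "add_subgroup V" "add_subgroup W" "U \<subseteq> V" "V \<subseteq> W"
  shows "finite (cosets U W) \<longleftrightarrow> finite (cosets U V) \<and> finite (cosets V W)"
    "card (cosets U W) = card (cosets U V) * card (cosets V W)"
proof -
  obtain S where S: "transversal U V S" using transversal_exists[OF assms(1)] .
  obtain T where T: "transversal V W T" using transversal_exists[OF assms(2)] .
  have inV: "s \<in> V" if "s \<in> S" for s using S that by (auto simp: transversal_def)
  have eq: "s = s' \<and> t = t'"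
    if *: "s \<in> S" "s' \<in> S" "t \<in> T" "t' \<in> T" "(s + t) - (s' + t') \<in> U" for s s' t t'
  proof -
    have "(s + t) - (s' + t') \<in> V" using * assms(4) by blast
    then have "(s + t) - (s' + t') - (s - s') \<in> V"
      using inV * assms(2) by (meson add_subgroup_diff)
    then have "t - t' \<in> V" by (simp add: algebra_simps)
    then have t: "t = t'" using T * by (auto simp: transversal_def)
    then have "s - s' \<in> U" using * by simp
    then show ?thesis using t S * by (auto simp: transversal_def)
  qed
  define f where "f = (\<lambda>(s, t). s + t :: 'a)"
  have inj: "inj_on f (S \<times> T)"
    unfolding inj_on_def f_def using eq add_subgroup_0[OF assms(1)] by auto
  have tr: "transversal U W (f ` (S \<times> T))"
    unfolding transversal_def
  proof (intro conjI ballI impI)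
    show "f ` (S \<times> T) \<subseteq> W"
      using S T assms(3,5) by (auto simp: transversal_def f_def intro!: add_subgroup_add)
    show "x = y" if "x \<in> f ` (S \<times> T)" "y \<in> f ` (S \<times> T)" "x - y \<in> U" for x y
      using that eq by (auto simp: f_def)
    show "\<exists>x\<in>f ` (S \<times> T). w - x \<in> U" if "w \<in> W" for w
    proof -
      obtain t where t: "t \<in> T" "w - t \<in> V" using T \<open>w \<in> W\<close> by (auto simp: transversal_def)
      then obtain s where "s \<in> S" "(w - t) - s \<in> U" using S by (auto simp: transversal_def)
      then show ?thesis using t
        by (intro bexI[of _ "f (s, t)"]) (auto simp: f_def algebra_simps)
    qed
  qed
  have ne: "S \<noteq> {}" "T \<noteq> {}"
    using S T add_subgroup_0[OF assms(2)] add_subgroup_0[OF assms(3)]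
    by (auto simp: transversal_def)
  have "finite (f ` (S \<times> T)) \<longleftrightarrow> finite S \<and> finite T"
    using ne inj by (simp add: finite_image_iff finite_cartesian_product_iff)
  then show "finite (cosets U W) \<longleftrightarrow> finite (cosets U V) \<and> finite (cosets V W)"
    using card_transversal(2)[OF assms(1) S] card_transversal(2)[OF assms(2) T]
      card_transversal(2)[OF assms(1) tr] by simp
  have "card (f ` (S \<times> T)) = card S * card T"
    using inj by (simp add: card_image card_cartesian_product)
  then show "card (cosets U W) = card (cosets U V) * card (cosets V W)"
    using card_transversal(1)[OF assms(1) S] card_transversal(1)[OF assms(2) T]
      card_transversal(1)[OF assms(1) tr] by simp
qed

lemma cosets_zero: "finite (cosets {0} V) \<longleftrightarrow> finite V" "card (cosets {0} V) = card V"
proof -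
  have "transversal {0} V V" by (auto simp: transversal_def)
  from card_transversal[OF add_subgroup_zero this]
  show "finite (cosets {0} V) \<longleftrightarrow> finite V" "card (cosets {0} V) = card V" by auto
qed

text \<open>Both factors are indices in the tower \<open>U \<subseteq> U + (V \<inter> N) \<subseteq> V\<close>.\<close>

lemma index_add_Int:
  assumes "add_subgroup U" "add_subgroup V" "add_subgroup N" "U \<subseteq> V"
  shows "finite (cosets U V) \<longleftrightarrow>
      finite (cosets (U \<inter> N) (V \<inter> N)) \<and> finite (cosets (sum_set U N) (sum_set V N))"
    "card (cosets U V) =
      card (cosets (U \<inter> N) (V \<inter> N)) * card (cosets (sum_set U N) (sum_set V N))"
proof -
  let ?M = "sum_set U (V \<inter> N)"
  have VN: "add_subgroup (V \<inter> N)" and UN: "add_subgroup (U \<inter> N)"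
    using assms by (auto intro: add_subgroup_Int)
  have M: "add_subgroup ?M" using assms VN by (intro add_subgroup_sum_set)
  have UM: "U \<subseteq> ?M" using sum_set_left[OF VN] by blast
  have MV: "?M \<subseteq> V"
  proof
    fix x assume "x \<in> ?M"
    then obtain u v where "u \<in> U" "v \<in> V \<inter> N" "x = u + v" by (rule sum_setE)
    then show "x \<in> V" using assms by (auto intro: add_subgroup_add)
  qed
  have surj1: "\<exists>v\<in>V \<inter> N. v' - v \<in> U" if "v' \<in> ?M" for v'
  proof -
    from that obtain u v where "u \<in> U" "v \<in> V \<inter> N" "v' = u + v" by (rule sum_setE)
    then show ?thesis by (intro bexI[of _ v]) auto
  qed
  have inj1: "v - w \<in> U \<longleftrightarrow> v - w \<in> U \<inter> N" if "v \<in> V \<inter> N" "w \<in> V \<inter> N" for v w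
    using that assms(3) by (auto intro: add_subgroup_diff)
  note iso1 = index_iso[where f = "\<lambda>x. x", OF UN assms(1) sum_set_right[OF assms(1)] inj1 surj1]
  have surj2: "\<exists>v\<in>V. v' - v \<in> sum_set U N" if "v' \<in> sum_set V N" for v'
  proof -
    from that obtain v n where "v \<in> V" "n \<in> N" "v' = v + n" by (rule sum_setE)
    then show ?thesis
      using sum_set_right[OF assms(1)] by (intro bexI[of _ v]) auto
  qed
  have inj2: "v - w \<in> sum_set U N \<longleftrightarrow> v - w \<in> ?M" if *: "v \<in> V" "w \<in> V" for v w
  proof
    assume "v - w \<in> sum_set U N"
    then obtain u n where un: "u \<in> U" "n \<in> N" "v - w = u + n" by (rule sum_setE)
    have "(v - w) - u \<in> V"
      using * un assms by (meson add_subgroup_diff subsetD)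
    then have "n \<in> V \<inter> N" using un by simp
    then show "v - w \<in> ?M" using un by (auto intro: sum_setI)
  next
    assume "v - w \<in> ?M"
    then show "v - w \<in> sum_set U N" using sum_set_mono[of U U "V \<inter> N" N] by blast
  qed
  note iso2 = index_iso[where f = "\<lambda>x. x", OF M add_subgroup_sum_set[OF assms(1,3)]
      sum_set_left[OF assms(3)] inj2 surj2]
  show "finite (cosets U V) \<longleftrightarrow>
      finite (cosets (U \<inter> N) (V \<inter> N)) \<and> finite (cosets (sum_set U N) (sum_set V N))"
    "card (cosets U V) =
      card (cosets (U \<inter> N) (V \<inter> N)) * card (cosets (sum_set U N) (sum_set V N))"
    using index_tower[OF assms(1) M assms(2) UM MV] iso1 iso2 by auto
qed

lemma card_cosets_eq_1:
  assumes "add_subgroup U" "add_subgroup V" "U \<subseteq> V" "card (cosets U V) = 1"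
  shows "U = V"
proof -
  obtain X where X: "cosets U V = {X}" using assms(4) card_1_singletonE by blast
  have "v \<in> U" if "v \<in> V" for v
  proof -
    have "(+) v ` U \<in> cosets U V" "(+) 0 ` U \<in> cosets U V"
      using that add_subgroup_0[OF assms(2)] unfolding cosets_def by blast+
    then have "(+) v ` U = (+) 0 ` U" using X by simp
    then show ?thesis unfolding coset_eq_iff[OF assms(1)] by simp
  qed
  then show ?thesis using assms(3) by blast
qed

lemma card_cosets_self:
  assumes "add_subgroup U"
  shows "card (cosets U U) = 1"
proof -
  have "transversal U U {0}"
    using assms by (auto simp: transversal_def add_subgroup_0)
  then show ?thesis using card_transversal(1)[OF assms] by fastforce
qed

section \<open>Bases and functionals modulo a subspace of finite index\<close>

definition basis_mod ::
    "('f::{field,finite} \<Rightarrow> 'a::ab_group_add \<Rightarrow> 'a) \<Rightarrow> 'a set \<Rightarrow> 'a set \<Rightarrow> 'a set \<Rightarrow> bool" where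
  "basis_mod sc U V S \<longleftrightarrow> finite S \<and> S \<subseteq> V \<and>
    (\<forall>v\<in>V. \<exists>!c. c \<in> S \<rightarrow>\<^sub>E UNIV \<and> v - (\<Sum>s\<in>S. sc (c s) s) \<in> U)"

context vector_space
begin

lemma add_subgroup_subspace: "subspace U \<Longrightarrow> add_subgroup U"
  by (auto intro!: add_subgroupI subspace_0 subspace_diff)

end

text \<open>A transversal is a finite spanning set, so a spanning set of least size exists. A
  relation with a nonzero coefficient would allow one element to be dropped.\<close>

lemma basis_mod_exists:
  fixes sc :: "'f::{field,finite} \<Rightarrow> 'a::ab_group_add \<Rightarrow> 'a"
  assumes vs: "vector_space sc" and U: "module.subspace sc U" and V: "module.subspace sc V"
    and fin: "finite (cosets U V)"
  obtains S where "basis_mod sc U V S"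
proof -
  interpret vector_space sc by fact
  have gU: "add_subgroup U" using U by (rule add_subgroup_subspace)
  define spans where "spans S \<longleftrightarrow> finite S \<and> S \<subseteq> V \<and>
    (\<forall>v\<in>V. \<exists>c. v - (\<Sum>s\<in>S. sc (c s) s) \<in> U)" for S
  obtain T where T: "transversal U V T" using transversal_exists[OF gU] .
  have finT: "finite T" using card_transversal[OF gU T] fin by simp
  have "spans T"
    unfolding spans_def
  proof (intro conjI ballI)
    show "T \<subseteq> V" using T by (simp add: transversal_def)
    fix v assume "v \<in> V"
    then obtain t where t: "t \<in> T" "v - t \<in> U" using T by (auto simp: transversal_def)
    have "(\<Sum>s\<in>T. sc (if s = t then 1 else 0) s) = (\<Sum>s\<in>T. if s = t then s else 0)"
      by (intro sum.cong) auto
    also have "\<dots> = t" using t finT by simp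
    finally show "\<exists>c. v - (\<Sum>s\<in>T. sc (c s) s) \<in> U" using t by metis
  qed fact
  then have "\<exists>n. \<exists>S. spans S \<and> card S = n" by blast
  define n where "n = (LEAST n. \<exists>S. spans S \<and> card S = n)"
  have "\<exists>S. spans S \<and> card S = n"
    unfolding n_def by (rule LeastI_ex) fact
  then obtain S where S: "spans S" "card S = n" by blast
  have min: "n \<le> card S'" if "spans S'" for S'
    unfolding n_def using that by (intro Least_le) blast
  have finS: "finite S" and SV: "S \<subseteq> V" using S(1) by (auto simp: spans_def)
  have ex: "\<exists>c. v - (\<Sum>s\<in>S. sc (c s) s) \<in> U" if "v \<in> V" for v
    using S(1) that by (auto simp: spans_def)
  have indep: "c s0 = 0" if "(\<Sum>s\<in>S. sc (c s) s) \<in> U" "s0 \<in> S" for c s0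
  proof (rule ccontr)
    assume c0: "c s0 \<noteq> 0"
    have "spans (S - {s0})"
      unfolding spans_def
    proof (intro conjI ballI)
      fix v assume "v \<in> V"
      then obtain d where d: "v - (\<Sum>s\<in>S. sc (d s) s) \<in> U" using ex by blast
      \<comment> \<open>Adding \<open>k\<close> times the relation cancels the coefficient of
        \<open>s0\<close>.\<close>
      define k where "k = d s0 / c s0"
      have "v - (\<Sum>s\<in>S. sc (d s) s) + sc k (\<Sum>s\<in>S. sc (c s) s) \<in> U"
        using d that(1) U by (auto intro: subspace_add subspace_scale)
      also have "v - (\<Sum>s\<in>S. sc (d s) s) + sc k (\<Sum>s\<in>S. sc (c s) s)
          = v - (\<Sum>s\<in>S. sc (d s - k * c s) s)"
        by (simp add: scale_left_diff_distrib sum_subtractf scale_sum_right)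
      also have "(\<Sum>s\<in>S. sc (d s - k * c s) s) = (\<Sum>s\<in>S - {s0}. sc (d s - k * c s) s)"
        using c0 finS that(2) by (subst sum.remove[of S s0]) (auto simp: k_def)
      finally show "\<exists>c. v - (\<Sum>s\<in>S - {s0}. sc (c s) s) \<in> U"
        by (intro exI[of _ "\<lambda>s. d s - k * c s"])
    qed (use finS SV in auto)
    from min[OF this] S(2) finS that(2) show False
      by (metis card_Diff1_less not_le)
  qed
  have "basis_mod sc U V S"
    unfolding basis_mod_def
  proof (intro conjI ballI)
    fix v assume "v \<in> V"
    then obtain c where c: "v - (\<Sum>s\<in>S. sc (c s) s) \<in> U" using ex by blast
    show "\<exists>!c. c \<in> S \<rightarrow>\<^sub>E UNIV \<and> v - (\<Sum>s\<in>S. sc (c s) s) \<in> U"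
    proof (rule ex1I[of _ "restrict c S"])
      show "restrict c S \<in> S \<rightarrow>\<^sub>E UNIV \<and> v - (\<Sum>s\<in>S. sc (restrict c S s) s) \<in> U"
        using c by auto
      fix d assume d: "d \<in> S \<rightarrow>\<^sub>E UNIV \<and> v - (\<Sum>s\<in>S. sc (d s) s) \<in> U"
      then have "(v - (\<Sum>s\<in>S. sc (c s) s)) - (v - (\<Sum>s\<in>S. sc (d s) s)) \<in> U"
        using c subspace_diff[OF U] by blast
      also have "(v - (\<Sum>s\<in>S. sc (c s) s)) - (v - (\<Sum>s\<in>S. sc (d s) s)) =
          (\<Sum>s\<in>S. sc (d s - c s) s)"
        by (simp add: scale_left_diff_distrib sum_subtractf)
      finally have "d s - c s = 0" if "s \<in> S" for s
        using indep[of "\<lambda>s. d s - c s"] that by blast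
      then show "d = restrict c S"
        using d by (intro PiE_ext[of _ S "\<lambda>_. UNIV"]) auto
    qed
  qed (use finS SV in auto)
  then show thesis by (rule that)
qed

text \<open>The linear combinations of \<open>S\<close> form a transversal, and uniqueness of
  coefficients makes them correspond to the functions from \<open>S\<close> to the field.\<close>

lemma card_basis_mod:
  fixes sc :: "'f::{field,finite} \<Rightarrow> 'a::ab_group_add \<Rightarrow> 'a"
  assumes vs: "vector_space sc" and U: "module.subspace sc U" and V: "module.subspace sc V"
    and S: "basis_mod sc U V S"
  shows "finite (cosets U V)" "card (cosets U V) = CARD('f) ^ card S"
proof -
  interpret vector_space sc by fact
  have gU: "add_subgroup U" using U by (rule add_subgroup_subspace)
  have finS: "finite S" and SV: "S \<subseteq> V" using S by (auto simp: basis_mod_def)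
  have ex1: "\<exists>!c. c \<in> S \<rightarrow>\<^sub>E UNIV \<and> v - (\<Sum>s\<in>S. sc (c s) s) \<in> U" if "v \<in> V" for v
    using S that by (auto simp: basis_mod_def)
  define f where "f c = (\<Sum>s\<in>S. sc (c s) s)" for c
  have fV: "f c \<in> V" for c
    unfolding f_def using SV V by (auto intro!: subspace_sum subspace_scale)
  have eq: "c = d" if "c \<in> S \<rightarrow>\<^sub>E UNIV" "d \<in> S \<rightarrow>\<^sub>E UNIV" "f c - f d \<in> U" for c d
    using ex1[OF fV[of c]] that subspace_0[OF U] unfolding f_def by (metis diff_self)
  have inj: "inj_on f (S \<rightarrow>\<^sub>E UNIV)"
    using eq subspace_0[OF U] by (auto simp: inj_on_def)
  have tr: "transversal U V (f ` (S \<rightarrow>\<^sub>E UNIV))"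
    unfolding transversal_def
  proof (intro conjI ballI impI)
    show "\<exists>t\<in>f ` (S \<rightarrow>\<^sub>E UNIV). v - t \<in> U" if "v \<in> V" for v
      using ex1[OF that] unfolding f_def by blast
  qed (use fV eq in auto)
  have fin: "finite (S \<rightarrow>\<^sub>E (UNIV :: 'f set))" using finS by (intro finite_PiE) auto
  show "finite (cosets U V)"
    using card_transversal(2)[OF gU tr] fin by simp
  have "card (cosets U V) = card (S \<rightarrow>\<^sub>E (UNIV :: 'f set))"
    using card_transversal(1)[OF gU tr] card_image[OF inj] by simp
  then show "card (cosets U V) = CARD('f) ^ card S"
    using finS by (simp add: card_PiE)
qed

text \<open>A functional that vanishes on \<open>U\<close> is determined by its values on a basis
  modulo \<open>U\<close>. Membership in \<open>extensional V\<close> turns agreement on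
  \<open>V\<close> into equality, so that functionals can be counted; the bound later drives the
  pigeonhole argument for differentials.\<close>

lemma card_functionals_le:
  fixes sc :: "'f::{field,finite} \<Rightarrow> 'a::ab_group_add \<Rightarrow> 'a"
  assumes vs: "vector_space sc" and U: "module.subspace sc U" and V: "module.subspace sc V"
    and fin: "finite (cosets U V)"
    and L: "\<And>\<omega>. \<omega> \<in> L \<Longrightarrow> \<omega> \<in> extensional V"
      "\<And>\<omega> x y. \<omega> \<in> L \<Longrightarrow> x \<in> V \<Longrightarrow> y \<in> V \<Longrightarrow> \<omega> (x + y) = \<omega> x + \<omega> y"
      "\<And>\<omega> c x. \<omega> \<in> L \<Longrightarrow> x \<in> V \<Longrightarrow> \<omega> (sc c x) = c * \<omega> x"
      "\<And>\<omega> x. \<omega> \<in> L \<Longrightarrow> x \<in> U \<Longrightarrow> \<omega> x = (0::'f)"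
    and UV: "U \<subseteq> V"
  shows "finite L" "card L \<le> card (cosets U V)"
proof -
  interpret vector_space sc by fact
  obtain S where S: "basis_mod sc U V S" using basis_mod_exists[OF vs U V fin] .
  have finS: "finite S" and SV: "S \<subseteq> V" using S by (auto simp: basis_mod_def)
  have ex1: "\<exists>!c. c \<in> S \<rightarrow>\<^sub>E UNIV \<and> v - (\<Sum>s\<in>S. sc (c s) s) \<in> U" if "v \<in> V" for v
    using S that by (auto simp: basis_mod_def)
  have lin: "\<omega> (\<Sum>s\<in>T. sc (c s) s) = (\<Sum>s\<in>T. c s * \<omega> s)" if "\<omega> \<in> L" "finite T" "T \<subseteq> V" for \<omega> c T
    using that(2,3)
  proof (induction T)
    case empty
    then show ?case using L(4)[OF that(1) subspace_0[OF U]] by simp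
  next
    case (insert t T)
    then have "sc (c t) t \<in> V" "(\<Sum>s\<in>T. sc (c s) s) \<in> V"
      using V by (auto intro!: subspace_sum subspace_scale)
    then show ?case using insert L(2,3)[OF that(1)] by simp
  qed
  have inj: "inj_on (\<lambda>\<omega>. restrict \<omega> S) L"
  proof (rule inj_onI)
    fix \<omega> \<eta> assume *: "\<omega> \<in> L" "\<eta> \<in> L" "restrict \<omega> S = restrict \<eta> S"
    have eqS: "\<omega> s = \<eta> s" if "s \<in> S" for s using *(3) that by (metis restrict_apply')
    show "\<omega> = \<eta>"
    proof (rule extensionalityI[of _ V])
      fix v assume v: "v \<in> V"
      then obtain c where c: "v - (\<Sum>s\<in>S. sc (c s) s) \<in> U" using ex1 by blast
      have 1: "(\<Sum>s\<in>S. sc (c s) s) \<in> V"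
        using SV V by (auto intro!: subspace_sum subspace_scale)
      have val: "\<rho> v = (\<Sum>s\<in>S. c s * \<rho> s)" if "\<rho> \<in> L" for \<rho>
      proof -
        have "\<rho> v = \<rho> ((v - (\<Sum>s\<in>S. sc (c s) s)) + (\<Sum>s\<in>S. sc (c s) s))" by simp
        also have "\<dots> = \<rho> (\<Sum>s\<in>S. sc (c s) s)"
          using L(2)[OF that subsetD[OF UV c] 1] L(4)[OF that c] by simp
        finally show ?thesis using lin[OF that finS SV] by simp
      qed
      show "\<omega> v = \<eta> v" using val[OF *(1)] val[OF *(2)] eqS by simp
    qed (use * L(1) in auto)
  qed
  have fin': "finite (S \<rightarrow>\<^sub>E (UNIV :: 'f set))" using finS by (intro finite_PiE) auto
  have sub: "(\<lambda>\<omega>. restrict \<omega> S) ` L \<subseteq> S \<rightarrow>\<^sub>E UNIV" by auto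
  show "finite L" using inj sub fin' by (meson finite_imageD finite_subset)
  have "card L \<le> card (S \<rightarrow>\<^sub>E (UNIV :: 'f set))" using card_inj_on_le[OF inj sub fin'] .
  then show "card L \<le> card (cosets U V)"
    using finS card_basis_mod(2)[OF vs U V S] by (simp add: card_PiE)
qed

subsection \<open>Counting over a rational subfield\<close>

lemma card_polys_degree_le:
  "finite {p :: 'f::{field,finite} poly. degree p \<le> d} \<and>
   card {p :: 'f poly. degree p \<le> d} = CARD('f) ^ Suc d"
proof (induction d)
  case 0
  have "{p :: 'f poly. degree p \<le> 0} = range (\<lambda>a. [:a:])"
    by (auto elim!: degree_eq_zeroE)
  moreover have "inj (\<lambda>a :: 'f. [:a:])" by (auto simp: inj_def)
  ultimately show ?case by (simp add: card_image)
next
  case (Suc d)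
  let ?f = "\<lambda>(a, p). pCons a p :: 'f poly"
  have "p \<in> ?f ` (UNIV \<times> {p. degree p \<le> d})" if "degree p \<le> Suc d" for p
    using that by (cases p) (auto split: if_splits)
  then have "{p :: 'f poly. degree p \<le> Suc d} = ?f ` (UNIV \<times> {p. degree p \<le> d})"
    by (auto split: if_splits)
  moreover have "inj_on ?f (UNIV \<times> {p. degree p \<le> d})" by (auto simp: inj_on_def)
  ultimately show ?case using Suc by (simp add: card_image card_cartesian_product)
qed

context curve
begin

lemma const_0 [simp]: "\<iota> 0 = 0"
  using const_add[of 0 0] by (metis add_cancel_right_left add_0)

lemma const_1 [simp]: "\<iota> 1 = 1"
  by (rule const_one)

lemma const_minus: "\<iota> (- a) = - \<iota> a"
  using const_add[of a "- a"] by (simp add: eq_neg_iff_add_eq_0 add.commute)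

lemma const_diff: "\<iota> (a - b) = \<iota> a - \<iota> b"
  using const_add[of a "- b"] by (simp add: const_minus)

lemma const_eq_0 [simp]: "\<iota> a = 0 \<longleftrightarrow> a = 0"
proof
  assume "\<iota> a = 0"
  then have "\<iota> (a * inverse a) = 0" by (simp add: const_mult)
  then show "a = 0" by (cases "a = 0") auto
qed simp

lemma inj_const: "inj \<iota>"
  unfolding inj_def using const_diff const_eq_0 by (metis diff_eq_diff_eq diff_self)

lemma vector_space_field: "vector_space (\<lambda>c f. \<iota> c * f)"
  by unfold_locales (auto simp: const_add const_mult algebra_simps)

lemma vector_space_fun: "vector_space (\<lambda>c (\<alpha> :: 'b \<Rightarrow> 'k) Q. \<iota> c * \<alpha> Q)"
  by unfold_locales (auto simp: const_add const_mult algebra_simps fun_eq_iff)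

section \<open>Polynomials in a transcendental element as coefficients\<close>

definition ev :: "'k \<Rightarrow> 'f poly \<Rightarrow> 'k" where
  "ev x p = poly (map_poly \<iota> p) x"

lemma ev_0 [simp]: "ev x 0 = 0"
  by (simp add: ev_def)

lemma ev_pCons [simp]: "ev x (pCons a p) = \<iota> a + x * ev x p"
  by (cases "a = 0 \<and> p = 0") (auto simp: ev_def map_poly_pCons)

lemma ev_1 [simp]: "ev x 1 = 1"
  by (simp add: one_pCons)

lemma ev_add: "ev x (p + q) = ev x p + ev x q"
  by (induction p q rule: poly_induct2) (simp_all add: const_add algebra_simps)

lemma ev_smult: "ev x (smult c p) = \<iota> c * ev x p"
  by (induction p) (simp_all add: const_mult algebra_simps)

lemma ev_minus: "ev x (- p) = - ev x p"
  using ev_smult[of x "-1" p] by (simp add: const_minus)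

lemma ev_diff: "ev x (p - q) = ev x p - ev x q"
  using ev_add[of x p "- q"] by (simp add: ev_minus)

lemma ev_mult: "ev x (p * q) = ev x p * ev x q"
  by (induction p) (simp_all add: ev_add ev_smult algebra_simps)

text \<open>Spanning over the rational functions in \<open>x\<close> with denominators cleared: a
  single factor \<open>g\<close> moves to the left, so only polynomial coefficients remain and
  degrees can be counted.\<close>

definition spanning :: "'k \<Rightarrow> 'k set \<Rightarrow> bool" where
  "spanning x B \<longleftrightarrow> finite B \<and>
    (\<forall>y. \<exists>g p. g \<noteq> 0 \<and> ev x g * y = (\<Sum>b\<in>B. ev x (p b) * b))"

lemma ev_eq_0_iff:
  assumes "\<not> algebraic_over \<iota> x"
  shows "ev x p = 0 \<longleftrightarrow> p = 0"
  using assms by (auto simp: algebraic_over_def ev_def)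

lemma spanning_exists:
  assumes tr: "\<not> algebraic_over \<iota> x" and fin: "finite_over (simple_subfield \<iota> x)"
  obtains B where "spanning x B"
proof -
  obtain B where B: "finite B"
    and ex: "\<And>y. \<exists>c. (\<forall>b\<in>B. c b \<in> simple_subfield \<iota> x) \<and> y = (\<Sum>b\<in>B. c b * b)"
    using fin unfolding finite_over_def by blast
  have "\<exists>g p. g \<noteq> 0 \<and> ev x g * y = (\<Sum>b\<in>B. ev x (p b) * b)" for y
  proof -
    obtain c where c: "\<forall>b\<in>B. c b \<in> simple_subfield \<iota> x" "y = (\<Sum>b\<in>B. c b * b)"
      using ex by blast
    have "\<forall>b\<in>B. \<exists>p q. c b = ev x p / ev x q \<and> ev x q \<noteq> 0"
      using c(1) unfolding simple_subfield_def ev_def by blast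
    then obtain p q where pq: "\<And>b. b \<in> B \<Longrightarrow> c b = ev x (p b) / ev x (q b) \<and> ev x (q b) \<noteq> 0"
      by metis
    define g where "g = prod q B"
    have "q b \<noteq> 0" if "b \<in> B" for b using pq[OF that] by auto
    then have "g \<noteq> 0" using B by (simp add: g_def)
    have "ev x g * c b = ev x (p b * prod q (B - {b}))" if "b \<in> B" for b
    proof -
      have "g = q b * prod q (B - {b})" unfolding g_def using B that by (rule prod.remove)
      then show ?thesis using pq[OF that] by (simp add: ev_mult)
    qed
    then have "ev x g * y = (\<Sum>b\<in>B. ev x (p b * prod q (B - {b})) * b)"
      unfolding c(2) sum_distrib_left by (intro sum.cong) (auto simp: mult.assoc[symmetric])
    with \<open>g \<noteq> 0\<close> show ?thesis by (intro exI[of _ g] exI[of _ "\<lambda>b. p b * prod q (B - {b})"] conjI)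
  qed
  then show thesis using that[of B] B by (simp add: spanning_def)
qed

end

text \<open>A transcendental \<open>x\<close> and a basis over the rational functions in it give the
  proof a degree to measure growth with. The theorem does not mention them; they are chosen at its
  beginning.\<close>

locale curve_basis = curve \<iota> for \<iota> :: "'f::{field,finite} \<Rightarrow> 'k::field" +
  fixes x :: 'k and Bs :: "'k set"
  assumes transcendental: "\<not> algebraic_over \<iota> x"
    and spanning: "spanning x Bs"
    and independent: "(\<Sum>b\<in>Bs. ev x (p b) * b) = 0 \<Longrightarrow> b \<in> Bs \<Longrightarrow> p b = 0"

lemma (in curve) curve_basis_exists:
  obtains x Bs where "curve_basis \<iota> x Bs"
proof -
  obtain x where x: "\<not> algebraic_over \<iota> x" "finite_over (simple_subfield \<iota> x)"
    using transcendence_degree_one by blast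
  have ex: "\<exists>n. \<exists>B. spanning x B \<and> card B = n" using spanning_exists[OF x] by metis
  define n where "n = (LEAST n. \<exists>B. spanning x B \<and> card B = n)"
  have "\<exists>B. spanning x B \<and> card B = n" unfolding n_def using ex by (rule LeastI_ex)
  then obtain B where B: "spanning x B" "card B = n" by blast
  have finB: "finite B" using B by (simp add: spanning_def)
  have min: "n \<le> card B'" if "spanning x B'" for B'
    unfolding n_def using that by (intro Least_le) blast
  have "r b0 = 0" if r: "(\<Sum>b\<in>B. ev x (r b) * b) = 0" and b0: "b0 \<in> B" for r b0
  proof (rule ccontr)
    assume r0: "r b0 \<noteq> 0"
    have "spanning x (B - {b0})"
      unfolding spanning_def
    proof (intro conjI allI)
      fix y
      obtain g p where gp: "g \<noteq> 0" "ev x g * y = (\<Sum>b\<in>B. ev x (p b) * b)"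
        using B unfolding spanning_def by blast
      \<comment> \<open>Cross-multiplication cancels the coefficient of \<open>b0\<close> without
        division, so the coefficients stay polynomials. The price is the extra factor
        \<open>r b0\<close> in front of \<open>y\<close>.\<close>
      define s where "s b = r b0 * p b - p b0 * r b" for b
      have "ev x (r b0 * g) * y = ev x (r b0) * (\<Sum>b\<in>B. ev x (p b) * b)
          - ev x (p b0) * (\<Sum>b\<in>B. ev x (r b) * b)"
        using gp(2) r by (simp add: ev_mult mult.assoc)
      also have "\<dots> = (\<Sum>b\<in>B. ev x (s b) * b)"
        unfolding s_def sum_distrib_left sum_subtractf[symmetric]
        by (intro sum.cong) (auto simp: ev_mult ev_diff algebra_simps)
      also have "\<dots> = (\<Sum>b\<in>B - {b0}. ev x (s b) * b)"
        using finB b0 by (subst sum.remove[of B b0]) (auto simp: s_def)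
      finally show "\<exists>g p. g \<noteq> 0 \<and> ev x g * y = (\<Sum>b\<in>B - {b0}. ev x (p b) * b)"
        using gp(1) r0 by (intro exI[of _ "r b0 * g"] exI[of _ s]) simp
    qed (use finB in auto)
    from min[OF this] B(2) finB b0 show False
      by (metis card_Diff1_less not_le)
  qed
  then have "curve_basis \<iota> x B"
    using x B(1) by unfold_locales auto
  then show thesis by (rule that)
qed

context curve_basis
begin

abbreviation "N \<equiv> card Bs"

lemma ev_x_eq_0 [simp]: "ev x p = 0 \<longleftrightarrow> p = 0"
  using ev_eq_0_iff[OF transcendental] .

lemma finite_Bs: "finite Bs"
  using spanning by (simp add: spanning_def)

text \<open>A finite box exhausting the span of the basis over the polynomials in \<open>x\<close>.
  The exponent in its cardinality grows with slope \<open>N\<close> in \<open>d\<close>, which is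
  where every bound in terms of \<open>N\<close> comes from.\<close>

definition V :: "nat \<Rightarrow> 'k set" where
  "V d = (\<lambda>p. \<Sum>b\<in>Bs. ev x (p b) * b) ` (Bs \<rightarrow>\<^sub>E {p. degree p \<le> d})"

lemma VI: "(\<And>b. b \<in> Bs \<Longrightarrow> degree (p b) \<le> d) \<Longrightarrow> (\<Sum>b\<in>Bs. ev x (p b) * b) \<in> V d"
  unfolding V_def by (rule image_eqI[of _ _ "restrict p Bs"]) auto

lemma VE:
  assumes "v \<in> V d"
  obtains p where "\<And>b. b \<in> Bs \<Longrightarrow> degree (p b) \<le> d" "v = (\<Sum>b\<in>Bs. ev x (p b) * b)"
  using assms unfolding V_def by (auto simp: PiE_iff)

lemma card_V: "finite (V d)" "card (V d) = CARD('f) ^ (N * Suc d)"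
proof -
  let ?f = "\<lambda>p. \<Sum>b\<in>Bs. ev x (p b) * b" and ?X = "Bs \<rightarrow>\<^sub>E {p :: 'f poly. degree p \<le> d}"
  have "inj_on ?f ?X"
  proof (rule inj_onI)
    fix r s assume rs: "r \<in> ?X" "s \<in> ?X" "?f r = ?f s"
    then have "(\<Sum>b\<in>Bs. ev x (r b - s b) * b) = 0"
      by (simp add: ev_diff left_diff_distrib sum_subtractf)
    then have "r b - s b = 0" if "b \<in> Bs" for b using independent[of "\<lambda>b. r b - s b"] that by blast
    then show "r = s" using rs by (intro PiE_ext) auto
  qed
  then have "card (V d) = card ?X" by (simp add: V_def card_image)
  also have "\<dots> = (CARD('f) ^ Suc d) ^ N"
    using finite_Bs card_polys_degree_le[where ?'f = 'f, of d] by (simp add: card_PiE)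
  finally show "card (V d) = CARD('f) ^ (N * Suc d)"
    by (metis mult.commute power_mult)
  show "finite (V d)"
    using finite_Bs card_polys_degree_le[where ?'f = 'f, of d] by (auto simp: V_def intro!: finite_PiE)
qed

lemma V_mono: "d \<le> e \<Longrightarrow> V d \<subseteq> V e"
  by (auto elim!: VE intro!: VI intro: order_trans)

lemma V_add:
  assumes "v \<in> V d" "w \<in> V d"
  shows "v + w \<in> V d"
proof -
  obtain p r where "\<And>b. b \<in> Bs \<Longrightarrow> degree (p b) \<le> d" "v = (\<Sum>b\<in>Bs. ev x (p b) * b)"
    "\<And>b. b \<in> Bs \<Longrightarrow> degree (r b) \<le> d" "w = (\<Sum>b\<in>Bs. ev x (r b) * b)"
    using assms by (elim VE) auto
  then have "v + w = (\<Sum>b\<in>Bs. ev x (p b + r b) * b)" "\<And>b. b \<in> Bs \<Longrightarrow> degree (p b + r b) \<le> d"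
    by (auto simp: ev_add distrib_right sum.distrib intro: degree_add_le)
  then show ?thesis using VI[of "\<lambda>b. p b + r b" d] by simp
qed

lemma V_mult:
  assumes "v \<in> V d"
  shows "ev x g * v \<in> V (d + degree g)"
proof -
  obtain p where p: "\<And>b. b \<in> Bs \<Longrightarrow> degree (p b) \<le> d" "v = (\<Sum>b\<in>Bs. ev x (p b) * b)"
    using assms by (elim VE) auto
  have "ev x g * v = (\<Sum>b\<in>Bs. ev x (g * p b) * b)"
    unfolding p(2) by (simp add: sum_distrib_left ev_mult mult.assoc)
  moreover have "degree (g * p b) \<le> d + degree g" if "b \<in> Bs" for b
    using degree_mult_le[of g "p b"] p(1)[OF that] by linarith
  ultimately show ?thesis using VI[of "\<lambda>b. g * p b" "d + degree g"] by simp
qed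

lemma V_0: "0 \<in> V d"
  using VI[of "\<lambda>_. 0" d] by simp

lemma V_sum: "(\<And>i. i \<in> I \<Longrightarrow> f i \<in> V d) \<Longrightarrow> sum f I \<in> V d"
  by (induction I rule: infinite_finite_induct) (auto intro: V_0 V_add)

lemma common_denominator:
  assumes "finite U"
  obtains g c where "g \<noteq> 0" "\<And>u. u \<in> U \<Longrightarrow> ev x g * u \<in> V c"
proof -
  have "\<exists>g c. g \<noteq> 0 \<and> (\<forall>u\<in>U. ev x g * u \<in> V c)"
    using assms
  proof (induction U)
    case empty
    show ?case by (rule exI[of _ 1]) auto
  next
    case (insert u U)
    then obtain g c where g: "g \<noteq> 0" "\<forall>u\<in>U. ev x g * u \<in> V c" by blast
    obtain h p where h: "h \<noteq> 0" "ev x h * u = (\<Sum>b\<in>Bs. ev x (p b) * b)"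
      using spanning unfolding spanning_def by blast
    define d where "d = (\<Sum>b\<in>Bs. degree (p b))"
    have "ev x h * u \<in> V d"
      unfolding h(2) d_def using finite_Bs by (intro VI member_le_sum) auto
    then have 1: "ev x (g * h) * u \<in> V (d + degree g)"
      using V_mult[of "ev x h * u" d g] by (simp add: ev_mult mult.assoc)
    have 2: "ev x (g * h) * u' \<in> V (c + degree h)" if "u' \<in> U" for u'
      using V_mult[of "ev x g * u'" c h] g(2) that by (simp add: ev_mult mult_ac)
    let ?e = "d + degree g + (c + degree h)"
    have "\<forall>u\<in>insert u U. ev x (g * h) * u \<in> V ?e"
      using 1 2 V_mono[of "d + degree g" ?e] V_mono[of "c + degree h" ?e] by auto
    moreover have "g * h \<noteq> 0" using g h by simp
    ultimately show ?case by blast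
  qed
  then show thesis using that by blast
qed

text \<open>
  The Horner sums \<open>u\<^sub>0 + w u\<^sub>1 + \<dots> + w\<^sup>d u\<^sub>d\<close> with digits from pairwise incongruent elements
  are distinct, while after clearing denominators they lie in a space whose dimension grows
  like \<open>N * e * d\<close>.
\<close>

lemma card_incongruent_bound:
  assumes R: "add_subgroup R" "\<And>r. r \<in> R \<Longrightarrow> w * r \<in> R"
    and w: "w \<noteq> 0" and h: "h \<noteq> 0" "degree h \<le> e"
    and step: "\<And>d v. v \<in> V d \<Longrightarrow> ev x h * w * v \<in> V (d + e)"
    and U: "finite U" "U \<subseteq> R" "\<And>u v. u \<in> U \<Longrightarrow> v \<in> U \<Longrightarrow> u - v \<in> (*) w ` R \<Longrightarrow> u = v"
  shows "card U \<le> CARD('f) ^ (N * e)"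
proof -
  define \<phi> where "\<phi> = horner_sum (\<lambda>u. u) w"
  have \<phi>: "\<phi> [] = 0" "\<phi> (u # us) = u + w * \<phi> us" for u us by (simp_all add: \<phi>_def)
  have \<phi>R: "\<phi> us \<in> R" if "set us \<subseteq> U" for us
    using that
  proof (induction us)
    case (Cons u us)
    then show ?case using R U(2) by (auto simp: \<phi> intro!: add_subgroup_add)
  qed (use R in \<open>auto simp: \<phi> add_subgroup_0\<close>)
  \<comment> \<open>Equal Horner sums have first digits congruent modulo w R, hence equal; these are
    subtracted and \<open>w\<close> is cancelled.\<close>
  have \<phi>_inj: "us = vs" if "length us = length vs" "set us \<subseteq> U" "set vs \<subseteq> U" "\<phi> us = \<phi> vs" for us vs
    using that
  proof (induction us vs rule: list_induct2)
    case (Cons u us v vs)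
    have "u - v = w * (\<phi> vs - \<phi> us)" using Cons.prems by (simp add: \<phi> algebra_simps)
    moreover have "\<phi> vs - \<phi> us \<in> R" using Cons.prems \<phi>R R(1) by (auto intro: add_subgroup_diff)
    ultimately have "u = v" using U(3) Cons.prems by auto
    then show ?case using Cons w by (simp add: \<phi>)
  qed simp
  obtain g c where g: "g \<noteq> 0" "\<And>u. u \<in> U \<Longrightarrow> ev x g * u \<in> V c"
    using common_denominator[OF U(1)] by blast
  \<comment> \<open>Each multiplication by \<open>w\<close> costs one factor \<open>h\<close> and
    raises the degree by \<open>e\<close>, while \<open>g\<close> clears the denominators of the
    digits once and for all.\<close>
  have \<phi>V: "ev x (g * h ^ length us) * \<phi> us \<in> V (c + length us * e)" if "set us \<subseteq> U" for us
    using that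
  proof (induction us)
    case Nil
    then show ?case by (simp add: \<phi> V_0)
  next
    case (Cons u us)
    have 1: "ev x (h ^ Suc (length us)) * (ev x g * u) \<in> V (c + Suc (length us) * e)"
    proof -
      have "degree (h ^ Suc (length us)) \<le> degree h * Suc (length us)" by (rule degree_power_le)
      also have "\<dots> \<le> Suc (length us) * e" using h(2) by (metis mult.commute mult_le_mono1)
      finally show ?thesis
        using V_mult[of "ev x g * u" c "h ^ Suc (length us)"] g(2) Cons.prems
          V_mono[of "c + degree (h ^ Suc (length us))" "c + Suc (length us) * e"] by auto
    qed
    have 2: "ev x h * w * (ev x (g * h ^ length us) * \<phi> us) \<in> V (c + Suc (length us) * e)"
      using step[OF Cons.IH] Cons.prems by (simp add: algebra_simps)
    have "ev x (g * h ^ Suc (length us)) * \<phi> (u # us) =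
        ev x (h ^ Suc (length us)) * (ev x g * u) + ev x h * w * (ev x (g * h ^ length us) * \<phi> us)"
      by (simp add: \<phi> ev_mult algebra_simps)
    then show ?case using V_add[OF 1 2] by simp
  qed
  have le: "card U ^ d \<le> CARD('f) ^ (N * Suc (c + d * e))" for d
  proof -
    let ?X = "{us. set us \<subseteq> U \<and> length us = d}"
    have "inj_on (\<lambda>us. ev x (g * h ^ d) * \<phi> us) ?X"
    proof (rule inj_onI)
      fix us vs assume *: "us \<in> ?X" "vs \<in> ?X" "ev x (g * h ^ d) * \<phi> us = ev x (g * h ^ d) * \<phi> vs"
      have "ev x (g * h ^ d) \<noteq> 0" using g(1) h(1) by simp
      then have "\<phi> us = \<phi> vs" using *(3) by (metis mult_left_cancel)
      then show "us = vs" using *(1,2) \<phi>_inj by auto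
    qed
    moreover have "(\<lambda>us. ev x (g * h ^ d) * \<phi> us) ` ?X \<subseteq> V (c + d * e)"
      using \<phi>V by auto
    ultimately have "card ?X \<le> card (V (c + d * e))"
      using card_inj_on_le card_V(1) by blast
    then show ?thesis by (simp only: card_lists_length_eq[OF U(1)] card_V)
  qed
  \<comment> \<open>Up to a factor independent of \<open>d\<close>, the estimate compares d-th
    powers; a base larger than q to the power \<open>N * e\<close> would win for large
    \<open>d\<close>.\<close>
  show ?thesis
  proof (rule ccontr)
    assume "\<not> card U \<le> CARD('f) ^ (N * e)"
    then have gt: "real (card U) / real CARD('f) ^ (N * e) > 1"
      by (simp add: of_nat_power[symmetric] del: of_nat_power)
    then obtain d where d: "real CARD('f) ^ (N * Suc c) < (real (card U) / real CARD('f) ^ (N * e)) ^ d"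
      using real_arch_pow by blast
    have "real (card U) ^ d \<le> real CARD('f) ^ (N * Suc (c + d * e))"
      using le[of d] by (metis of_nat_le_iff of_nat_power)
    also have "\<dots> = real CARD('f) ^ (N * Suc c) * (real CARD('f) ^ (N * e)) ^ d"
      by (simp add: power_add[symmetric] power_mult[symmetric] algebra_simps)
    finally have "(real (card U) / real CARD('f) ^ (N * e)) ^ d \<le> real CARD('f) ^ (N * Suc c)"
      by (simp add: power_divide divide_le_eq)
    with d show False by simp
  qed
qed

text \<open>Here \<open>h\<close> clears the denominators of \<open>w * b\<close> for all basis
  elements \<open>b\<close>. The witness for \<open>e\<close> includes \<open>degree h\<close>
  because \<open>card_incongruent_bound\<close> also asks for
  \<open>degree h \<le> e\<close>.\<close>

lemma multiplier_exists:
  obtains h e where "h \<noteq> 0" "degree h \<le> e" "\<And>d v. v \<in> V d \<Longrightarrow> ev x h * w * v \<in> V (d + e)"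
proof -
  obtain h c where h: "h \<noteq> 0" "\<And>u. u \<in> (*) w ` Bs \<Longrightarrow> ev x h * u \<in> V c"
    using common_denominator[of "(*) w ` Bs"] finite_Bs by blast
  have "ev x h * w * v \<in> V (d + (c + degree h))" if "v \<in> V d" for d v
  proof -
    from that obtain p
      where p: "\<And>b. b \<in> Bs \<Longrightarrow> degree (p b) \<le> d" "v = (\<Sum>b\<in>Bs. ev x (p b) * b)"
      by (elim VE) auto
    have "ev x h * w * v = (\<Sum>b\<in>Bs. ev x (p b) * (ev x h * (w * b)))"
      unfolding p(2) sum_distrib_left by (simp add: mult_ac)
    also have "\<dots> \<in> V (d + (c + degree h))"
    proof (rule V_sum)
      fix b assume b: "b \<in> Bs"
      then have "ev x (p b) * (ev x h * (w * b)) \<in> V (c + degree (p b))"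
        using h(2) by (intro V_mult) auto
      then show "ev x (p b) * (ev x h * (w * b)) \<in> V (d + (c + degree h))"
        using p(1)[OF b] V_mono[of "c + degree (p b)" "d + (c + degree h)"] by auto
    qed
    finally show ?thesis .
  qed
  then show thesis using that[of h "c + degree h"] h(1) by simp
qed

text \<open>The bound on incongruent sets depends on \<open>w\<close> alone and not on
  \<open>R\<close>. The lemma is used for rings of regular functions at a point and for valuation
  rings not yet known to be discrete.\<close>

lemma finite_cosets_mult:
  fixes w :: 'k
  assumes "add_subgroup R" "\<And>r. r \<in> R \<Longrightarrow> w * r \<in> R" "w \<noteq> 0"
  shows "finite (cosets ((*) w ` R) R)"
proof -
  obtain h e where h: "h \<noteq> 0" "degree h \<le> e" "\<And>d v. v \<in> V d \<Longrightarrow> ev x h * w * v \<in> V (d + e)"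
    using multiplier_exists[of w] by blast
  have wR: "add_subgroup ((*) w ` R)" using assms(1) by (rule add_subgroup_mult_image)
  show ?thesis
    by (rule cosets_bounded[OF wR]) (rule card_incongruent_bound[OF assms h])
qed

end

subsection \<open>Existence of poles\<close>

context curve
begin

section \<open>Arithmetic of orders at a point\<close>

lemma pt_mult: "Q \<in> points \<iota> \<Longrightarrow> a \<noteq> 0 \<Longrightarrow> b \<noteq> 0 \<Longrightarrow> Q (a * b) = Q a + Q b"
  by (simp add: points_def)

lemma pt_const: "Q \<in> points \<iota> \<Longrightarrow> c \<noteq> 0 \<Longrightarrow> Q (\<iota> c) = 0"
  by (simp add: points_def)

lemma pt_0: "Q \<in> points \<iota> \<Longrightarrow> Q 0 = 0"
  by (simp add: points_def)

lemma pt_1: "Q \<in> points \<iota> \<Longrightarrow> Q 1 = 0"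
  using pt_const[of Q 1] by simp

lemma pt_minus: "Q \<in> points \<iota> \<Longrightarrow> Q (- a) = Q a"
  using pt_mult[of Q "\<iota> (- 1)" a] pt_const[of Q "- 1"]
  by (cases "a = 0") (simp_all add: const_minus)

lemma pt_inverse: "Q \<in> points \<iota> \<Longrightarrow> Q (inverse a) = - Q a"
  using pt_mult[of Q a "inverse a"] by (cases "a = 0") (simp_all add: pt_1 pt_0)

lemma pt_divide: "Q \<in> points \<iota> \<Longrightarrow> a \<noteq> 0 \<Longrightarrow> b \<noteq> 0 \<Longrightarrow> Q (a / b) = Q a - Q b"
  by (simp add: divide_inverse pt_mult pt_inverse)

lemma pt_power: "Q \<in> points \<iota> \<Longrightarrow> Q (a ^ n) = int n * Q a"
  by (induction n; cases "a = 0") (auto simp: pt_mult pt_1 pt_0 algebra_simps power_0_left)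

lemma pt_surj:
  assumes "Q \<in> points \<iota>"
  obtains s where "s \<noteq> 0" "Q s = n"
proof -
  have "surj Q" using assms by (simp add: points_def)
  then obtain s where "Q s = n" by (metis surjD)
  \<comment> \<open>The preimage may be 0, whose dummy order is 0; in that case \<open>n\<close> is
    0 and the element 1 serves instead.\<close>
  then show thesis
    using that[of s] that[of 1] pt_1[OF assms] pt_0[OF assms] by (cases "s = 0") auto
qed

lemma ord_ge_0 [simp]: "ord_ge Q n 0"
  by (simp add: ord_ge_def)

lemma ord_ge_mono: "ord_ge Q n a \<Longrightarrow> m \<le> n \<Longrightarrow> ord_ge Q m a"
  by (auto simp: ord_ge_def)

lemma ord_ge_minus: "Q \<in> points \<iota> \<Longrightarrow> ord_ge Q n (- a) \<longleftrightarrow> ord_ge Q n a"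
  by (auto simp: ord_ge_def pt_minus)

lemma ord_ge_add:
  assumes "Q \<in> points \<iota>" "ord_ge Q n a" "ord_ge Q n b"
  shows "ord_ge Q n (a + b)"
proof (cases "a = 0 \<or> b = 0 \<or> a + b = 0")
  case False
  then have "min (Q a) (Q b) \<le> Q (a + b)" using assms(1) by (simp add: points_def)
  then show ?thesis using assms False by (auto simp: ord_ge_def)
qed (use assms in \<open>auto simp: ord_ge_def\<close>)

lemma ord_ge_diff:
  "Q \<in> points \<iota> \<Longrightarrow> ord_ge Q n a \<Longrightarrow> ord_ge Q n b \<Longrightarrow> ord_ge Q n (a - b)"
  using ord_ge_add[of Q n a "- b"] by (simp add: ord_ge_minus)

lemma ord_ge_mult:
  "Q \<in> points \<iota> \<Longrightarrow> ord_ge Q n a \<Longrightarrow> ord_ge Q m b \<Longrightarrow> ord_ge Q (n + m) (a * b)"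
  by (cases "a = 0 \<or> b = 0") (auto simp: ord_ge_def pt_mult)

lemma ord_ge_mult_iff:
  "Q \<in> points \<iota> \<Longrightarrow> a \<noteq> 0 \<Longrightarrow> ord_ge Q n (a * b) \<longleftrightarrow> ord_ge Q (n - Q a) b"
  by (cases "b = 0") (auto simp: ord_ge_def pt_mult)

lemma ord_ge_const: "Q \<in> points \<iota> \<Longrightarrow> ord_ge Q 0 (\<iota> c)"
  by (cases "c = 0") (auto simp: ord_ge_def pt_const)

lemma ord_ge_sum:
  "Q \<in> points \<iota> \<Longrightarrow> (\<And>i. i \<in> I \<Longrightarrow> ord_ge Q n (f i)) \<Longrightarrow> ord_ge Q n (sum f I)"
  by (induction I rule: infinite_finite_induct) (auto intro: ord_ge_add)

lemma add_subgroup_ord_ge: "Q \<in> points \<iota> \<Longrightarrow> add_subgroup {a. ord_ge Q n a}"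
  by (auto intro!: add_subgroupI ord_ge_diff)

lemma subspace_ord_ge:
  assumes "Q \<in> points \<iota>"
  shows "module.subspace (\<lambda>c f. \<iota> c * f) {a. ord_ge Q n a}"
proof -
  interpret vector_space "\<lambda>c f. \<iota> c * f" by (rule vector_space_field)
  show ?thesis
    using assms ord_ge_mult[OF assms ord_ge_const[OF assms], of n]
    by (auto simp: subspace_def intro: ord_ge_add)
qed

lemma pt_add_eq:
  assumes "Q \<in> points \<iota>" "a \<noteq> 0" "b = 0 \<or> Q a < Q b"
  shows "a + b \<noteq> 0" "Q (a + b) = Q a"
proof -
  show nz: "a + b \<noteq> 0"
    using assms pt_minus[OF assms(1), of a] by (auto simp: add_eq_0_iff)
  show "Q (a + b) = Q a"
  proof (cases "b = 0")
    case False
    have "ord_ge Q (Q a) (a + b)"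
      using assms by (intro ord_ge_add) (auto simp: ord_ge_def)
    moreover have "\<not> Q a < Q (a + b)"
    proof
      assume "Q a < Q (a + b)"
      then have "ord_ge Q (Q a + 1) ((a + b) - b)"
        using assms False by (intro ord_ge_diff) (auto simp: ord_ge_def)
      then show False using assms by (simp add: ord_ge_def)
    qed
    ultimately show ?thesis using nz by (simp add: ord_ge_def)
  qed simp
qed

end

section \<open>Adjoining an element to a subring; maximal subrings are valuation rings\<close>

definition subring :: "'a::comm_ring_1 set \<Rightarrow> bool" where
  "subring R \<longleftrightarrow> add_subgroup R \<and> 1 \<in> R \<and> (\<forall>a\<in>R. \<forall>b\<in>R. a * b \<in> R)"

lemma subringI:
  "0 \<in> R \<Longrightarrow> 1 \<in> R \<Longrightarrow> (\<And>a b. a \<in> R \<Longrightarrow> b \<in> R \<Longrightarrow> a - b \<in> R) \<Longrightarrow>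
    (\<And>a b. a \<in> R \<Longrightarrow> b \<in> R \<Longrightarrow> a * b \<in> R) \<Longrightarrow> subring R"
  by (simp add: subring_def add_subgroup_def)

lemma subring_add_subgroup: "subring R \<Longrightarrow> add_subgroup R"
  and subring_1: "subring R \<Longrightarrow> 1 \<in> R"
  and subring_mult: "subring R \<Longrightarrow> a \<in> R \<Longrightarrow> b \<in> R \<Longrightarrow> a * b \<in> R"
  by (simp_all add: subring_def)

lemma subring_power: "subring R \<Longrightarrow> a \<in> R \<Longrightarrow> a ^ n \<in> R"
  by (induction n) (auto intro: subring_1 subring_mult)

text \<open>Values at \<open>u\<close> of polynomials of degree at most \<open>n\<close> with
  coefficients in \<open>R\<close>, in Horner form because \<open>R\<close> is a set and not a type
  of coefficients.\<close>

primrec polys_le :: "'a::comm_ring_1 set \<Rightarrow> 'a \<Rightarrow> nat \<Rightarrow> 'a set" where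
  "polys_le R u 0 = R"
| "polys_le R u (Suc n) = {a + u * s | a s. a \<in> R \<and> s \<in> polys_le R u n}"

context
  fixes R :: "'a::field set"
  assumes R: "subring R"
begin

lemma subring_0: "0 \<in> R"
  using R by (simp add: subring_add_subgroup add_subgroup_0)

lemma polys_le_SucI: "a \<in> R \<Longrightarrow> s \<in> polys_le R u n \<Longrightarrow> a + u * s \<in> polys_le R u (Suc n)"
  by auto

lemma polys_le_mult_u: "s \<in> polys_le R u n \<Longrightarrow> u * s \<in> polys_le R u (Suc n)"
  using polys_le_SucI[OF subring_0] by simp

lemma polys_le_subgroup: "add_subgroup (polys_le R u n)"
proof (induction n)
  case 0
  then show ?case using R by (simp add: subring_add_subgroup)
next
  case (Suc n)
  show ?case
  proof (rule add_subgroupI)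
    show "0 \<in> polys_le R u (Suc n)"
      using polys_le_mult_u[OF add_subgroup_0[OF Suc]] by simp
    fix s t assume "s \<in> polys_le R u (Suc n)" "t \<in> polys_le R u (Suc n)"
    then obtain a b s' t' where *: "a \<in> R" "b \<in> R" "s' \<in> polys_le R u n" "t' \<in> polys_le R u n"
      "s = a + u * s'" "t = b + u * t'" by auto
    then have "s - t = (a - b) + u * (s' - t')" by (simp add: algebra_simps)
    then show "s - t \<in> polys_le R u (Suc n)"
      using * add_subgroup_diff[OF subring_add_subgroup[OF R]] add_subgroup_diff[OF Suc]
        polys_le_SucI by metis
  qed
qed

lemma polys_le_scale: "a \<in> R \<Longrightarrow> s \<in> polys_le R u n \<Longrightarrow> a * s \<in> polys_le R u n"
proof (induction n arbitrary: s)
  case 0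
  then show ?case using R by (simp add: subring_mult)
next
  case (Suc n)
  then obtain b t where *: "b \<in> R" "t \<in> polys_le R u n" "s = b + u * t" by auto
  then have "a * s = a * b + u * (a * t)" by (simp add: algebra_simps)
  then show ?case using polys_le_SucI Suc.IH[OF Suc.prems(1) *(2)] subring_mult[OF R Suc.prems(1) *(1)]
    by metis
qed

lemma polys_le_0: "a \<in> R \<Longrightarrow> a \<in> polys_le R u n"
proof (cases n)
  case (Suc m)
  assume "a \<in> R"
  then show ?thesis
    using polys_le_SucI[OF _ add_subgroup_0[OF polys_le_subgroup], of a u m] Suc by simp
qed simp

lemma polys_le_Suc: "polys_le R u n \<subseteq> polys_le R u (Suc n)"
proof (induction n)
  case 0
  then show ?case using polys_le_0[of _ u 1] by auto
next
  case (Suc n)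
  show ?case
  proof
    fix s assume "s \<in> polys_le R u (Suc n)"
    then obtain a t where *: "a \<in> R" "t \<in> polys_le R u n" "s = a + u * t" by auto
    then show "s \<in> polys_le R u (Suc (Suc n))"
      using polys_le_SucI[of a t u "Suc n"] Suc by blast
  qed
qed

lemma polys_le_mono: "n \<le> m \<Longrightarrow> polys_le R u n \<subseteq> polys_le R u m"
  using lift_Suc_mono_le[of "polys_le R u"] polys_le_Suc by blast

lemma polys_le_mult:
  "s \<in> polys_le R u n \<Longrightarrow> t \<in> polys_le R u m \<Longrightarrow> s * t \<in> polys_le R u (n + m)"
proof (induction n arbitrary: s)
  case 0
  then show ?case by (simp add: polys_le_scale)
next
  case (Suc n)
  then obtain a r where *: "a \<in> R" "r \<in> polys_le R u n" "s = a + u * r" by auto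
  have "a * t \<in> polys_le R u (Suc n + m)"
    using polys_le_scale[OF *(1) Suc.prems(2)] polys_le_mono[of m "Suc n + m"] by auto
  moreover have "u * (r * t) \<in> polys_le R u (Suc n + m)"
    using polys_le_mult_u Suc.IH[OF *(2) Suc.prems(2)] by simp
  ultimately have "a * t + u * (r * t) \<in> polys_le R u (Suc n + m)"
    by (rule add_subgroup_add[OF polys_le_subgroup])
  then show ?case using *(3) by (simp add: algebra_simps)
qed

lemma polys_le_power: "u ^ n \<in> polys_le R u n"
  by (induction n) (auto simp del: polys_le.simps(2) simp: polys_le_mult_u subring_1[OF R])

text \<open>The recursion exposes the constant coefficient, whereas lowering the degree requires the
  leading one.\<close>

lemma polys_le_top:
  "s \<in> polys_le R u (Suc n) \<Longrightarrow> \<exists>a\<in>R. \<exists>t\<in>polys_le R u n. s = t + a * u ^ Suc n"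
proof (induction n arbitrary: s)
  case 0
  then show ?case by (auto simp: mult.commute)
next
  case (Suc n)
  then obtain b r where *: "b \<in> R" "r \<in> polys_le R u (Suc n)" "s = b + u * r"
    using polys_le.simps(2)[of R u "Suc n"] by blast
  then obtain a t where at: "a \<in> R" "t \<in> polys_le R u n" "r = t + a * u ^ Suc n"
    using Suc.IH by blast
  then have "s = (b + u * t) + a * u ^ Suc (Suc n)"
    using * by (simp add: algebra_simps)
  then show ?case using at *(1) polys_le_SucI by blast
qed

lemma polys_le_flip:
  assumes "u \<noteq> 0"
  shows "s \<in> polys_le R (1 / u) m \<Longrightarrow> u ^ m * s \<in> polys_le R u m"
proof (induction m arbitrary: s)
  case (Suc m)
  then obtain a t where *: "a \<in> R" "t \<in> polys_le R (1 / u) m" "s = a + 1 / u * t" by auto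
  have "u ^ Suc m * s = a * u ^ Suc m + u ^ m * t"
    using * assms by (simp add: algebra_simps)
  moreover have "a * u ^ Suc m \<in> polys_le R u (Suc m)"
    using *(1) polys_le_power[of u "Suc m"] by (rule polys_le_scale)
  moreover have "u ^ m * t \<in> polys_le R u (Suc m)"
    using Suc.IH[OF *(2)] polys_le_Suc by blast
  ultimately show ?case using add_subgroup_add[OF polys_le_subgroup] by metis
qed simp

text \<open>Multiplying \<open>f = b + s / u\<close> by \<open>y\<close> gives
  \<open>y * s = u * (1 - y * b)\<close>. As \<open>1 - y * b\<close> is a unit, \<open>u\<close> is
  a polynomial in \<open>1 / u\<close> of degree below \<open>m\<close>, so a power of
  \<open>u\<close> becomes expressible by lower powers, and the leading term of \<open>f\<close> can
  be replaced.\<close>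

lemma polys_le_descend:
  assumes f: "y * f = 1" "y \<in> R"
    and unit: "\<And>b. b \<in> R \<Longrightarrow> 1 - y * b \<noteq> 0 \<and> inverse (1 - y * b) \<in> R"
    and u: "u \<noteq> 0" and m: "f \<in> polys_le R (1 / u) m" "m \<noteq> 0" "m \<le> n"
    and n: "f \<in> polys_le R u n"
  shows "f \<in> polys_le R u (n - 1)"
proof -
  obtain k where k: "m = Suc k" using m(2) not0_implies_Suc by blast
  obtain b s where b: "b \<in> R" "s \<in> polys_le R (1 / u) k" "f = b + 1 / u * s"
    using m(1) k by auto
  define e where "e = inverse (1 - y * b)"
  have e: "1 - y * b \<noteq> 0" "e \<in> R" using unit[OF b(1)] by (auto simp: e_def)
  have "s = u * (f - b)" using b(3) u by (simp add: field_simps)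
  then have "y * s = u * (y * f - y * b)" by (simp only: right_diff_distrib mult.left_commute)
  then have "y * s = u * (1 - y * b)" using f by simp
  then have ueq: "u = (e * y) * s" using e(1) by (simp add: e_def field_simps)
  then have "u \<in> polys_le R (1 / u) k"
    using polys_le_scale[OF _ b(2)] e(2) f(2) subring_mult[OF R] by metis
  then have um: "u ^ k * u \<in> polys_le R u k" using polys_le_flip[OF u] by blast
  have un: "u ^ n \<in> polys_le R u (n - 1)"
  proof -
    have "u ^ (n - m) * (u ^ k * u) \<in> polys_le R u ((n - m) + k)"
      using polys_le_mult[OF polys_le_power um] .
    moreover have "u ^ (n - m) * (u ^ k * u) = u ^ n"
      using k m(3) by (simp add: power_add[symmetric] power_Suc2[symmetric] del: power_Suc)
    moreover have "(n - m) + k = n - 1" using k m(3) by simp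
    ultimately show ?thesis by simp
  qed
  obtain n' where n': "n = Suc n'" using k m(3) by (cases n) auto
  obtain a t where "a \<in> R" "t \<in> polys_le R u n'" "f = t + a * u ^ n"
    using polys_le_top n unfolding n' by blast
  then show ?thesis
    using un polys_le_scale add_subgroup_add[OF polys_le_subgroup] n' by (metis diff_Suc_1)
qed

lemma subring_adjoin: "subring (\<Union>n. polys_le R u n)"
proof (rule subringI)
  have common: "\<exists>n. a \<in> polys_le R u n \<and> b \<in> polys_le R u n"
    if "a \<in> polys_le R u k" "b \<in> polys_le R u l" for a b k l
    using that polys_le_mono[of k "max k l" u] polys_le_mono[of l "max k l" u] by auto
  show "a - b \<in> (\<Union>n. polys_le R u n)" if "a \<in> (\<Union>n. polys_le R u n)" "b \<in> (\<Union>n. polys_le R u n)" for a b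
    using that common add_subgroup_diff[OF polys_le_subgroup] by (metis UN_iff UNIV_I)
  show "a * b \<in> (\<Union>n. polys_le R u n)" if "a \<in> (\<Union>n. polys_le R u n)" "b \<in> (\<Union>n. polys_le R u n)" for a b
    using that polys_le_mult by (metis UN_iff UNIV_I)
qed (use polys_le_0[OF subring_0, of u 0] polys_le_0[OF subring_1[OF R], of u 0] in blast)+

end

text \<open>Inverting a non-unit \<open>1 - y b\<close> of \<open>R\<close> does not produce \<open>f = 1 / y\<close>.\<close>

lemma maximal_subring_is_valuation_ring:
  fixes R :: "'a::field set"
  assumes R: "subring R" and f: "y * f = 1" "y \<in> R" "f \<notin> R"
    and max: "\<And>T. subring T \<Longrightarrow> R \<subseteq> T \<Longrightarrow> f \<notin> T \<Longrightarrow> T = R"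
    and u: "u \<noteq> 0"
  shows "u \<in> R \<or> 1 / u \<in> R"
proof -
  \<comment> \<open>By maximality, every proper enlargement of \<open>R\<close> already contains
    \<open>f\<close>.\<close>
  have adjoin: "f \<in> (\<Union>n. polys_le R v n)" if "v \<notin> R" for v
  proof (rule ccontr)
    assume "f \<notin> (\<Union>n. polys_le R v n)"
    moreover have "R \<subseteq> (\<Union>n. polys_le R v n)" using polys_le_0[OF R] by blast
    ultimately have "(\<Union>n. polys_le R v n) = R" using max subring_adjoin[OF R] by blast
    moreover have "v \<in> polys_le R v 1" using polys_le_power[OF R, of v 1] by simp
    ultimately show False using that by blast
  qed
  have unit: "1 - y * b \<noteq> 0 \<and> inverse (1 - y * b) \<in> R" if b: "b \<in> R" for b
  proof
    define w where "w = 1 - y * b"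
    have wR: "w \<in> R"
      unfolding w_def using f(2) b R
      by (auto intro!: add_subgroup_diff simp: subring_add_subgroup subring_1 subring_mult)
    show "1 - y * b \<noteq> 0"
    proof
      assume "1 - y * b = 0"
      then have "y * f = y * b" using f(1) by simp
      moreover have "y \<noteq> 0" using f(1) by auto
      ultimately show False using f(3) b by simp
    qed
    then have w0: "w \<noteq> 0" by (simp add: w_def)
    show "inverse (1 - y * b) \<in> R"
    proof (rule ccontr)
      assume "inverse (1 - y * b) \<notin> R"
      then obtain n where "f \<in> polys_le R (1 / w) n"
        using adjoin[of "1 / w"] by (auto simp: w_def divide_inverse)
      then have "w ^ n * f \<in> polys_le R w n" using polys_le_flip[OF R w0] by blast
      moreover have "polys_le R w n \<subseteq> R" for n
      proof (induction n)
        case (Suc n)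
        show ?case
        proof
          fix s assume "s \<in> polys_le R w (Suc n)"
          then obtain a t where "a \<in> R" "t \<in> R" "s = a + w * t" using Suc by auto
          then show "s \<in> R" using wR R by (auto intro!: add_subgroup_add simp: subring_add_subgroup subring_mult)
        qed
      qed simp
      ultimately have wf: "w ^ n * f \<in> R" by blast
      \<comment> \<open>Since \<open>y * f = 1\<close>, one has \<open>w * f = f - b\<close>:
        multiplication by \<open>w\<close> does not change \<open>f\<close> modulo \<open>R\<close>.
        Together with \<open>wf\<close> this puts \<open>f\<close> into \<open>R\<close>.\<close>
      have "w ^ n * f - f \<in> R" for n
      proof (induction n)
        case (Suc n)
        have "w ^ Suc n * f - f = (w ^ n * f - f) - (y * f) * (w ^ n * b)"
          by (simp add: w_def algebra_simps)
        also have "\<dots> = (w ^ n * f - f) - w ^ n * b" using f(1) by simp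
        finally have eq: "w ^ Suc n * f - f = (w ^ n * f - f) - w ^ n * b" .
        show ?case
          unfolding eq using Suc subring_mult[OF R subring_power[OF R wR] b]
          by (rule add_subgroup_diff[OF subring_add_subgroup[OF R]])
      qed (use R in \<open>simp add: add_subgroup_0 subring_add_subgroup\<close>)
      from add_subgroup_diff[OF subring_add_subgroup[OF R] wf this[of n]] f(3)
      show False by simp
    qed
  qed
  \<comment> \<open>The larger of the two least degrees of \<open>f\<close>, in \<open>u\<close> and
    in \<open>1 / u\<close>, can be lowered. The statement is about \<open>v\<close> so that
    \<open>u\<close> and \<open>1 / u\<close> can exchange roles.\<close>
  have contr: False if v: "v \<noteq> 0" and m: "\<And>k. k < n \<Longrightarrow> f \<notin> polys_le R v k" "f \<in> polys_le R v n"
      "f \<in> polys_le R (1 / v) m" "m \<le> n" for v m n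
  proof -
    have "m \<noteq> 0" "n \<noteq> 0" using m f(3) by (auto intro!: gr0I)
    then show False
      using polys_le_descend[OF R f(1,2) unit v m(3) _ m(4) m(2)] m(1)[of "n - 1"] by simp
  qed
  show ?thesis
  proof (rule ccontr)
    assume "\<not> ?thesis"
    then have "\<exists>n. f \<in> polys_le R u n" "\<exists>n. f \<in> polys_le R (1 / u) n"
      using adjoin[of u] adjoin[of "1 / u"] by auto
    then obtain n m where n: "f \<in> polys_le R u n" "\<And>k. k < n \<Longrightarrow> f \<notin> polys_le R u k"
      and m: "f \<in> polys_le R (1 / u) m" "\<And>k. k < m \<Longrightarrow> f \<notin> polys_le R (1 / u) k"
      unfolding exists_least_iff[of "\<lambda>n. f \<in> polys_le R _ n"] by blast
    show False
    proof (cases "m \<le> n")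
      case True
      then show False using contr[OF u n(2,1) m(1)] by blast
    next
      case False
      then show False using contr[of "1 / u" m n] u n m by simp
    qed
  qed
qed

context curve
begin

lemma ev_monom: "ev x (monom a n) = \<iota> a * x ^ n"
  by (induction n) (simp_all add: monom_0 monom_Suc algebra_simps)

lemma subring_range_ev: "subring (range (ev x))"
proof (rule subringI)
  show "0 \<in> range (ev x)" using rangeI[of "ev x" 0] by simp
  show "1 \<in> range (ev x)" using rangeI[of "ev x" 1] by simp
  show "a - b \<in> range (ev x)" if "a \<in> range (ev x)" "b \<in> range (ev x)" for a b
    using that by (auto simp: ev_diff[symmetric])
  show "a * b \<in> range (ev x)" if "a \<in> range (ev x)" "b \<in> range (ev x)" for a b
    using that by (auto simp: ev_mult[symmetric])
qed

text \<open>If \<open>f\<close> were a polynomial \<open>p\<close> in \<open>1 / f\<close>,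
  multiplication by \<open>f ^ degree p\<close> would give a monic equation of degree
  \<open>Suc (degree p)\<close> for \<open>f\<close>. This makes the polynomials in
  \<open>1 / f\<close> an admissible start for Zorn's lemma.\<close>

lemma transcendental_notin_ev_inverse:
  assumes tr: "\<not> algebraic_over \<iota> f" and y: "y * f = 1"
  shows "f \<notin> range (ev y)"
proof
  assume "f \<in> range (ev y)"
  then obtain p where p: "f = ev y p" by auto
  have flip: "\<exists>r. degree r \<le> d \<and> ev y p * f ^ d = ev f r" if "degree p \<le> d" for d p
    using that
  proof (induction d arbitrary: p)
    case 0
    then obtain a where "p = [:a:]" by (auto elim: degree_eq_zeroE)
    then show ?case by (intro exI[of _ "[:a:]"]) simp
  next
    case (Suc d)
    obtain a p' where p': "p = pCons a p'" by (cases p)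
    then have "degree p' \<le> d" using Suc.prems by (auto split: if_splits)
    then obtain r where r: "degree r \<le> d" "ev y p' * f ^ d = ev f r" using Suc.IH by blast
    have "ev y p * f ^ Suc d = \<iota> a * f ^ Suc d + (y * f) * (ev y p' * f ^ d)"
      by (simp add: p' algebra_simps)
    also have "\<dots> = ev f (monom a (Suc d) + r)"
      using y r by (simp add: ev_add ev_monom del: power_Suc)
    finally show ?case
      using r(1) degree_monom_le[of a "Suc d"]
      by (intro exI[of _ "monom a (Suc d) + r"]) (auto intro!: degree_add_le)
  qed
  obtain r where r: "degree r \<le> degree p" "ev y p * f ^ degree p = ev f r"
    using flip[of p "degree p"] by auto
  have "ev f (monom 1 (Suc (degree p)) - r) = 0"
    using r(2) p[symmetric] by (simp add: ev_diff ev_monom)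
  then have "monom 1 (Suc (degree p)) - r = 0" using ev_eq_0_iff[OF tr] by simp
  then have "monom (1 :: 'f) (Suc (degree p)) = r" by simp
  then have "degree r = Suc (degree p)" by (metis degree_monom_eq one_neq_zero)
  then show False using r(1) by simp
qed

end

section \<open>From valuation rings to points\<close>

context curve_basis
begin

text \<open>
  The index \<open>\<nu> w\<close> of \<open>w R\<close> in \<open>R\<close> is finite and multiplicative; a non-unit of minimal
  index is a uniformizer.
\<close>

lemma valuation_ring_point:
  assumes R: "subring R" "range \<iota> \<subseteq> R" and val: "\<And>u. u \<noteq> 0 \<Longrightarrow> u \<in> R \<or> 1 / u \<in> R"
    and y: "y \<in> R" "y \<noteq> 0" "1 / y \<notin> R"
  obtains Q where "Q \<in> points \<iota>" "Q y > 0"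
proof -
  have gR: "add_subgroup R" using R(1) by (rule subring_add_subgroup)
  define \<nu> where "\<nu> w = card (cosets ((*) w ` R) R)" for w
  have sub: "(*) w ` R \<subseteq> R" if "w \<in> R" for w using that R(1) by (auto intro: subring_mult)
  have grp: "add_subgroup ((*) w ` R)" for w using gR by (rule add_subgroup_mult_image)
  have \<nu>_pos: "\<nu> w \<ge> 1" if "w \<in> R" "w \<noteq> 0" for w
    unfolding \<nu>_def using card_cosets_pos[OF gR finite_cosets_mult[OF gR _ that(2)]]
      subring_mult[OF R(1) that(1)] by (simp add: Suc_leI)
  have \<nu>_mult: "\<nu> (w * v) = \<nu> w * \<nu> v" if "w \<in> R" "w \<noteq> 0" "v \<in> R" for w v
  proof -
    have "(*) (w * v) ` R \<subseteq> (*) w ` R" using sub[OF that(3)] by (auto simp: mult.assoc)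
    then have "\<nu> (w * v) = card (cosets ((*) (w * v) ` R) ((*) w ` R)) * \<nu> w"
      unfolding \<nu>_def by (intro index_tower(2) grp gR sub[OF that(1)])
    also have "card (cosets ((*) (w * v) ` R) ((*) w ` R)) = \<nu> v"
      unfolding \<nu>_def
    proof (rule index_iso(2)[where f = "(*) w", OF grp grp])
      fix a b
      show "w * a - w * b \<in> (*) (w * v) ` R \<longleftrightarrow> a - b \<in> (*) v ` R"
        using that(2) by (auto simp: right_diff_distrib[symmetric] mult.assoc)
    next
      fix v' assume "v' \<in> (*) w ` R"
      then show "\<exists>a\<in>R. v' - w * a \<in> (*) (w * v) ` R"
        using add_subgroup_0[OF grp, of "w * v"] by fastforce
    qed auto
    finally show ?thesis by (simp add: mult.commute)
  qed
  have \<nu>_1: "1 / w \<in> R" if "w \<in> R" "w \<noteq> 0" "\<nu> w = 1" for w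
  proof -
    have "(*) w ` R = R"
      using card_cosets_eq_1[OF grp gR sub[OF that(1)]] that(3) by (simp add: \<nu>_def)
    then obtain a where "a \<in> R" "1 = w * a" using subring_1[OF R(1)] by (metis imageE)
    then have "1 / w = a" using that(2) by (simp add: field_simps)
    then show ?thesis using \<open>a \<in> R\<close> by simp
  qed
  define nonunit where "nonunit w \<longleftrightarrow> w \<in> R \<and> w \<noteq> 0 \<and> 1 / w \<notin> R" for w
  define unit where "unit w \<longleftrightarrow> w \<in> R \<and> w \<noteq> 0 \<and> 1 / w \<in> R" for w
  have unit_mult: "unit (a * b)" if "unit a" "unit b" for a b
    using that subring_mult[OF R(1), of "1 / a" "1 / b"] subring_mult[OF R(1), of a b]
    by (auto simp: unit_def)
  have unit_inv: "unit (1 / a)" if "unit a" for a using that by (auto simp: unit_def)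
  have "nonunit y" using y by (simp add: nonunit_def)
  then obtain t where t: "nonunit t" "\<And>w. nonunit w \<Longrightarrow> \<nu> t \<le> \<nu> w"
    using ex_has_least_nat[of nonunit y \<nu>] by blast
  have tR: "t \<in> R" "t \<noteq> 0" "1 / t \<notin> R" using t(1) by (auto simp: nonunit_def)
  have \<nu>t: "\<nu> t \<ge> 2"
    using \<nu>_pos[OF tR(1,2)] \<nu>_1[OF tR(1,2)] tR(3) by (cases "\<nu> t = 1") auto
  \<comment> \<open>Otherwise \<open>t / w\<close> lies in \<open>R\<close>; minimality of
    \<open>\<nu> t\<close> forces \<open>\<nu> (t / w) = 1\<close>, so \<open>t / w\<close> is a
    unit and \<open>w / t\<close> lies in \<open>R\<close> after all.\<close>
  have div_t: "w / t \<in> R" if "nonunit w" for w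
  proof (rule ccontr)
    assume n: "w / t \<notin> R"
    have w: "w \<in> R" "w \<noteq> 0" using that by (auto simp: nonunit_def)
    have *: "t / w \<in> R" "t / w \<noteq> 0" using val[of "w / t"] n w tR by auto
    have "\<nu> t = \<nu> w * \<nu> (t / w)" using \<nu>_mult[OF w *(1)] w(2) by simp
    moreover have "\<nu> t \<le> \<nu> w" using t(2)[OF that] .
    moreover have "1 \<le> \<nu> w" using \<nu>_pos[OF w] .
    ultimately have "\<nu> (t / w) \<le> 1"
      by (metis Suc_le_eq mult.right_neutral mult_le_cancel1 One_nat_def not_less_zero zero_less_one)
    then have "\<nu> (t / w) = 1" using \<nu>_pos[OF *] by simp
    from \<nu>_1[OF * this] n show False by simp
  qed
  \<comment> \<open>Dividing a non-unit by \<open>t\<close> divides its index by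
    \<open>\<nu> t \<ge> 2\<close>, so the process stops at a unit.\<close>
  have decomp: "\<exists>k e. unit e \<and> w = t ^ k * e" if "w \<in> R" "w \<noteq> 0" for w
    using that
  proof (induction "\<nu> w" arbitrary: w rule: less_induct)
    case less
    show ?case
    proof (cases "1 / w \<in> R")
      case True
      then show ?thesis using less.prems by (intro exI[of _ 0] exI[of _ w]) (simp add: unit_def)
    next
      case False
      then have *: "w / t \<in> R" "w / t \<noteq> 0"
        using div_t[of w] less.prems tR by (auto simp: nonunit_def)
      have "\<nu> w = \<nu> t * \<nu> (w / t)" using \<nu>_mult[OF tR(1,2) *(1)] tR(2) by simp
      moreover have "\<nu> (w / t) < 2 * \<nu> (w / t)" using \<nu>_pos[OF *] by simp
      moreover have "2 * \<nu> (w / t) \<le> \<nu> t * \<nu> (w / t)" using \<nu>t by (rule mult_le_mono1)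
      ultimately have "\<nu> (w / t) < \<nu> w" by simp
      from less.hyps[OF this *] obtain k e where "unit e" "w / t = t ^ k * e" by blast
      then show ?thesis using tR(2) by (intro exI[of _ "Suc k"] exI[of _ e]) (simp add: field_simps)
    qed
  qed
  have decomp_int: "\<exists>k e. unit e \<and> w = t powi k * e" if "w \<noteq> 0" for w
  proof (cases "w \<in> R")
    case True
    then obtain k e where "unit e" "w = t ^ k * e" using decomp \<open>w \<noteq> 0\<close> by blast
    then show ?thesis by (intro exI[of _ "int k"] exI[of _ e]) (simp add: power_int_def)
  next
    case False
    then have "1 / w \<in> R" using val[OF that] by blast
    then obtain k e where e: "unit e" "1 / w = t ^ k * e" using decomp[of "1 / w"] \<open>w \<noteq> 0\<close> by auto
    have "w = 1 / (t ^ k * e)" using e(2) that by (metis divide_divide_eq_right div_by_1 mult_1)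
    also have "\<dots> = t powi (- int k) * (1 / e)"
      by (simp add: power_int_minus divide_inverse)
    finally show ?thesis using unit_inv[OF e(1)] by blast
  qed
  have uniq_le: "\<not> k < l" if "unit e" "unit e'" "t powi k * e = t powi l * e'" for k l e e'
  proof
    assume "k < l"
    define n where "n = nat (l - k - 1)"
    have n: "l = k + int (Suc n)" using \<open>k < l\<close> by (simp add: n_def)
    have "t powi l = t powi k * t ^ Suc n"
      unfolding n using tR(2) by (simp add: power_int_add power_int_of_nat del: of_nat_Suc)
    then have "t powi k * e = t powi k * (t ^ Suc n * e')" using that(3) by (simp add: mult.assoc)
    then have "e = t ^ Suc n * e'" using tR(2) by simp
    then have "1 / t = t ^ n * (e' * (1 / e))"
      using that tR(2) by (simp add: unit_def field_simps)
    also have "\<dots> \<in> R"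
      using that(1,2) tR(1) by (intro subring_mult[OF R(1)] subring_power[OF R(1)]) (auto simp: unit_def)
    finally show False using tR(3) by simp
  qed
  \<comment> \<open>The order is the exponent of the uniformizer; 0 receives the dummy value that
    \<open>points\<close> prescribes.\<close>
  define Q where "Q w = (if w = 0 then 0 else THE k. \<exists>e. unit e \<and> w = t powi k * e)" for w
  have Q_eq: "Q (t powi k * e) = k" if "unit e" for k e
  proof -
    have "(THE l. \<exists>e'. unit e' \<and> t powi k * e = t powi l * e') = k"
    proof (rule the_equality)
      show "\<exists>e'. unit e' \<and> t powi k * e = t powi k * e'" using that by blast
      fix l assume "\<exists>e'. unit e' \<and> t powi k * e = t powi l * e'"
      then obtain e' where "unit e'" "t powi k * e = t powi l * e'" by blast
      then have "\<not> k < l" "\<not> l < k" using uniq_le that by metis+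
      then show "l = k" by simp
    qed
    then show ?thesis using that tR(2) by (simp add: Q_def unit_def)
  qed
  have Q_R: "Q w \<ge> 0" if w: "w \<in> R" "w \<noteq> 0" for w
  proof -
    from w obtain k e where "unit e" "w = t ^ k * e" using decomp by blast
    then show ?thesis using Q_eq[of e "int k"] by (simp add: power_int_of_nat)
  qed
  have Qmult: "Q (a * b) = Q a + Q b" if "a \<noteq> 0" "b \<noteq> 0" for a b
  proof -
    from decomp_int[OF that(1)] decomp_int[OF that(2)]
    obtain k e l e' where *: "unit e" "a = t powi k * e" "unit e'" "b = t powi l * e'"
      by blast
    then have "a * b = t powi (k + l) * (e * e')" using tR(2) by (simp add: power_int_add mult_ac)
    then show ?thesis using * Q_eq unit_mult by metis
  qed
  have Qadd: "Q a \<le> Q (a + b)" if "a \<noteq> 0" "b \<noteq> 0" "a + b \<noteq> 0" "Q a \<le> Q b" for a b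
  proof -
    from decomp_int[OF that(1)] decomp_int[OF that(2)]
    obtain k e l e' where *: "unit e" "a = t powi k * e" "unit e'" "b = t powi l * e'"
      by blast
    then have "k \<le> l" using that(4) Q_eq by simp
    then have "t powi l = t powi k * t ^ nat (l - k)"
      using tR(2) power_int_add[of t k "l - k"] by (simp add: power_int_def)
    then have ab: "a + b = t powi k * (e + t ^ nat (l - k) * e')"
      using * by (simp add: algebra_simps)
    define z where "z = e + t ^ nat (l - k) * e'"
    have z: "z \<in> R" "z \<noteq> 0"
      unfolding z_def using * tR(1) ab that(3) R(1)
      by (auto intro!: add_subgroup_add[OF gR] subring_mult subring_power simp: unit_def)
    have "t powi k \<noteq> 0" using tR(2) by simp
    then have "Q (a + b) = Q (t powi k * 1) + Q z" using Qmult[of "t powi k" z] z(2) ab z_def by simp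
    also have "Q (t powi k * 1) = Q a"
      using Q_eq[of 1 k] Q_eq[OF *(1), of k] *(2) subring_1[OF R(1)] by (simp add: unit_def)
    finally show ?thesis using Q_R[OF z] by simp
  qed
  have unit1: "unit 1" using subring_1[OF R(1)] by (simp add: unit_def)
  have "Q \<in> points \<iota>"
    unfolding points_def
  proof (intro CollectI conjI allI impI)
    show "Q 0 = 0" by (simp add: Q_def)
    show "surj Q" by (rule surjI[of Q "\<lambda>k. t powi k * 1"]) (rule Q_eq[OF unit1])
    show "Q (a * b) = Q a + Q b" if "a \<noteq> 0" "b \<noteq> 0" for a b using Qmult[OF that] .
    show "min (Q a) (Q b) \<le> Q (a + b)" if "a \<noteq> 0" "b \<noteq> 0" "a + b \<noteq> 0" for a b
      using Qadd[OF that] Qadd[of b a] that by (cases "Q a \<le> Q b") (auto simp: add.commute)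
    show "Q (\<iota> c) = 0" if "c \<noteq> 0" for c
    proof -
      have "\<iota> c * \<iota> (1 / c) = 1" using that by (simp add: const_mult[symmetric])
      then have "1 / \<iota> c = \<iota> (1 / c)" using that by (simp add: field_simps)
      then have "unit (\<iota> c)" using R(2) that by (auto simp: unit_def)
      then show ?thesis using Q_eq[of "\<iota> c" 0] by simp
    qed
  qed
  moreover have "Q y > 0"
  proof -
    obtain k e where e: "unit e" "y = t ^ k * e" using decomp y by blast
    then have "Q y = int k" using Q_eq[of e "int k"] by (simp add: power_int_of_nat)
    moreover have "k \<noteq> 0" using e y(3) by (auto simp: unit_def intro!: gr0I)
    ultimately show ?thesis by simp
  qed
  ultimately show thesis by (rule that)
qed

text \<open>A nonconstant \<open>f\<close> is transcendental. Among the subrings that contain the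
  constants and \<open>1 / f\<close> but not \<open>f\<close>, Zorn's lemma gives a maximal one; it
  is a valuation ring in which \<open>1 / f\<close> is a non-unit, and the point it defines is a
  pole of \<open>f\<close>.\<close>

lemma no_poles_imp_const:
  assumes "\<And>Q. Q \<in> points \<iota> \<Longrightarrow> ord_ge Q 0 f"
  shows "f \<in> range \<iota>"
proof (rule ccontr)
  assume nc: "f \<notin> range \<iota>"
  then have tr: "\<not> algebraic_over \<iota> f" using full_constant_field by blast
  have f0: "f \<noteq> 0" using nc const_0 by (metis rangeI)
  define y where "y = 1 / f"
  have yf: "y * f = 1" "y \<noteq> 0" using f0 by (auto simp: y_def)
  define A where "A = {R. subring R \<and> range \<iota> \<subseteq> R \<and> y \<in> R \<and> f \<notin> R}"
  have const_ev: "range \<iota> \<subseteq> range (ev y)"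
  proof
    fix a assume "a \<in> range \<iota>"
    then obtain c where "a = ev y [:c:]" by auto
    then show "a \<in> range (ev y)" by blast
  qed
  have "y = ev y [:0, 1:]" by simp
  then have yev: "y \<in> range (ev y)" by blast
  have "range (ev y) \<in> A"
    using subring_range_ev transcendental_notin_ev_inverse[OF tr yf(1)] const_ev yev by (simp add: A_def)
  then have "A \<noteq> {}" by blast
  moreover have "\<Union>\<C> \<in> A" if C: "\<C> \<noteq> {}" "subset.chain A \<C>" for \<C>
  proof -
    have CA: "R \<in> A" if "R \<in> \<C>" for R using C(2) that by (auto simp: subset.chain_def)
    have common: "\<exists>R\<in>\<C>. a \<in> R \<and> b \<in> R" if "a \<in> \<Union>\<C>" "b \<in> \<Union>\<C>" for a b
    proof -
      from that obtain S T where ST: "S \<in> \<C>" "T \<in> \<C>" "a \<in> S" "b \<in> T" by blast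
      then have "S \<subseteq> T \<or> T \<subseteq> S" using C(2) by (auto simp: subset_chain_def)
      then show ?thesis using ST by blast
    qed
    have "subring (\<Union>\<C>)"
    proof (rule subringI)
      fix a b assume "a \<in> \<Union>\<C>" "b \<in> \<Union>\<C>"
      then obtain R where R: "R \<in> \<C>" "a \<in> R" "b \<in> R" using common by blast
      then have "subring R" using CA by (simp add: A_def)
      then show "a - b \<in> \<Union>\<C>" "a * b \<in> \<Union>\<C>"
        using R by (auto intro: subring_mult dest: subring_add_subgroup add_subgroup_diff)
    next
      obtain R where "R \<in> \<C>" using C(1) by blast
      moreover from this have "subring R" using CA by (simp add: A_def)
      ultimately show "0 \<in> \<Union>\<C>" "1 \<in> \<Union>\<C>"
        by (auto dest: subring_1 subring_add_subgroup add_subgroup_0)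
    qed
    then show ?thesis using C(1) CA unfolding A_def by blast
  qed
  ultimately obtain R where R: "R \<in> A" "\<forall>X\<in>A. R \<subseteq> X \<longrightarrow> X = R"
    using subset_Zorn_nonempty[of A] by blast
  have R': "subring R" "range \<iota> \<subseteq> R" "y \<in> R" "f \<notin> R" using R(1) by (auto simp: A_def)
  have max: "T = R" if "subring T" "R \<subseteq> T" "f \<notin> T" for T
  proof -
    have "T \<in> A" using that R' by (auto simp: A_def)
    then show ?thesis using R(2) that(2) by blast
  qed
  have val: "u \<in> R \<or> 1 / u \<in> R" if "u \<noteq> 0" for u
    by (rule maximal_subring_is_valuation_ring[OF R'(1) yf(1) R'(3,4) max that])
  have "1 / y = f" by (simp add: y_def)
  then obtain Q where Q: "Q \<in> points \<iota>" "Q y > 0"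
    using valuation_ring_point[OF R'(1,2) val R'(3) yf(2)] R'(4) by metis
  have "Q y = - Q f" using pt_divide[OF Q(1), of 1 f] pt_1[OF Q(1)] f0 by (simp add: y_def)
  then show False using Q assms[OF Q(1)] f0 by (simp add: ord_ge_def)
qed

end

subsection \<open>Residue fields\<close>

lemma card_field_ge_2: "2 \<le> CARD('f::{field,finite})"
proof -
  have "card {0, 1 :: 'f} \<le> CARD('f)" by (intro card_mono) auto
  then show ?thesis by simp
qed

context curve
begin

text \<open>This is the number q of constants, see \<open>base_eq\<close>. It is written through
  \<open>\<iota>\<close> because the type \<open>real\<close> would not determine
  \<open>'f\<close>.\<close>

definition base :: real where
  "base = real (card (range \<iota>))"

lemma base_eq: "base = real CARD('f)"
  by (simp add: base_def card_image inj_const)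

lemma base_gt_1: "1 < base"
  using card_field_ge_2[where ?'f = 'f] by (simp add: base_eq)

text \<open>For an infinite index \<open>card\<close> is 0 and the value carries no information;
  hence the finiteness hypotheses in the rules below.\<close>

definition ldim :: "'a::ab_group_add set \<Rightarrow> 'a set \<Rightarrow> real" where
  "ldim U V = log base (real (card (cosets U V)))"

lemma ldim_nonneg:
  assumes "add_subgroup V" "finite (cosets U V)"
  shows "0 \<le> ldim U V"
  using card_cosets_pos[OF assms] base_gt_1 by (simp add: ldim_def)

lemma ldim_tower:
  assumes "add_subgroup U" "add_subgroup V" "add_subgroup W" "U \<subseteq> V" "V \<subseteq> W" "finite (cosets U W)"
  shows "ldim U W = ldim U V + ldim V W"
proof -
  have fin: "finite (cosets U V)" "finite (cosets V W)"
    using index_tower(1)[OF assms(1-5)] assms(6) by auto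
  show ?thesis
    unfolding ldim_def index_tower(2)[OF assms(1-5)] of_nat_mult
    using card_cosets_pos[OF assms(2) fin(1)] card_cosets_pos[OF assms(3) fin(2)] base_gt_1
    by (intro log_mult_pos) auto
qed

lemma ldim_mono:
  assumes "add_subgroup V" "finite (cosets U V)" "card (cosets U V) \<le> card (cosets U' V')"
  shows "ldim U V \<le> ldim U' V'"
  unfolding ldim_def using card_cosets_pos[OF assms(1,2)] assms(3) base_gt_1 by simp

lemma ldim_power: "card (cosets U V) = CARD('f) ^ n \<Longrightarrow> ldim U V = real n"
  using base_gt_1 unfolding ldim_def base_eq[symmetric] of_nat_power
  by (simp add: of_nat_power base_eq[symmetric] log_nat_power)

end

context curve_basis
begin

lemma mult_ord_ge_image:
  assumes "Q \<in> points \<iota>" "w \<noteq> 0"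
  shows "(*) w ` {a. ord_ge Q n a} = {a. ord_ge Q (n + Q w) a}"
proof
  show "(*) w ` {a. ord_ge Q n a} \<subseteq> {a. ord_ge Q (n + Q w) a}"
    using assms by (auto simp: ord_ge_mult_iff)
  show "{a. ord_ge Q (n + Q w) a} \<subseteq> (*) w ` {a. ord_ge Q n a}"
  proof
    fix a assume "a \<in> {a. ord_ge Q (n + Q w) a}"
    then have "a / w \<in> {a. ord_ge Q n a}"
      using ord_ge_mult_iff[OF assms, of "n + Q w" "a / w"] assms(2) by simp
    then show "a \<in> (*) w ` {a. ord_ge Q n a}"
      using assms(2) by (intro image_eqI[of _ _ "a / w"]) auto
  qed
qed

text \<open>For a uniformizer \<open>w\<close> at \<open>Q\<close>, the elements of order at least 1
  are the multiples by \<open>w\<close> of those of order at least 0, so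
  \<open>finite_cosets_mult\<close> applies.\<close>

lemma finite_residue:
  assumes Q: "Q \<in> points \<iota>"
  shows "finite (cosets {a. ord_ge Q 1 a} {a. ord_ge Q 0 a})"
proof -
  obtain w where w: "w \<noteq> 0" "Q w = 1" using pt_surj[OF Q] .
  have "finite (cosets ((*) w ` {a. ord_ge Q 0 a}) {a. ord_ge Q 0 a})"
    using w ord_ge_mult_iff[OF Q w(1)] by (intro finite_cosets_mult add_subgroup_ord_ge Q)
      (auto intro: ord_ge_mono)
  then show ?thesis using mult_ord_ge_image[OF Q w(1), of 0] w(2) by simp
qed

text \<open>The shape of \<open>basis_mod\<close>, with its extensional coefficient functions, was
  taken from \<open>residue_basis\<close> for the sake of this equivalence.\<close>

lemma residue_basis_iff:
  "residue_basis \<iota> Q B \<longleftrightarrow> basis_mod (\<lambda>c f. \<iota> c * f) {a. ord_ge Q 1 a} {a. ord_ge Q 0 a} B"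
  by (auto simp: residue_basis_def basis_mod_def)

text \<open>This gives the \<open>THE\<close> in \<open>point_degree\<close> its meaning: a residue
  basis exists because the quotient is finite, and its size is determined because powers of q have
  distinct exponents.\<close>

lemma card_residue:
  assumes Q: "Q \<in> points \<iota>"
  shows "card (cosets {a. ord_ge Q 1 a} {a. ord_ge Q 0 a}) = CARD('f) ^ point_degree \<iota> Q"
proof -
  note sub = subspace_ord_ge[OF Q, of 1] subspace_ord_ge[OF Q, of 0]
  obtain B where B: "residue_basis \<iota> Q B"
    using basis_mod_exists[OF vector_space_field sub finite_residue[OF Q]]
    unfolding residue_basis_iff .
  have card: "card (cosets {a. ord_ge Q 1 a} {a. ord_ge Q 0 a}) = CARD('f) ^ card B"
    if "residue_basis \<iota> Q B" for B
    using card_basis_mod(2)[OF vector_space_field sub] that unfolding residue_basis_iff by blast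
  have "point_degree \<iota> Q = card B"
    unfolding point_degree_def
  proof (rule the_equality)
    fix n assume "\<exists>B. residue_basis \<iota> Q B \<and> card B = n"
    then obtain B' where "residue_basis \<iota> Q B'" "card B' = n" by blast
    then have "CARD('f) ^ n = CARD('f) ^ card B" using card[of B'] card[OF B] by simp
    then show "n = card B"
      using card_field_ge_2[where ?'f = 'f] by (subst (asm) power_inject_exp) auto
  qed (use B in blast)
  then show ?thesis using card[OF B] by simp
qed

lemma point_degree_pos:
  assumes Q: "Q \<in> points \<iota>"
  shows "0 < point_degree \<iota> Q"
proof (rule ccontr)
  assume "\<not> ?thesis"
  then have "{a. ord_ge Q 1 a} = {a. ord_ge Q 0 a}"
    using card_residue[OF Q]
    by (intro card_cosets_eq_1 add_subgroup_ord_ge Q) (auto intro: ord_ge_mono)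
  moreover have "1 \<in> {a. ord_ge Q 0 a}" "1 \<notin> {a. ord_ge Q 1 a}"
    using pt_1[OF Q] by (auto simp: ord_ge_def)
  ultimately show False by blast
qed

subsection \<open>Divisors\<close>

abbreviation mult_at :: "'k divisor \<Rightarrow> 'k point \<Rightarrow> int" where
  "mult_at \<equiv> Poly_Mapping.lookup"

abbreviation pt :: "'k point \<Rightarrow> 'k divisor" where
  "pt Q \<equiv> Poly_Mapping.single Q 1"

lemma mult_at_pt: "mult_at (pt Q) R = (if R = Q then 1 else 0)"
  by (simp add: lookup_single when_def)

lemma divisors_0: "0 \<in> divisors \<iota>"
  by (simp add: divisors_def)

lemma divisors_add: "D \<in> divisors \<iota> \<Longrightarrow> E \<in> divisors \<iota> \<Longrightarrow> D + E \<in> divisors \<iota>"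
  using keys_add[of D E] by (auto simp: divisors_def)

lemma divisors_diff: "D \<in> divisors \<iota> \<Longrightarrow> E \<in> divisors \<iota> \<Longrightarrow> D - E \<in> divisors \<iota>"
  using keys_diff[of D E] by (auto simp: divisors_def)

lemma divisors_single: "Q \<in> points \<iota> \<Longrightarrow> Poly_Mapping.single Q n \<in> divisors \<iota>"
  by (auto simp: divisors_def)

lemma divisor_exists:
  assumes "finite {Q \<in> points \<iota>. c Q \<noteq> 0}"
  obtains D where "D \<in> divisors \<iota>" "\<And>Q. Q \<in> points \<iota> \<Longrightarrow> mult_at D Q = c Q"
proof -
  define c' where "c' Q = (if Q \<in> points \<iota> then c Q else 0)" for Q
  have "{Q. c' Q \<noteq> 0} = {Q \<in> points \<iota>. c Q \<noteq> 0}" by (auto simp: c'_def)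
  then have "finite {Q. c' Q \<noteq> 0}" using assms by simp
  then have l: "mult_at (Poly_Mapping.Abs_poly_mapping c') = c'"
    by (simp add: lookup_Abs_poly_mapping)
  show thesis
  proof (rule that)
    show "Poly_Mapping.Abs_poly_mapping c' \<in> divisors \<iota>"
      using l by (auto simp: divisors_def in_keys_iff c'_def split: if_splits)
    show "mult_at (Poly_Mapping.Abs_poly_mapping c') Q = c Q" if "Q \<in> points \<iota>" for Q
      using l that by (simp add: c'_def)
  qed
qed

lemma divisor_degree_superset:
  assumes "finite X" "Poly_Mapping.keys D \<subseteq> X"
  shows "divisor_degree \<iota> D = (\<Sum>Q\<in>X. mult_at D Q * int (point_degree \<iota> Q))"
  unfolding divisor_degree_def using assms
  by (intro sum.mono_neutral_left) (auto simp: in_keys_iff)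

lemma divisor_degree_0: "divisor_degree \<iota> 0 = 0"
  by (simp add: divisor_degree_def)

lemma divisor_degree_add: "divisor_degree \<iota> (D + E) = divisor_degree \<iota> D + divisor_degree \<iota> E"
proof -
  let ?X = "Poly_Mapping.keys D \<union> Poly_Mapping.keys E"
  have "finite ?X" "Poly_Mapping.keys (D + E) \<subseteq> ?X" using keys_add[of D E] by auto
  then show ?thesis
    by (simp add: divisor_degree_superset[of ?X] lookup_add distrib_right sum.distrib)
qed

lemma divisor_degree_diff: "divisor_degree \<iota> (D - E) = divisor_degree \<iota> D - divisor_degree \<iota> E"
  using divisor_degree_add[of "D - E" E] by simp

lemma divisor_degree_single:
  "divisor_degree \<iota> (Poly_Mapping.single Q n) = n * int (point_degree \<iota> Q)"
  by (simp add: divisor_degree_def)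

text \<open>The set \<open>T\<close> keeps track of which points are added: in the final estimate
  each of them has to come from the support of \<open>Z\<close> or be \<open>P\<close>.\<close>

lemma effective_induct [consumes 2, case_names zero add]:
  assumes "effective Z" "Poly_Mapping.keys Z \<subseteq> T"
    and zero: "\<Phi> 0"
    and add: "\<And>Z Q. Q \<in> T \<Longrightarrow> effective Z \<Longrightarrow> Poly_Mapping.keys Z \<subseteq> T \<Longrightarrow> \<Phi> Z \<Longrightarrow> \<Phi> (Z + pt Q)"
  shows "\<Phi> Z"
  using assms(1,2)
proof (induction "nat (\<Sum>Q\<in>Poly_Mapping.keys Z. mult_at Z Q)" arbitrary: Z rule: less_induct)
  case less
  show ?case
  proof (cases "Z = 0")
    case False
    then obtain Q where Q: "Q \<in> Poly_Mapping.keys Z" by (metis keys_eq_empty ex_in_conv)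
    define Y where "Y = Z - pt Q"
    have QZ: "mult_at Z Q \<ge> 1" using Q less.prems(1)
      by (auto simp: effective_def in_keys_iff int_one_le_iff_zero_less order_less_le)
    have eff: "effective Y"
      using less.prems(1) QZ by (auto simp: effective_def Y_def lookup_minus mult_at_pt)
    have sub: "Poly_Mapping.keys Y \<subseteq> Poly_Mapping.keys Z"
      using Q QZ keys_diff[of Z "pt Q"] by (auto simp: Y_def)
    have "(\<Sum>R\<in>Poly_Mapping.keys Y. mult_at Y R) = (\<Sum>R\<in>Poly_Mapping.keys Z. mult_at Y R)"
      using sub by (intro sum.mono_neutral_left) (auto simp: in_keys_iff)
    also have "\<dots> = (\<Sum>R\<in>Poly_Mapping.keys Z. mult_at Z R) - 1"
      using Q by (simp add: Y_def lookup_minus mult_at_pt sum_subtractf)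
    finally have s: "(\<Sum>R\<in>Poly_Mapping.keys Y. mult_at Y R) = (\<Sum>R\<in>Poly_Mapping.keys Z. mult_at Z R) - 1" .
    have "0 \<le> (\<Sum>R\<in>Poly_Mapping.keys Y. mult_at Y R)"
      using eff by (intro sum_nonneg) (auto simp: effective_def)
    then have "\<Phi> Y" using s eff sub less.prems(2) by (intro less.hyps) auto
    then have "\<Phi> (Y + pt Q)" using eff sub less.prems(2) Q by (intro add) auto
    then show ?thesis by (simp add: Y_def)
  qed (use zero in simp)
qed

subsection \<open>Bounded adeles\<close>

text \<open>Off the finite support of \<open>D\<close> the local conditions say that the order is
  nonnegative, so they imply the adele condition.\<close>

lemma bounded_adeles_iff:
  "\<alpha> \<in> bounded_adeles \<iota> D \<longleftrightarrow> (\<forall>Q\<in>points \<iota>. ord_ge Q (- mult_at D Q) (\<alpha> Q))"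
proof -
  have "\<alpha> \<in> adeles \<iota>" if "\<forall>Q\<in>points \<iota>. ord_ge Q (- mult_at D Q) (\<alpha> Q)"
  proof -
    have "{Q \<in> points \<iota>. \<not> ord_ge Q 0 (\<alpha> Q)} \<subseteq> Poly_Mapping.keys D"
    proof
      fix Q assume "Q \<in> {Q \<in> points \<iota>. \<not> ord_ge Q 0 (\<alpha> Q)}"
      then have "mult_at D Q \<noteq> 0" using that by auto
      then show "Q \<in> Poly_Mapping.keys D" by (simp add: in_keys_iff)
    qed
    then show ?thesis unfolding adeles_def using finite_subset finite_keys by blast
  qed
  then show ?thesis by (auto simp: bounded_adeles_def)
qed

lemma bounded_adeles_subset_adeles: "bounded_adeles \<iota> D \<subseteq> adeles \<iota>"
  by (auto simp: bounded_adeles_def)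

lemma bounded_adeles_mono: "effective (E - D) \<Longrightarrow> bounded_adeles \<iota> D \<subseteq> bounded_adeles \<iota> E"
  unfolding effective_def lookup_minus
  by (auto simp: bounded_adeles_iff intro!: ord_ge_mono[of _ "- mult_at D _" _ "- mult_at E _"])

lemma subspace_bounded_adeles:
  "module.subspace (\<lambda>c \<alpha> Q. \<iota> c * \<alpha> Q) (bounded_adeles \<iota> D)"
proof -
  interpret vector_space "\<lambda>c (\<alpha> :: 'k point \<Rightarrow> 'k) Q. \<iota> c * \<alpha> Q" by (rule vector_space_fun)
  have "ord_ge Q n (\<iota> c * a)" if "Q \<in> points \<iota>" "ord_ge Q n a" for Q n c a
    using ord_ge_mult[OF that(1) ord_ge_const[OF that(1)] that(2)] by simp
  then show ?thesis
    by (auto simp: subspace_def bounded_adeles_iff intro: ord_ge_add)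
qed

lemma add_subgroup_bounded_adeles: "add_subgroup (bounded_adeles \<iota> D)"
  using vector_space.add_subgroup_subspace[OF vector_space_fun subspace_bounded_adeles] .

lemma adele_bounded:
  assumes "\<alpha> \<in> adeles \<iota>"
  obtains D where "D \<in> divisors \<iota>" "effective D" "\<alpha> \<in> bounded_adeles \<iota> D"
proof -
  define c where "c Q = (if ord_ge Q 0 (\<alpha> Q) then 0 else - Q (\<alpha> Q))" for Q
  have "finite {Q \<in> points \<iota>. \<not> ord_ge Q 0 (\<alpha> Q)}" using assms by (simp add: adeles_def)
  then have "finite {Q \<in> points \<iota>. c Q \<noteq> 0}"
    by (rule rev_finite_subset) (auto simp: c_def)
  then obtain D where D: "D \<in> divisors \<iota>" "\<And>Q. Q \<in> points \<iota> \<Longrightarrow> mult_at D Q = c Q"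
    using divisor_exists by blast
  have "effective D"
    unfolding effective_def
  proof
    fix Q show "0 \<le> mult_at D Q"
    proof (cases "Q \<in> points \<iota>")
      case True
      then show ?thesis using D(2) by (auto simp: c_def ord_ge_def)
    next
      case False
      then have "Q \<notin> Poly_Mapping.keys D" using D(1) by (auto simp: divisors_def)
      then show ?thesis by (simp add: in_keys_iff)
    qed
  qed
  moreover have "\<alpha> \<in> bounded_adeles \<iota> D"
    using D(2) by (auto simp: bounded_adeles_iff c_def) (auto simp: ord_ge_def)
  ultimately show thesis using D(1) that by blast
qed

text \<open>The two spaces differ only in the component at \<open>Q\<close>, where the quotient is a
  rescaled copy of the residue field.\<close>

lemma index_bounded_adeles_pt:
  assumes Q: "Q \<in> points \<iota>"
  shows "finite (cosets (bounded_adeles \<iota> D) (bounded_adeles \<iota> (D + pt Q)))"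
    "card (cosets (bounded_adeles \<iota> D) (bounded_adeles \<iota> (D + pt Q))) = CARD('f) ^ point_degree \<iota> Q"
proof -
  \<comment> \<open>Multiplication by \<open>s\<close> moves order 0 to the lowest order that
    \<open>D + pt Q\<close> allows at \<open>Q\<close>, and order 1 to the lowest that
    \<open>D\<close> allows.\<close>
  obtain s where s: "s \<noteq> 0" "Q s = - (mult_at D Q + 1)" using pt_surj[OF Q] .
  define f where "f r = (\<lambda>R. if R = Q then s * r else 0)" for r
  have f1: "f r \<in> bounded_adeles \<iota> (D + pt Q)" if "r \<in> {a. ord_ge Q 0 a}" for r
    using that ord_ge_mult_iff[OF Q s(1)] s(2) by (auto simp: bounded_adeles_iff f_def lookup_add mult_at_pt)
  have f2: "f r - f r' \<in> bounded_adeles \<iota> D \<longleftrightarrow> r - r' \<in> {a. ord_ge Q 1 a}" for r r'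
    using Q ord_ge_mult_iff[OF Q s(1), of "- mult_at D Q" "r - r'"] s(2)
    by (auto simp: bounded_adeles_iff f_def right_diff_distrib)
  have f3: "\<exists>r\<in>{a. ord_ge Q 0 a}. \<alpha> - f r \<in> bounded_adeles \<iota> D"
    if "\<alpha> \<in> bounded_adeles \<iota> (D + pt Q)" for \<alpha>
  proof
    have "ord_ge Q (- mult_at D Q - 1) (s * (\<alpha> Q / s))"
      using that Q s(1) by (auto simp: bounded_adeles_iff lookup_add mult_at_pt dest: bspec[of _ _ Q])
    then show "\<alpha> Q / s \<in> {a. ord_ge Q 0 a}"
      using ord_ge_mult_iff[OF Q s(1), of "- mult_at D Q - 1" "\<alpha> Q / s"] s(2) by simp
    show "\<alpha> - f (\<alpha> Q / s) \<in> bounded_adeles \<iota> D"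
      unfolding bounded_adeles_iff
    proof
      fix R assume R: "R \<in> points \<iota>"
      show "ord_ge R (- mult_at D R) ((\<alpha> - f (\<alpha> Q / s)) R)"
        using bspec[OF that[unfolded bounded_adeles_iff] R] s(1)
        by (cases "R = Q") (auto simp: f_def lookup_add mult_at_pt)
    qed
  qed
  note iso = index_iso[OF add_subgroup_ord_ge[OF Q] add_subgroup_bounded_adeles f1 f2 f3]
  show "finite (cosets (bounded_adeles \<iota> D) (bounded_adeles \<iota> (D + pt Q)))"
    using iso(1) finite_residue[OF Q] by simp
  show "card (cosets (bounded_adeles \<iota> D) (bounded_adeles \<iota> (D + pt Q))) = CARD('f) ^ point_degree \<iota> Q"
    using iso(2) card_residue[OF Q] by simp
qed

lemma index_bounded_adeles_add:
  assumes "effective Z" "Z \<in> divisors \<iota>"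
  shows "finite (cosets (bounded_adeles \<iota> D) (bounded_adeles \<iota> (D + Z))) \<and>
    ldim (bounded_adeles \<iota> D) (bounded_adeles \<iota> (D + Z)) = real_of_int (divisor_degree \<iota> Z)"
proof -
  have "Poly_Mapping.keys Z \<subseteq> points \<iota>" using assms(2) by (simp add: divisors_def)
  with assms(1) show ?thesis
  proof (induction rule: effective_induct)
    case zero
    have "card (cosets (bounded_adeles \<iota> D) (bounded_adeles \<iota> D)) = 1"
      by (rule card_cosets_self[OF add_subgroup_bounded_adeles])
    then show ?case by (auto simp: ldim_def divisor_degree_0 intro: card_ge_0_finite)
  next
    case (add Z Q)
    let ?A = "bounded_adeles \<iota>"
    have 1: "finite (cosets (?A (D + Z)) (?A (D + Z + pt Q)))"
      "ldim (?A (D + Z)) (?A (D + Z + pt Q)) = real (point_degree \<iota> Q)"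
      using index_bounded_adeles_pt[OF add(1), of "D + Z"] ldim_power by auto
    have sub: "?A D \<subseteq> ?A (D + Z)" "?A (D + Z) \<subseteq> ?A (D + Z + pt Q)"
      using add(2) by (auto intro!: bounded_adeles_mono simp: effective_def mult_at_pt)
    note grp = add_subgroup_bounded_adeles
    have fin: "finite (cosets (?A D) (?A (D + Z + pt Q)))"
      using index_tower(1)[OF grp grp grp sub] 1 add by simp
    have "ldim (?A D) (?A (D + Z + pt Q)) = divisor_degree \<iota> Z + real (point_degree \<iota> Q)"
      using ldim_tower[OF grp grp grp sub fin] 1 add by simp
    then show ?case
      using fin by (simp add: divisor_degree_add divisor_degree_single add.assoc)
  qed
qed

lemma index_bounded_adeles:
  assumes "effective (E - D)" "D \<in> divisors \<iota>" "E \<in> divisors \<iota>"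
  shows "finite (cosets (bounded_adeles \<iota> D) (bounded_adeles \<iota> E))"
    "ldim (bounded_adeles \<iota> D) (bounded_adeles \<iota> E) = divisor_degree \<iota> E - divisor_degree \<iota> D"
  using index_bounded_adeles_add[OF assms(1) divisors_diff[OF assms(3,2)], of D]
  by (simp_all add: divisor_degree_diff)

subsection \<open>Weak approximation\<close>

text \<open>If regularity at \<open>Q\<close> implied regularity at \<open>R\<close>, units at
  \<open>Q\<close> would be units at \<open>R\<close>, and \<open>R\<close> would be
  \<open>R t\<close> times \<open>Q\<close> for a uniformizer \<open>t\<close> at \<open>Q\<close>.
  Surjectivity of \<open>R\<close> makes this factor 1 or -1, and regularity of \<open>t\<close>
  excludes -1.\<close>

lemma points_separate:
  assumes Q: "Q \<in> points \<iota>" and R: "R \<in> points \<iota>" and ne: "Q \<noteq> R"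
  obtains (separated) u where "u \<noteq> 0" "Q u \<ge> 0" "R u < 0"
proof (rule ccontr)
  assume none: "\<not> thesis"
  have ge: "R u \<ge> 0" if "u \<noteq> 0" "Q u \<ge> 0" for u
    using none that separated[of u] by force
  have unit: "R u = 0" if "u \<noteq> 0" "Q u = 0" for u
    using ge[of u] ge[of "inverse u"] that pt_inverse[OF Q, of u] pt_inverse[OF R, of u] by simp
  obtain t where t: "t \<noteq> 0" "Q t = 1" using pt_surj[OF Q] .
  have scaled: "R u = Q u * R t" if "u \<noteq> 0" for u
  proof -
    have Rp: "R (t powi k) = k * R t" and Qp: "Q (t powi k) = k" for k
      using t pt_power[OF R] pt_power[OF Q] pt_inverse[OF R] pt_inverse[OF Q]
      by (auto simp: power_int_def)
    have nz: "t powi Q u \<noteq> 0" using t by simp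
    have "R (u / t powi Q u) = 0"
      using that nz pt_divide[OF Q that nz] Qp by (intro unit) auto
    then show ?thesis using pt_divide[OF R that nz] Rp by simp
  qed
  obtain s where "s \<noteq> 0" "R s = 1" using pt_surj[OF R] .
  then have "Q s * R t = 1" using scaled by simp
  then have "R t = 1 \<or> R t = - 1" by (metis mult.commute zmult_eq_1_iff)
  moreover have "R t \<ge> 0" using ge t by simp
  ultimately have "R t = 1" by simp
  \<comment> \<open>Equality of the points as functions also includes the argument 0, where both
    have the dummy value.\<close>
  then have "R u = Q u" for u using scaled[of u] pt_0[OF Q] pt_0[OF R] by (cases "u = 0") auto
  then show False using ne by auto
qed

lemma points_separate_strict:
  assumes Q: "Q \<in> points \<iota>" and R: "R \<in> points \<iota>" and ne: "Q \<noteq> R"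
  obtains u where "u \<noteq> 0" "Q u > 0" "R u < 0"
proof -
  obtain u where u: "u \<noteq> 0" "Q u \<ge> 0" "R u < 0" using points_separate[OF Q R ne] .
  obtain v where v: "v \<noteq> 0" "R v \<ge> 0" "Q v < 0" using points_separate[OF R Q] ne by blast
  show thesis
    using that[of "u / v"] u v pt_divide[OF Q u(1) v(1)] pt_divide[OF R u(1) v(1)] by simp
qed

lemma points_separate_finite:
  assumes "finite T" "T \<subseteq> points \<iota>" "Q \<in> points \<iota>" "Q \<notin> T"
  shows "\<exists>u. u \<noteq> 0 \<and> Q u > 0 \<and> (\<forall>R\<in>T. R u < 0)"
  using assms
proof (induction T)
  case empty
  obtain s where "s \<noteq> 0" "Q s = 1" using pt_surj[OF empty(2)] .
  then show ?case by (intro exI[of _ s]) auto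
next
  case (insert S T)
  then obtain u where u: "u \<noteq> 0" "Q u > 0" "\<forall>R\<in>T. R u < 0" by auto
  have Q: "Q \<in> points \<iota>" and S: "S \<in> points \<iota>" using insert by auto
  show ?case
  proof (cases "S u < 0")
    case True
    then show ?thesis using u by blast
  next
    case False
    obtain t where t: "t \<noteq> 0" "Q t > 0" "S t < 0"
      using points_separate_strict[OF Q S] insert.prems by blast
    \<comment> \<open>The exponent exceeds every \<open>\<bar>R u\<bar>\<close>. The order of
      \<open>t ^ r\<close> at \<open>R\<close> is then nonnegative or at most \<open>- r\<close>,
      never equal to the negative \<open>R u\<close>, so no cancellation occurs in
      \<open>u + t ^ r\<close>.\<close>
    define r where "r = nat (1 + (\<Sum>R\<in>T. \<bar>R u\<bar>))"
    have r: "int r = 1 + (\<Sum>R\<in>T. \<bar>R u\<bar>)" by (simp add: r_def sum_nonneg)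
    then have r0: "int r \<ge> 1" by (simp add: sum_nonneg)
    let ?z = "u + t ^ r"
    have tr: "t ^ r \<noteq> 0" using t by simp
    have "?z = t ^ r + u" by simp
    moreover have "S (t ^ r) < S u"
      using False pt_power[OF S, of t r] t(3) r0 by (smt (verit) mult_less_0_iff)
    ultimately have z: "?z \<noteq> 0" "S ?z < 0"
      using pt_add_eq[OF S tr, of u] pt_power[OF S, of t r] t(3) r0
      by (auto simp: mult_less_0_iff add.commute)
    have "0 < int r * Q t" using r0 t(2) by (intro mult_pos_pos) auto
    then have "ord_ge Q 1 (t ^ r)" using pt_power[OF Q, of t r] by (simp add: ord_ge_def)
    moreover have "ord_ge Q 1 u" using u(2) by (simp add: ord_ge_def)
    ultimately have "ord_ge Q 1 ?z" by (intro ord_ge_add Q)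
    then have "Q ?z > 0" using z by (simp add: ord_ge_def)
    moreover have "R ?z < 0" if "R \<in> T" for R
    proof -
      have R: "R \<in> points \<iota>" using insert that by auto
      have Ru: "R u < 0" using u that by blast
      have bd: "\<bar>R u\<bar> < int r"
        using member_le_sum[OF that, of "\<lambda>R. \<bar>R u\<bar>"] insert(1) r by simp
      have "R (t ^ r) = int r * R t" using pt_power[OF R] .
      moreover have "int r * R t \<le> - int r \<or> int r * R t \<ge> 0"
      proof (cases "R t \<ge> 0")
        case False
        then have "int r * R t \<le> int r * (- 1)" using r0 by (intro mult_left_mono) auto
        then show ?thesis by simp
      qed simp
      ultimately have "R (t ^ r) < R u \<or> R u < R (t ^ r)" using Ru bd by linarith
      then show ?thesis
      proof
        assume "R (t ^ r) < R u"
        then show ?thesis using pt_add_eq(2)[OF R tr, of u] Ru by (simp add: add.commute)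
      next
        assume "R u < R (t ^ r)"
        then show ?thesis using pt_add_eq(2)[OF R u(1), of "t ^ r"] Ru by simp
      qed
    qed
    ultimately show ?thesis using z by blast
  qed
qed

text \<open>For \<open>u\<close> with a zero at \<open>Q\<close> and poles on \<open>T\<close>, the
  function \<open>1 / (1 + u ^ n)\<close> is close to 1 at \<open>Q\<close> and close to 0 on
  \<open>T\<close>.\<close>

lemma weak_approximation_one:
  assumes "finite T" "T \<subseteq> points \<iota>" "Q \<in> points \<iota>" "Q \<notin> T"
  shows "\<exists>z. ord_ge Q (int m) (z - 1) \<and> (\<forall>R\<in>T. ord_ge R (int m) z)"
proof -
  obtain u where u: "u \<noteq> 0" "Q u > 0" "\<forall>R\<in>T. R u < 0"
    using points_separate_finite[OF assms] by blast
  have Q: "Q \<in> points \<iota>" by fact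
  \<comment> \<open>A positive exponent even for \<open>m = 0\<close>, so that \<open>u ^ ?n\<close>
    vanishes at \<open>Q\<close> and \<open>1 + u ^ ?n\<close> is a unit there.\<close>
  let ?n = "Suc m"
  have un: "u ^ ?n \<noteq> 0" using u(1) by simp
  have Qn: "Q (u ^ ?n) \<ge> int ?n"
    using pt_power[OF Q, of u ?n] u(2) mult_left_mono[of 1 "Q u" "int ?n"] by simp
  have "Q 1 < Q (u ^ ?n)" using Qn pt_1[OF Q] by simp
  then have w: "1 + u ^ ?n \<noteq> 0" "Q (1 + u ^ ?n) = 0"
    using pt_add_eq[OF Q, of 1 "u ^ ?n"] pt_1[OF Q] by auto
  define z where "z = 1 / (1 + u ^ ?n)"
  have "z - 1 = - (u ^ ?n / (1 + u ^ ?n))" using w(1) by (simp add: z_def field_simps)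
  then have "ord_ge Q (int m) (z - 1)"
    using pt_divide[OF Q un w(1)] w(2) Qn ord_ge_minus[OF Q] by (simp only: ord_ge_def) simp
  moreover have "ord_ge R (int m) z" if "R \<in> T" for R
  proof -
    have R: "R \<in> points \<iota>" using assms that by auto
    have "R u \<le> - 1" using u(3) that by force
    then have Rn: "R (u ^ ?n) \<le> - int ?n"
      using pt_power[OF R, of u ?n] mult_left_mono[of "R u" "- 1" "int ?n"] by simp
    then have "R (u ^ ?n + 1) = R (u ^ ?n)"
      using pt_add_eq(2)[OF R un, of 1] pt_1[OF R] by simp
    then have "R z = - R (u ^ ?n)"
      using pt_divide[OF R _ w(1), of 1] pt_1[OF R] by (simp add: z_def add.commute)
    then show ?thesis using Rn by (simp add: ord_ge_def)
  qed
  ultimately show ?thesis by blast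
qed

lemma weak_approximation:
  assumes T: "finite T" "T \<subseteq> points \<iota>"
  obtains z where "\<And>Q. Q \<in> T \<Longrightarrow> ord_ge Q m (z - a Q)"
proof -
  \<comment> \<open>The precision of the approximate idempotents has to absorb the poles of every
    \<open>a R\<close> at every other point of \<open>T\<close>.\<close>
  define M where "M = nat (\<bar>m\<bar> + (\<Sum>Q\<in>T. \<Sum>R\<in>T. \<bar>Q (a R)\<bar>))"
  have Mb: "m - Q (a R) \<le> int M" if "Q \<in> T" "R \<in> T" for Q R
  proof -
    have "\<bar>Q (a R)\<bar> \<le> (\<Sum>R\<in>T. \<bar>Q (a R)\<bar>)" using that T by (intro member_le_sum) auto
    also have "\<dots> \<le> (\<Sum>Q\<in>T. \<Sum>R\<in>T. \<bar>Q (a R)\<bar>)"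
      using that T by (intro member_le_sum[of Q T "\<lambda>Q. \<Sum>R\<in>T. \<bar>Q (a R)\<bar>"]) (auto simp: sum_nonneg)
    finally show ?thesis unfolding M_def by linarith
  qed
  have "\<exists>z. ord_ge Q (int M) (z - 1) \<and> (\<forall>R\<in>T - {Q}. ord_ge R (int M) z)" if "Q \<in> T" for Q
    using weak_approximation_one[of "T - {Q}" Q M] T that by auto
  then obtain z where z: "\<And>Q. Q \<in> T \<Longrightarrow> ord_ge Q (int M) (z Q - 1)"
      "\<And>Q R. Q \<in> T \<Longrightarrow> R \<in> T \<Longrightarrow> R \<noteq> Q \<Longrightarrow> ord_ge R (int M) (z Q)"
    by (metis DiffI singletonD)
  have key: "ord_ge Q m (a R * c)" if "Q \<in> T" "R \<in> T" "ord_ge Q (int M) c" for Q R c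
  proof (cases "a R = 0")
    case False
    then show ?thesis
      using that T Mb[OF that(1,2)] ord_ge_mult_iff[of Q "a R" m c] by (auto intro: ord_ge_mono)
  qed simp
  have "ord_ge Q m ((\<Sum>R\<in>T. a R * z R) - a Q)" if "Q \<in> T" for Q
  proof -
    have Q: "Q \<in> points \<iota>" using that T by auto
    have "(\<Sum>R\<in>T. a R * z R) - a Q = a Q * (z Q - 1) + (\<Sum>R\<in>T - {Q}. a R * z R)"
      using T that by (subst sum.remove[of T Q]) (auto simp: algebra_simps)
    also have "ord_ge Q m \<dots>"
    proof (intro ord_ge_add ord_ge_sum Q)
      show "ord_ge Q m (a Q * (z Q - 1))" using key[OF that that z(1)[OF that]] .
      show "ord_ge Q m (a R * z R)" if "R \<in> T - {Q}" for R
        using key[of Q R] z(2)[of R Q] that \<open>Q \<in> T\<close> by auto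
    qed
    finally show ?thesis .
  qed
  then show thesis using that by blast
qed

subsection \<open>Zeros and poles\<close>

text \<open>By weak approximation, the functions regular on the support of \<open>Z\<close> map onto
  A(0)/A(-Z), whose dimension is the degree of \<open>Z\<close>, and multiples of \<open>w\<close>
  go to 0. The data \<open>h\<close> and \<open>e\<close> are parameters because Riemann's theorem
  needs sharp values of \<open>e\<close>, not just some multiplier.\<close>

lemma degree_zeros_le:
  assumes w: "w \<noteq> 0" and h: "h \<noteq> 0" "degree h \<le> e"
    and step: "\<And>d v. v \<in> V d \<Longrightarrow> ev x h * w * v \<in> V (d + e)"
    and Z: "Z \<in> divisors \<iota>" "effective Z"
    and le: "\<And>Q. Q \<in> points \<iota> \<Longrightarrow> mult_at Z Q \<noteq> 0 \<Longrightarrow> mult_at Z Q \<le> Q w"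
  shows "divisor_degree \<iota> Z \<le> int (N * e)"
proof -
  let ?T = "Poly_Mapping.keys Z"
  have T: "finite ?T" "?T \<subseteq> points \<iota>" using Z by (auto simp: divisors_def)
  define R where "R = {a. \<forall>Q\<in>?T. ord_ge Q 0 a}"
  have gR: "add_subgroup R"
    unfolding R_def using T by (auto intro!: add_subgroupI ord_ge_diff)
  have Tw: "Q w \<ge> mult_at Z Q" "mult_at Z Q \<ge> 0" if "Q \<in> ?T" for Q
    using le[of Q] that T Z(2) by (auto simp: in_keys_iff effective_def)
  have wR: "w * r \<in> R" if "r \<in> R" for r
    unfolding R_def
  proof (intro CollectI ballI)
    fix Q assume Q: "Q \<in> ?T"
    then have "ord_ge Q 0 r" using that by (simp add: R_def)
    then show "ord_ge Q 0 (w * r)"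
      using Q T Tw[OF Q] ord_ge_mult_iff[of Q w 0 r] w ord_ge_mono[of Q 0 r "- Q w"] by auto
  qed
  have gwR: "add_subgroup ((*) w ` R)" using gR by (rule add_subgroup_mult_image)
  have bd: "finite (cosets ((*) w ` R) R)" "card (cosets ((*) w ` R) R) \<le> CARD('f) ^ (N * e)"
    by (rule cosets_bounded[OF gwR], rule card_incongruent_bound[OF gR wR w h step]; assumption)+
  \<comment> \<open>Zero off the support: there A(0) and A(-Z) impose the same condition, so no
    approximation is required.\<close>
  define f where "f r = (\<lambda>Q. if Q \<in> ?T then r else 0 :: 'k)" for r
  have f2: "f a - f b \<in> bounded_adeles \<iota> (0 - Z)" if "a - b \<in> (*) w ` R" for a b
  proof -
    from that obtain r where r: "r \<in> R" "a - b = w * r" by blast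
    have "ord_ge Q (mult_at Z Q) (w * r)" if "Q \<in> ?T" for Q
      using r(1) that T Tw[OF that] w ord_ge_mult_iff[of Q w "mult_at Z Q" r]
        ord_ge_mono[of Q 0 r "mult_at Z Q - Q w"] by (auto simp: R_def)
    then show ?thesis
      using r(2) by (auto simp: bounded_adeles_iff f_def lookup_minus)
  qed
  have f3: "\<exists>a\<in>R. \<alpha> - f a \<in> bounded_adeles \<iota> (0 - Z)" if \<alpha>: "\<alpha> \<in> bounded_adeles \<iota> 0" for \<alpha>
  proof -
    define m where "m = (\<Sum>Q\<in>?T. mult_at Z Q)"
    have m: "mult_at Z Q \<le> m" if "Q \<in> ?T" for Q
      unfolding m_def using that T Tw by (intro member_le_sum) auto
    obtain a where a: "\<And>Q. Q \<in> ?T \<Longrightarrow> ord_ge Q m (a - \<alpha> Q)"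
      using weak_approximation[OF T] by blast
    have "ord_ge Q 0 (a - \<alpha> Q + \<alpha> Q)" if "Q \<in> ?T" for Q
    proof (rule ord_ge_add)
      show "Q \<in> points \<iota>" using that T by blast
      show "ord_ge Q 0 (a - \<alpha> Q)" using a[OF that] m[OF that] Tw[OF that] by (auto intro: ord_ge_mono)
      show "ord_ge Q 0 (\<alpha> Q)" using \<alpha> that T by (auto simp: bounded_adeles_iff)
    qed
    then have "a \<in> R" by (simp add: R_def)
    moreover have "\<alpha> - f a \<in> bounded_adeles \<iota> (0 - Z)"
      unfolding bounded_adeles_iff
    proof
      fix Q assume Q: "Q \<in> points \<iota>"
      show "ord_ge Q (- mult_at (0 - Z) Q) ((\<alpha> - f a) Q)"
      proof (cases "Q \<in> ?T")
        case True
        then have "ord_ge Q (mult_at Z Q) (a - \<alpha> Q)" using a m by (auto intro: ord_ge_mono)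
        then have "ord_ge Q (mult_at Z Q) (\<alpha> Q - a)"
          using ord_ge_minus[OF Q, of "mult_at Z Q" "a - \<alpha> Q"] by simp
        then show ?thesis using True by (simp add: f_def lookup_minus)
      next
        case False
        then show ?thesis using \<alpha> Q by (simp add: f_def lookup_minus in_keys_iff bounded_adeles_iff)
      qed
    qed
    ultimately show ?thesis by blast
  qed
  have "card (cosets (bounded_adeles \<iota> (0 - Z)) (bounded_adeles \<iota> 0)) \<le> card (cosets ((*) w ` R) R)"
    by (rule index_surj(2)[OF gwR add_subgroup_bounded_adeles bd(1), where f = f]) (use f2 f3 in auto)
  also have "\<dots> \<le> CARD('f) ^ (N * e)" by (rule bd(2))
  finally have c: "card (cosets (bounded_adeles \<iota> (0 - Z)) (bounded_adeles \<iota> 0)) \<le> CARD('f) ^ (N * e)" .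
  have idx: "finite (cosets (bounded_adeles \<iota> (0 - Z)) (bounded_adeles \<iota> 0))"
    "ldim (bounded_adeles \<iota> (0 - Z)) (bounded_adeles \<iota> 0) = divisor_degree \<iota> Z"
    using index_bounded_adeles[of 0 "0 - Z"] Z divisors_diff[OF divisors_0 Z(1)]
      divisor_degree_diff[of 0 Z] by (auto simp: divisors_0 divisor_degree_0)
  have "divisor_degree \<iota> Z \<le> log base (real (CARD('f) ^ (N * e)))"
    unfolding idx(2)[symmetric] ldim_def
    using c card_cosets_pos[OF add_subgroup_bounded_adeles idx(1)] base_gt_1
    by (intro log_mono) (auto simp: of_nat_le_iff simp del: of_nat_power)
  also have "\<dots> = real (N * e)"
    unfolding of_nat_power base_eq[symmetric] using base_gt_1 by (simp add: log_nat_power)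
  finally show ?thesis by linarith
qed

text \<open>More than \<open>N * e\<close> distinct zeros would give a reduced divisor of zeros
  whose degree contradicts \<open>degree_zeros_le\<close>.\<close>

lemma finite_zeros:
  assumes w: "w \<noteq> 0"
  shows "finite {Q \<in> points \<iota>. Q w > 0}"
proof (rule ccontr)
  assume inf: "infinite {Q \<in> points \<iota>. Q w > 0}"
  obtain h e where h: "h \<noteq> 0" "degree h \<le> e" "\<And>d v. v \<in> V d \<Longrightarrow> ev x h * w * v \<in> V (d + e)"
    using multiplier_exists[of w] by blast
  obtain T where T: "T \<subseteq> {Q \<in> points \<iota>. Q w > 0}" "finite T" "card T = Suc (N * e)"
    using infinite_arbitrarily_large[OF inf] by blast
  have "finite {Q \<in> points \<iota>. (if Q \<in> T then 1 else 0 :: int) \<noteq> 0}"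
    using T(2) by (rule rev_finite_subset) auto
  then obtain Z where Z: "Z \<in> divisors \<iota>" "\<And>Q. Q \<in> points \<iota> \<Longrightarrow> mult_at Z Q = (if Q \<in> T then 1 else 0)"
    using divisor_exists[of "\<lambda>Q. if Q \<in> T then 1 else 0"] by blast
  have ZQ: "mult_at Z Q = (if Q \<in> T then 1 else 0)" for Q
    using Z T(1) by (cases "Q \<in> points \<iota>") (auto simp: divisors_def in_keys_iff)
  have keys: "Poly_Mapping.keys Z = T" using ZQ by (auto simp: in_keys_iff split: if_splits)
  have "divisor_degree \<iota> Z \<le> int (N * e)"
    using w h Z(1)
  proof (rule degree_zeros_le)
    show "effective Z" using ZQ by (simp add: effective_def)
    show "mult_at Z Q \<le> Q w" if "Q \<in> points \<iota>" "mult_at Z Q \<noteq> 0" for Q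
      using that ZQ T(1) by (auto split: if_splits)
  qed
  moreover have "divisor_degree \<iota> Z = (\<Sum>Q\<in>T. int (point_degree \<iota> Q))"
    unfolding divisor_degree_def keys by (intro sum.cong) (auto simp: ZQ)
  moreover have "(\<Sum>Q\<in>T. 1) \<le> (\<Sum>Q\<in>T. int (point_degree \<iota> Q))"
    using T(1) point_degree_pos by (intro sum_mono) (auto simp: Suc_le_eq)
  ultimately show False using T(3) by simp
qed

lemma finite_support:
  assumes "w \<noteq> 0"
  shows "finite {Q \<in> points \<iota>. Q w \<noteq> 0}"
proof -
  have "{Q \<in> points \<iota>. Q w \<noteq> 0} \<subseteq> {Q \<in> points \<iota>. Q w > 0} \<union> {Q \<in> points \<iota>. Q (inverse w) > 0}"
    by (auto simp: pt_inverse)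
  then show ?thesis
    using finite_zeros[OF assms] finite_zeros[of "inverse w"] assms
    by (meson finite_UnI finite_subset nonzero_imp_inverse_nonzero)
qed

end

context curve_basis
begin

subsection \<open>Riemann-Roch spaces\<close>

lemma effectiveI:
  assumes "D \<in> divisors \<iota>" "\<And>Q. Q \<in> points \<iota> \<Longrightarrow> 0 \<le> mult_at D Q"
  shows "effective D"
  unfolding effective_def
proof
  fix Q show "0 \<le> mult_at D Q"
    using assms not_in_keys_iff_lookup_eq_zero[of Q D]
    by (cases "Q \<in> points \<iota>") (auto simp: divisors_def)
qed

lemma finite_support_divisor: "finite {Q. mult_at D Q \<noteq> 0}"
  using finite_keys[of D] by (simp add: keys.rep_eq)

lemma divisors_lower_bound:
  assumes "D \<in> divisors \<iota>" "E \<in> divisors \<iota>"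
  obtains F where "F \<in> divisors \<iota>" "effective (D - F)" "effective (E - F)"
proof -
  have "a \<noteq> 0 \<or> b \<noteq> 0" if "min a b \<noteq> 0" for a b :: int using that by auto
  then have "{Q \<in> points \<iota>. min (mult_at D Q) (mult_at E Q) \<noteq> 0} \<subseteq>
      {Q. mult_at D Q \<noteq> 0} \<union> {Q. mult_at E Q \<noteq> 0}" by blast
  then have "finite {Q \<in> points \<iota>. min (mult_at D Q) (mult_at E Q) \<noteq> 0}"
    using finite_support_divisor[of D] finite_support_divisor[of E] by (simp add: finite_subset)
  then obtain F where F: "F \<in> divisors \<iota>" "\<And>Q. Q \<in> points \<iota> \<Longrightarrow> mult_at F Q = min (mult_at D Q) (mult_at E Q)"
    using divisor_exists[of "\<lambda>Q. min (mult_at D Q) (mult_at E Q)"] by blast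
  show thesis
  proof (rule that[OF F(1)])
    show "effective (D - F)" "effective (E - F)"
      by (rule effectiveI, use F(1) assms divisors_diff in blast, simp add: F(2) lookup_minus)+
  qed
qed

lemma divisors_upper_bound:
  assumes "D \<in> divisors \<iota>" "E \<in> divisors \<iota>"
  obtains F where "F \<in> divisors \<iota>" "effective (F - D)" "effective (F - E)"
proof -
  have n: "0 - D \<in> divisors \<iota>" "0 - E \<in> divisors \<iota>" using assms divisors_0 divisors_diff by blast+
  obtain F where F: "F \<in> divisors \<iota>" "effective (0 - D - F)" "effective (0 - E - F)"
    using divisors_lower_bound[OF n] by blast
  have "0 - F \<in> divisors \<iota>" using F(1) divisors_0 divisors_diff by blast
  then show thesis
    using F(2,3) by (intro that[of "0 - F"])
      (simp_all add: effective_def lookup_minus, (metis minus_le_iff neg_le_iff_le)+)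
qed

definition scale_div :: "int \<Rightarrow> 'k divisor \<Rightarrow> 'k divisor" where
  "scale_div n D = Poly_Mapping.map ((*) n) D"

lemma mult_at_scale_div [simp]: "mult_at (scale_div n D) Q = n * mult_at D Q"
  by (simp add: scale_div_def Poly_Mapping.map.rep_eq when_def)

lemma scale_div_divisors: "D \<in> divisors \<iota> \<Longrightarrow> scale_div n D \<in> divisors \<iota>"
  by (auto simp: divisors_def in_keys_iff)

lemma divisor_degree_scale_div: "divisor_degree \<iota> (scale_div n D) = n * divisor_degree \<iota> D"
proof -
  have "Poly_Mapping.keys (scale_div n D) \<subseteq> Poly_Mapping.keys D" by (auto simp: in_keys_iff)
  then have "divisor_degree \<iota> (scale_div n D) =
      (\<Sum>Q\<in>Poly_Mapping.keys D. n * mult_at D Q * int (point_degree \<iota> Q))"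
    by (simp add: divisor_degree_superset[of "Poly_Mapping.keys D"])
  then show ?thesis by (simp add: divisor_degree_def sum_distrib_left mult.assoc)
qed

abbreviation LS :: "'k divisor \<Rightarrow> 'k set" where
  "LS \<equiv> riemann_roch_space \<iota>"

lemma LS_iff: "f \<in> LS D \<longleftrightarrow> (\<forall>Q\<in>points \<iota>. ord_ge Q (- mult_at D Q) f)"
  by (cases "f = 0") (auto simp: riemann_roch_space_def ord_ge_def)

lemma LS_mono: "effective (E - D) \<Longrightarrow> LS D \<subseteq> LS E"
  unfolding effective_def lookup_minus
  by (auto simp: LS_iff intro!: ord_ge_mono[of _ "- mult_at D _" _ "- mult_at E _"])

lemma add_subgroup_LS: "add_subgroup (LS D)"
  by (rule add_subgroupI) (auto simp: LS_iff intro: ord_ge_diff)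

lemma LS_scale: "f \<in> LS D \<Longrightarrow> \<iota> c * f \<in> LS D"
  using ord_ge_mult[OF _ ord_ge_const, of _ "- mult_at D _" f c] by (auto simp: LS_iff)

abbreviation principal :: "('k point \<Rightarrow> 'k) set" where
  "principal \<equiv> range (\<lambda>f _. f)"

lemma principal_adele: "(\<lambda>_. f) \<in> adeles \<iota>"
proof (cases "f = 0")
  case False
  have "{Q \<in> points \<iota>. \<not> ord_ge Q 0 f} \<subseteq> {Q \<in> points \<iota>. Q f \<noteq> 0}" by (auto simp: ord_ge_def)
  then show ?thesis using finite_support[OF False] by (auto simp: adeles_def intro: finite_subset)
qed (simp add: adeles_def)

lemma subspace_principal: "module.subspace (\<lambda>c (\<alpha> :: 'k point \<Rightarrow> 'k) Q. \<iota> c * \<alpha> Q) principal"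
proof -
  interpret vector_space "\<lambda>c (\<alpha> :: 'k point \<Rightarrow> 'k) Q. \<iota> c * \<alpha> Q" by (rule vector_space_fun)
  show ?thesis by (auto simp: subspace_def image_iff fun_eq_iff)
qed

lemma add_subgroup_principal: "add_subgroup principal"
  using vector_space.add_subgroup_subspace[OF vector_space_fun subspace_principal] .

lemma subspace_adeles: "module.subspace (\<lambda>c \<alpha> Q. \<iota> c * \<alpha> Q) (adeles \<iota>)"
proof -
  interpret vector_space "\<lambda>c (\<alpha> :: 'k point \<Rightarrow> 'k) Q. \<iota> c * \<alpha> Q" by (rule vector_space_fun)
  have "\<alpha> + \<beta> \<in> adeles \<iota>" if "\<alpha> \<in> adeles \<iota>" "\<beta> \<in> adeles \<iota>" for \<alpha> \<beta> :: "'k point \<Rightarrow> 'k"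
  proof -
    have "{Q \<in> points \<iota>. \<not> ord_ge Q 0 ((\<alpha> + \<beta>) Q)} \<subseteq>
        {Q \<in> points \<iota>. \<not> ord_ge Q 0 (\<alpha> Q)} \<union> {Q \<in> points \<iota>. \<not> ord_ge Q 0 (\<beta> Q)}"
      by (auto intro: ord_ge_add)
    then show ?thesis using that unfolding adeles_def by (auto intro: finite_subset)
  qed
  moreover have "(\<lambda>Q. \<iota> c * \<alpha> Q) \<in> adeles \<iota>" if "\<alpha> \<in> adeles \<iota>" for c \<alpha>
  proof -
    have "ord_ge Q 0 (\<iota> c * a)" if "Q \<in> points \<iota>" "ord_ge Q 0 a" for Q a
      using ord_ge_mult[OF that(1) ord_ge_const[OF that(1)] that(2)] by simp
    then have "{Q \<in> points \<iota>. \<not> ord_ge Q 0 (\<iota> c * \<alpha> Q)} \<subseteq> {Q \<in> points \<iota>. \<not> ord_ge Q 0 (\<alpha> Q)}"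
      by auto
    then show ?thesis using that unfolding adeles_def by (auto intro: finite_subset)
  qed
  moreover have "0 \<in> adeles \<iota>" by (simp add: adeles_def)
  ultimately show ?thesis by (simp add: subspace_def)
qed

lemma add_subgroup_adeles: "add_subgroup (adeles \<iota>)"
  using vector_space.add_subgroup_subspace[OF vector_space_fun subspace_adeles] .

text \<open>A(D) + k, with the function field k embedded diagonally. Vanishing of a differential at
  \<open>D\<close> is vanishing on this group, see \<open>vanishes_at_iff\<close>.\<close>

definition AK :: "'k divisor \<Rightarrow> ('k point \<Rightarrow> 'k) set" where
  "AK D = sum_set (bounded_adeles \<iota> D) principal"

lemma add_subgroup_AK: "add_subgroup (AK D)"
  unfolding AK_def by (intro add_subgroup_sum_set add_subgroup_bounded_adeles add_subgroup_principal)

lemma subspace_AK: "module.subspace (\<lambda>c \<alpha> Q. \<iota> c * \<alpha> Q) (AK D)"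
proof -
  interpret vector_space "\<lambda>c (\<alpha> :: 'k point \<Rightarrow> 'k) Q. \<iota> c * \<alpha> Q" by (rule vector_space_fun)
  have "AK D = {u + v | u v. u \<in> bounded_adeles \<iota> D \<and> v \<in> principal}"
    by (simp only: AK_def sum_set_def)
  then show ?thesis
    using subspace_sums[OF subspace_bounded_adeles subspace_principal] by simp
qed

lemma AK_mono: "effective (E - D) \<Longrightarrow> AK D \<subseteq> AK E"
  unfolding AK_def by (intro sum_set_mono bounded_adeles_mono) auto

lemma AK_subset_adeles: "AK D \<subseteq> adeles \<iota>"
proof
  fix \<alpha> assume "\<alpha> \<in> AK D"
  then obtain \<beta> f where "\<beta> \<in> bounded_adeles \<iota> D" "f \<in> principal" "\<alpha> = \<beta> + f"
    unfolding AK_def by (rule sum_setE)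
  then show "\<alpha> \<in> adeles \<iota>"
    using bounded_adeles_subset_adeles principal_adele add_subgroup_add[OF add_subgroup_adeles] by blast
qed

text \<open>This is \<open>index_add_Int\<close> for A(D) inside A(E) and the diagonal functions:
  the intersections are the Riemann-Roch spaces, the sums are the groups \<open>AK\<close>, and the
  product of both indices is known from the degrees.\<close>

lemma degree_split:
  assumes "effective (E - D)" "D \<in> divisors \<iota>" "E \<in> divisors \<iota>"
  shows "finite (cosets (LS D) (LS E))" "finite (cosets (AK D) (AK E))"
    "ldim (LS D) (LS E) + ldim (AK D) (AK E) = divisor_degree \<iota> E - divisor_degree \<iota> D"
proof -
  let ?A = "bounded_adeles \<iota>"
  have mem: "(\<lambda>_. f) \<in> ?A F \<longleftrightarrow> f \<in> LS F" for f F by (simp add: bounded_adeles_iff LS_iff)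
  have grp: "add_subgroup (?A F \<inter> principal)" for F
    by (intro add_subgroup_Int add_subgroup_bounded_adeles add_subgroup_principal)
  have 1: "(\<lambda>_. f) \<in> ?A E \<inter> principal" if "f \<in> LS E" for f using that mem by blast
  have 2: "(\<lambda>_. f) - (\<lambda>_. g) \<in> ?A D \<inter> principal \<longleftrightarrow> f - g \<in> LS D" for f g
  proof -
    have "(\<lambda>_. f) - (\<lambda>_. g) = (\<lambda>_ :: 'k point. f - g)" by (simp add: fun_eq_iff)
    then show ?thesis using mem[of "f - g" D] by auto
  qed
  have 3: "\<exists>f\<in>LS E. \<alpha> - (\<lambda>_. f) \<in> ?A D \<inter> principal" if "\<alpha> \<in> ?A E \<inter> principal" for \<alpha>
  proof -
    from that obtain f where f: "\<alpha> = (\<lambda>_. f)" by blast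
    then have "f \<in> LS E" using that mem by blast
    moreover have "\<alpha> - (\<lambda>_. f) = 0" by (simp add: f fun_eq_iff)
    ultimately show ?thesis using add_subgroup_0[OF grp, of D] by force
  qed
  note iso_rules = index_iso[where f = "\<lambda>f (_ :: 'k point). f", OF add_subgroup_LS grp]
  have iso: "finite (cosets (?A D \<inter> principal) (?A E \<inter> principal)) \<longleftrightarrow> finite (cosets (LS D) (LS E))"
    by (rule iso_rules(1)) (rule 1, assumption, rule 2, rule 3, assumption)
  have iso': "card (cosets (?A D \<inter> principal) (?A E \<inter> principal)) = card (cosets (LS D) (LS E))"
    by (rule iso_rules(2)) (rule 1, assumption, rule 2, rule 3, assumption)
  note split = index_add_Int[OF add_subgroup_bounded_adeles add_subgroup_bounded_adeles
      add_subgroup_principal bounded_adeles_mono[OF assms(1)], folded AK_def]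
  note idx = index_bounded_adeles[OF assms]
  show fin: "finite (cosets (LS D) (LS E))" "finite (cosets (AK D) (AK E))"
    using split(1) iso idx(1) by blast+
  have card: "card (cosets (?A D) (?A E)) = card (cosets (LS D) (LS E)) * card (cosets (AK D) (AK E))"
    using split(2) iso' by simp
  have "ldim (?A D) (?A E) = ldim (LS D) (LS E) + ldim (AK D) (AK E)"
    unfolding ldim_def card of_nat_mult
    using card_cosets_pos[OF add_subgroup_LS fin(1)] card_cosets_pos[OF add_subgroup_AK fin(2)] base_gt_1
    by (intro log_mult_pos) auto
  then show "ldim (LS D) (LS E) + ldim (AK D) (AK E) = divisor_degree \<iota> E - divisor_degree \<iota> D"
    using idx(2) by simp
qed

text \<open>The existence of poles confines L(0) to the constants, and L(E) has finite index over
  L(0) for every effective E.\<close>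

lemma finite_LS:
  assumes "D \<in> divisors \<iota>"
  shows "finite (LS D)"
proof -
  obtain E where E: "E \<in> divisors \<iota>" "effective (E - D)" "effective (E - 0)"
    using divisors_upper_bound[OF assms divisors_0] by blast
  have "LS 0 \<subseteq> range \<iota>" using no_poles_imp_const by (auto simp: LS_iff)
  then have "finite (LS 0)" by (rule finite_subset) simp
  moreover have "finite (cosets (LS 0) (LS E))"
    using degree_split(1)[OF E(3) divisors_0 E(1)] .
  ultimately have "finite (LS E)"
    using index_tower(1)[OF add_subgroup_zero add_subgroup_LS add_subgroup_LS _ LS_mono[OF E(3)]]
      add_subgroup_0[OF add_subgroup_LS] by (simp add: cosets_zero)
  then show ?thesis using LS_mono[OF E(2)] by (rule rev_finite_subset)
qed

definition ell :: "'k divisor \<Rightarrow> real" where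
  "ell D = log base (real (card (LS D)))"

lemma ell_eq_ldim: "ell D = ldim {0} (LS D)"
  by (simp add: ell_def ldim_def cosets_zero)

lemma ell_diff:
  assumes "effective (E - D)" "D \<in> divisors \<iota>" "E \<in> divisors \<iota>"
  shows "ell E - ell D = ldim (LS D) (LS E)"
proof -
  have "ldim {0} (LS E) = ldim {0} (LS D) + ldim (LS D) (LS E)"
    using finite_LS[OF assms(3)] LS_mono[OF assms(1)] add_subgroup_0[OF add_subgroup_LS]
    by (intro ldim_tower add_subgroup_zero add_subgroup_LS) (auto simp: cosets_zero)
  then show ?thesis by (simp add: ell_eq_ldim)
qed

lemma card_LS_pos: "D \<in> divisors \<iota> \<Longrightarrow> 0 < card (LS D)"
  using finite_LS add_subgroup_0[OF add_subgroup_LS] by (auto simp: card_gt_0_iff)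

lemma ell_AK:
  assumes "effective (E - D)" "D \<in> divisors \<iota>" "E \<in> divisors \<iota>"
  shows "ldim (AK D) (AK E) = divisor_degree \<iota> E - divisor_degree \<iota> D - (ell E - ell D)"
  using degree_split(3)[OF assms] ell_diff[OF assms] by simp

lemma ell_bounds:
  assumes "effective (E - D)" "D \<in> divisors \<iota>" "E \<in> divisors \<iota>"
  shows "ell D \<le> ell E" "ell E - ell D \<le> divisor_degree \<iota> E - divisor_degree \<iota> D"
  using ell_AK[OF assms] ell_diff[OF assms] ldim_nonneg[OF add_subgroup_LS degree_split(1)[OF assms]]
    ldim_nonneg[OF add_subgroup_AK degree_split(2)[OF assms]] by linarith+

lemma LS_mult:
  assumes "f \<noteq> 0" "\<And>Q. Q \<in> points \<iota> \<Longrightarrow> mult_at D Q - Q f \<le> mult_at E Q" "g \<in> LS D"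
  shows "f * g \<in> LS E"
  unfolding LS_iff
proof
  fix Q assume Q: "Q \<in> points \<iota>"
  then have "ord_ge Q (- mult_at D Q) g" using assms(3) by (simp add: LS_iff)
  then show "ord_ge Q (- mult_at E Q) (f * g)"
    unfolding ord_ge_mult_iff[OF Q assms(1)] by (rule ord_ge_mono) (use assms(2)[OF Q] in simp)
qed

lemma ell_le_mult:
  assumes "f \<noteq> 0" "\<And>Q. Q \<in> points \<iota> \<Longrightarrow> mult_at D Q - Q f \<le> mult_at E Q"
    and "D \<in> divisors \<iota>" "E \<in> divisors \<iota>"
  shows "ell D \<le> ell E"
proof -
  have "inj_on ((*) f) (LS D)" using assms(1) by (auto simp: inj_on_def)
  moreover have "(*) f ` LS D \<subseteq> LS E" using LS_mult[OF assms(1,2)] by blast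
  ultimately have "card (LS D) \<le> card (LS E)" using card_inj_on_le finite_LS[OF assms(4)] by blast
  then show ?thesis unfolding ell_def using card_LS_pos[OF assms(3)] base_gt_1 by simp
qed

subsection \<open>Riemann's theorem\<close>

lemma ord_ev_ge:
  assumes Q: "Q \<in> points \<iota>" and m: "0 \<le> m" "- m \<le> Q x"
  shows "degree p \<le> l \<Longrightarrow> ord_ge Q (- (int l * m)) (ev x p)"
proof (induction l arbitrary: p)
  case 0
  then obtain a where "p = [:a:]" by (auto elim: degree_eq_zeroE)
  then show ?case using ord_ge_const[OF Q] by simp
next
  case (Suc l)
  obtain a r where p: "p = pCons a r" by (cases p)
  then have "degree r \<le> l" using Suc.prems by (auto split: if_splits)
  then have "ord_ge Q (- m + - (int l * m)) (x * ev x r)"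
    using Suc.IH m(2) by (intro ord_ge_mult Q) (auto simp: ord_ge_def)
  moreover have "ord_ge Q (- (int (Suc l) * m)) (\<iota> a)"
    using ord_ge_const[OF Q] by (rule ord_ge_mono) (use m(1) in simp)
  ultimately show ?case
    unfolding p ev_pCons using Q by (intro ord_ge_add) (auto simp: algebra_simps)
qed

text \<open>At a pole of \<open>x\<close> the powers of \<open>x\<close> have distinct orders, so
  the leading term decides.\<close>

lemma ord_ev_pole:
  assumes Q: "Q \<in> points \<iota>" "Q x < 0"
  shows "p \<noteq> 0 \<Longrightarrow> Q (ev x p) = int (degree p) * Q x"
proof (induction p)
  case (pCons a p)
  have x0: "x \<noteq> 0" using Q pt_0[OF Q(1)] by auto
  show ?case
  proof (cases "p = 0")
    case True
    then show ?thesis using pCons.prems pt_const[OF Q(1)] by simp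
  next
    case False
    have nz: "x * ev x p \<noteq> 0" using False x0 by simp
    have eq: "Q (x * ev x p) = int (degree (pCons a p)) * Q x"
      using False pCons.IH x0 pt_mult[OF Q(1)] by (simp add: algebra_simps)
    also have "\<dots> < 0" using Q(2) False by (simp add: mult_less_0_iff)
    finally have "\<iota> a = 0 \<or> Q (x * ev x p) < Q (\<iota> a)"
      using pt_const[OF Q(1), of a] by (cases "a = 0") simp_all
    then have "Q (x * ev x p + \<iota> a) = Q (x * ev x p)" using pt_add_eq(2)[OF Q(1) nz] by blast
    then show ?thesis using eq by (simp add: add.commute)
  qed
qed simp

text \<open>The powers of \<open>x\<close> fall into finitely many residue classes, so two of them
  agree modulo functions vanishing at \<open>Q\<close>, and their difference is the polynomial
  sought.\<close>

lemma poly_vanishing_at: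
  assumes Q: "Q \<in> points \<iota>" "Q x \<ge> 0"
  obtains p where "p \<noteq> 0" "1 \<le> Q (ev x p)"
proof -
  have pow: "ord_ge Q 0 (x ^ i)" for i using pt_power[OF Q(1), of x i] Q(2) by (simp add: ord_ge_def)
  have "\<exists>i j :: nat. i < j \<and> ord_ge Q 1 (x ^ i - x ^ j)"
  proof (rule ccontr)
    assume neg: "\<not> ?thesis"
    have eq: "i = j" if "ord_ge Q 1 (x ^ i - x ^ j)" for i j :: nat
    proof (rule ccontr)
      assume "i \<noteq> j"
      then consider "i < j" | "j < i" by linarith
      then show False
      proof cases
        case 2
        have "ord_ge Q 1 (x ^ j - x ^ i)" using ord_ge_minus[OF Q(1), of 1 "x ^ i - x ^ j"] that by simp
        then show False using neg 2 by blast
      qed (use neg that in blast)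
    qed
    have "inj (\<lambda>i :: nat. x ^ i)" using eq by (auto simp: inj_def)
    moreover have "finite (range (\<lambda>i :: nat. x ^ i))"
      using pow eq
      by (intro card_incongruent_le(1)[OF add_subgroup_ord_ge[OF Q(1)] finite_residue[OF Q(1)]]) auto
    ultimately show False using finite_imageD infinite_UNIV_nat by blast
  qed
  then obtain i j :: nat where ij: "i < j" "ord_ge Q 1 (x ^ i - x ^ j)" by blast
  define p :: "'f poly" where "p = monom 1 i - monom 1 j"
  have "coeff p i = 1" using ij(1) by (simp add: p_def)
  then have p0: "p \<noteq> 0" by auto
  have "ord_ge Q 1 (ev x p)" using ij(2) by (simp add: p_def ev_diff ev_monom)
  then have "1 \<le> Q (ev x p)" using p0 by (simp add: ord_ge_def)
  with p0 show thesis by (rule that)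
qed

lemma poly_vanishing:
  assumes "effective D" "D \<in> divisors \<iota>"
  obtains p where "p \<noteq> 0" "\<And>Q. Q \<in> points \<iota> \<Longrightarrow> Q x \<ge> 0 \<Longrightarrow> mult_at D Q \<le> Q (ev x p)"
proof -
  have nonneg: "0 \<le> Q (ev x p)" if "Q \<in> points \<iota>" "Q x \<ge> 0" "p \<noteq> 0" for Q p
    using ord_ev_ge[OF that(1), of 0 p "degree p"] that by (simp add: ord_ge_def)
  have "Poly_Mapping.keys D \<subseteq> points \<iota>" using assms(2) by (simp add: divisors_def)
  with assms(1) have "\<exists>p. p \<noteq> 0 \<and> (\<forall>Q\<in>points \<iota>. Q x \<ge> 0 \<longrightarrow> mult_at D Q \<le> Q (ev x p))"
  proof (induction rule: effective_induct)
    case zero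
    show ?case by (intro exI[of _ 1]) (auto simp: pt_1)
  next
    case (add D R)
    then obtain p where p: "p \<noteq> 0" "\<And>Q. Q \<in> points \<iota> \<Longrightarrow> Q x \<ge> 0 \<Longrightarrow> mult_at D Q \<le> Q (ev x p)"
      by blast
    show ?case
    proof (cases "R x \<ge> 0")
      case True
      then obtain r where r: "r \<noteq> 0" "1 \<le> R (ev x r)" using poly_vanishing_at add(1) by blast
      have "mult_at (D + pt R) Q \<le> Q (ev x (p * r))" if "Q \<in> points \<iota>" "Q x \<ge> 0" for Q
        using p(2)[OF that] nonneg[OF that r(1)] r p(1) pt_mult[OF that(1), of "ev x p" "ev x r"]
        by (auto simp: lookup_add mult_at_pt ev_mult)
      then show ?thesis using p(1) r(1) by (intro exI[of _ "p * r"]) simp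
    next
      case False
      then have "mult_at (D + pt R) Q = mult_at D Q" if "Q x \<ge> 0" for Q
        using that by (auto simp: lookup_add mult_at_pt)
      then show ?thesis using p by auto
    qed
  qed
  then show thesis using that by blast
qed

text \<open>Let B be the polar divisor of \<open>x\<close>. The boxes \<open>V l\<close> lie in L(l
  B + C) for a fixed C, which forces deg B = \<open>N\<close> and bounds deg - l on the multiples of
  B. An arbitrary effective divisor is moved below such a multiple by a polynomial in
  \<open>x\<close>.\<close>

lemma riemann_inequality:
  "\<exists>\<gamma>. \<forall>D\<in>divisors \<iota>. divisor_degree \<iota> D - ell D \<le> \<gamma>"
proof -
  have x0: "x \<noteq> 0" using ev_x_eq_0[of "[:0, 1:]"] by auto
  have "finite {Q \<in> points \<iota>. max 0 (- Q x) \<noteq> 0}"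
    by (rule finite_subset[OF _ finite_support[OF x0]]) auto
  then obtain B where B: "B \<in> divisors \<iota>" "\<And>Q. Q \<in> points \<iota> \<Longrightarrow> mult_at B Q = max 0 (- Q x)"
    using divisor_exists[of "\<lambda>Q. max 0 (- Q x)"] by blast
  have effB: "effective B" using B by (intro effectiveI) auto
  have degB_le: "divisor_degree \<iota> B \<le> int N"
  proof -
    have "divisor_degree \<iota> B \<le> int (N * 1)"
    \<comment> \<open>The sharp case for \<open>1 / x\<close>: the multiplier \<open>x\<close> turns
      the product into 1, so \<open>e = 1\<close> is enough.\<close>
    proof (rule degree_zeros_le[of "inverse x" "[:0, 1:]"])
      show "ev x [:0, 1:] * inverse x * v \<in> V (d + 1)" if "v \<in> V d" for d v
        using that V_mono[of d "d + 1"] x0 by auto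
      show "mult_at B Q \<le> Q (inverse x)" if "Q \<in> points \<iota>" "mult_at B Q \<noteq> 0" for Q
        using B(2)[OF that(1)] that pt_inverse[OF that(1), of x] by auto
    qed (use x0 B effB in auto)
    then show ?thesis by simp
  qed
  \<comment> \<open>A pole bound valid for all basis elements at once; adding it to l B accommodates
    the whole box \<open>V l\<close>.\<close>
  define c where "c Q = (\<Sum>b\<in>Bs. max 0 (- Q b))" for Q :: "'k point"
  have "finite (\<Union>b\<in>Bs. {Q \<in> points \<iota>. Q b \<noteq> 0})"
  proof (intro finite_UN_I finite_Bs)
    fix b show "finite {Q \<in> points \<iota>. Q b \<noteq> 0}"
      by (cases "b = 0") (simp_all add: finite_support pt_0 cong: conj_cong)
  qed
  moreover have "{Q \<in> points \<iota>. c Q \<noteq> 0} \<subseteq> (\<Union>b\<in>Bs. {Q \<in> points \<iota>. Q b \<noteq> 0})"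
  proof
    fix Q assume "Q \<in> {Q \<in> points \<iota>. c Q \<noteq> 0}"
    then obtain b where b: "Q \<in> points \<iota>" "b \<in> Bs" "max 0 (- Q b) \<noteq> 0"
      unfolding c_def by (auto elim: sum.not_neutral_contains_not_neutral)
    from b(3) have "Q b \<noteq> 0" by (cases "Q b = 0") simp_all
    with b show "Q \<in> (\<Union>b\<in>Bs. {Q \<in> points \<iota>. Q b \<noteq> 0})" by blast
  qed
  ultimately have "finite {Q \<in> points \<iota>. c Q \<noteq> 0}" by (rule rev_finite_subset)
  then obtain C where C: "C \<in> divisors \<iota>" "\<And>Q. Q \<in> points \<iota> \<Longrightarrow> mult_at C Q = c Q"
    using divisor_exists by blast
  have effC: "effective C" using C by (intro effectiveI) (auto simp: c_def sum_nonneg)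
  define lB where "lB l = scale_div (int l) B" for l :: nat
  have lB: "lB l \<in> divisors \<iota>" "divisor_degree \<iota> (lB l) = int l * divisor_degree \<iota> B"
      "effective (lB l)" for l
    using B(1) effB by (auto simp: lB_def scale_div_divisors divisor_degree_scale_div effective_def)
  have lBC: "lB l + C \<in> divisors \<iota>" for l using lB C divisors_add by blast
  have sub: "V l \<subseteq> LS (lB l + C)" for l
  proof
    fix v assume "v \<in> V l"
    then obtain p where p: "\<And>b. b \<in> Bs \<Longrightarrow> degree (p b) \<le> l" "v = (\<Sum>b\<in>Bs. ev x (p b) * b)"
      by (elim VE) auto
    show "v \<in> LS (lB l + C)"
      unfolding LS_iff p(2)
    proof (intro ballI ord_ge_sum)
      fix Q b assume Q: "Q \<in> points \<iota>" and b: "b \<in> Bs"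
      have "- Q b \<le> max 0 (- Q b)" by simp
      also have "\<dots> \<le> c Q" unfolding c_def using b finite_Bs by (intro member_le_sum) auto
      finally have "ord_ge Q (- c Q) b" by (simp add: ord_ge_def)
      moreover have "ord_ge Q (- (int l * mult_at B Q)) (ev x (p b))"
        using B(2)[OF Q] p(1)[OF b] by (intro ord_ev_ge Q) auto
      ultimately have "ord_ge Q (- (int l * mult_at B Q) + - c Q) (ev x (p b) * b)"
        by (intro ord_ge_mult Q)
      then show "ord_ge Q (- mult_at (lB l + C) Q) (ev x (p b) * b)"
        using C(2)[OF Q] by (simp add: lookup_add lB_def)
    qed
  qed
  have ell_ge: "real (N * Suc l) \<le> ell (lB l + C)" for l
  proof -
    have "real (N * Suc l) = log base (real (card (V l)))"
      unfolding card_V of_nat_power base_eq[symmetric] using base_gt_1 by (simp add: log_nat_power)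
    also have "\<dots> \<le> ell (lB l + C)"
    proof -
      have "0 < card (V l)" unfolding card_V by simp
      moreover have "card (V l) \<le> card (LS (lB l + C))" by (rule card_mono[OF finite_LS[OF lBC] sub])
      ultimately show ?thesis unfolding ell_def using base_gt_1 by (intro log_mono) auto
    qed
    finally show ?thesis .
  qed
  \<comment> \<open>Otherwise the dimension of L(l B + C), at least \<open>N * Suc l\<close>, would
    grow at most like \<open>l * (N - 1)\<close>.\<close>
  have degB_ge: "int N \<le> divisor_degree \<iota> B"
  proof (rule ccontr)
    assume "\<not> ?thesis"
    then have less: "divisor_degree \<iota> B \<le> int N - 1" by simp
    define M where "M = ell 0 + divisor_degree \<iota> C"
    have "real l \<le> M" for l
    proof -
      have "effective (lB l + C - 0)" using lB effC by (simp add: effective_def lookup_add)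
      then have "ell (lB l + C) - ell 0 \<le> divisor_degree \<iota> (lB l + C) - divisor_degree \<iota> 0"
        using ell_bounds(2) divisors_0 lBC by blast
      then have "ell (lB l + C) \<le> M + real l * divisor_degree \<iota> B"
        using lB by (simp add: M_def divisor_degree_add divisor_degree_0)
      moreover have "real l * divisor_degree \<iota> B \<le> real l * (real N - 1)"
        using less by (intro mult_left_mono) linarith+
      ultimately show ?thesis using ell_ge[of l] by (simp add: algebra_simps)
    qed
    then show False using reals_Archimedean2[of M] by (metis not_le)
  qed
  define \<gamma> where "\<gamma> = divisor_degree \<iota> C - real N"
  have bound_lB: "divisor_degree \<iota> (lB l) - ell (lB l) \<le> \<gamma>" for l
  proof -
    have "ell (lB l + C) - ell (lB l) \<le> divisor_degree \<iota> (lB l + C) - divisor_degree \<iota> (lB l)"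
      using effC lB lBC by (intro ell_bounds(2)) auto
    then have "ell (lB l + C) \<le> ell (lB l) + divisor_degree \<iota> C" by (simp add: divisor_degree_add)
    moreover have "divisor_degree \<iota> (lB l) \<le> real l * real N"
      unfolding lB(2) using degB_le by (simp add: mult_left_mono)
    ultimately show ?thesis using ell_ge[of l] by (simp add: \<gamma>_def algebra_simps)
  qed
  have bound_eff: "divisor_degree \<iota> A - ell A \<le> \<gamma>" if A: "effective A" "A \<in> divisors \<iota>" for A
  proof -
    obtain p where p: "p \<noteq> 0" "\<And>Q. Q \<in> points \<iota> \<Longrightarrow> Q x \<ge> 0 \<Longrightarrow> mult_at A Q \<le> Q (ev x p)"
      using poly_vanishing[OF A] by blast
    let ?z = "ev x p" and ?l = "degree p"
    have z0: "?z \<noteq> 0" using p(1) by simp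
    have "finite {Q \<in> points \<iota>. max 0 (Q ?z) \<noteq> 0}"
      by (rule finite_subset[OF _ finite_support[OF z0]]) auto
    then obtain Z where Z: "Z \<in> divisors \<iota>" "\<And>Q. Q \<in> points \<iota> \<Longrightarrow> mult_at Z Q = max 0 (Q ?z)"
      using divisor_exists[of "\<lambda>Q. max 0 (Q ?z)"] by blast
    have effZ: "effective Z" using Z by (intro effectiveI) auto
    have degZ: "divisor_degree \<iota> Z \<le> int (N * ?l)"
    \<comment> \<open>A polynomial in \<open>x\<close> needs no multiplier, and its degree serves as
      \<open>e\<close>.\<close>
    proof (rule degree_zeros_le[of ?z 1])
      show "ev x 1 * ?z * v \<in> V (d + ?l)" if "v \<in> V d" for d v using V_mult[OF that, of p] by simp
      show "mult_at Z Q \<le> Q ?z" if "Q \<in> points \<iota>" "mult_at Z Q \<noteq> 0" for Q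
        using Z(2) that by (auto simp: max_def split: if_splits)
    qed (use z0 Z effZ in auto)
    have zQ: "Q ?z = mult_at Z Q - int ?l * mult_at B Q" if Q: "Q \<in> points \<iota>" for Q
    proof (cases "Q x < 0")
      case True
      then have "Q ?z = int ?l * Q x" using ord_ev_pole[OF Q _ p(1)] by simp
      moreover from this have "Q ?z \<le> 0" using True by (simp add: mult_nonneg_nonpos)
      ultimately show ?thesis using Z(2)[OF Q] B(2)[OF Q] True by simp
    next
      case False
      then have "ord_ge Q 0 ?z" using ord_ev_ge[OF Q, of 0 p ?l] by simp
      then show ?thesis using Z(2)[OF Q] B(2)[OF Q] False z0 by (simp add: ord_ge_def)
    qed
    \<comment> \<open>\<open>E\<close> is \<open>A\<close> minus the divisor of \<open>?z\<close>,
      written through zeros and poles because at this stage only the inequality between their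
      degrees is known. It yields deg A \<le> deg E, the direction required.\<close>
    define E where "E = A - Z + lB ?l"
    have E: "E \<in> divisors \<iota>" unfolding E_def using A Z lB divisors_add divisors_diff by blast
    have EQ: "mult_at E Q = mult_at A Q - Q ?z" if "Q \<in> points \<iota>" for Q
      using zQ[OF that] by (simp add: E_def lookup_add lookup_minus lB_def)
    \<comment> \<open>At each pole of \<open>x\<close> the multiplicity of \<open>B\<close> is at
      least 1, so the added total multiplicity of \<open>A\<close> outweighs \<open>A\<close>
      there.\<close>
    define l' where "l' = ?l + nat (\<Sum>Q\<in>Poly_Mapping.keys A. mult_at A Q)"
    have effl: "effective (lB l' - E)"
    proof (rule effectiveI)
      show "lB l' - E \<in> divisors \<iota>" using lB E divisors_diff by blast
      fix Q assume Q: "Q \<in> points \<iota>"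
      show "0 \<le> mult_at (lB l' - E) Q"
      proof (cases "Q x < 0")
        case True
        then have BQ: "1 \<le> mult_at B Q" using B(2)[OF Q] by simp
        have AQ: "0 \<le> mult_at A Q'" for Q' using A(1) by (simp add: effective_def)
        have "mult_at A Q \<le> (\<Sum>Q\<in>Poly_Mapping.keys A. mult_at A Q)"
        proof (cases "Q \<in> Poly_Mapping.keys A")
          case True
          then show ?thesis using AQ by (intro member_le_sum) auto
        next
          case False
          then show ?thesis using AQ by (simp add: in_keys_iff sum_nonneg)
        qed
        then have "int ?l + mult_at A Q \<le> int l'" using AQ[of Q] by (simp add: l'_def)
        then have "(int ?l + mult_at A Q) * mult_at B Q \<le> int l' * mult_at B Q"
          using BQ by (intro mult_right_mono) auto
        moreover have "mult_at A Q * 1 \<le> mult_at A Q * mult_at B Q"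
          using BQ AQ by (intro mult_left_mono) auto
        moreover have "mult_at Z Q = 0"
          using zQ[OF Q] ord_ev_pole[OF Q True p(1)] B(2)[OF Q] True by simp
        ultimately show ?thesis
          by (simp add: E_def lookup_add lookup_minus lB_def algebra_simps)
      next
        case False
        then have "mult_at E Q \<le> 0" using EQ[OF Q] p(2)[OF Q] by simp
        moreover have "0 \<le> int l' * mult_at B Q" using effB by (simp add: effective_def)
        ultimately show ?thesis by (simp add: lookup_minus lB_def)
      qed
    qed
    have "ell E \<le> ell A"
    proof (rule ell_le_mult[of "inverse ?z"])
      show "mult_at E Q - Q (inverse ?z) \<le> mult_at A Q" if "Q \<in> points \<iota>" for Q
        using EQ[OF that] pt_inverse[OF that, of ?z] by simp
    qed (use z0 E A in auto)
    moreover have "ell (lB l') - ell E \<le> divisor_degree \<iota> (lB l') - divisor_degree \<iota> E"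
      using effl E lB by (intro ell_bounds(2)) auto
    moreover have "divisor_degree \<iota> A \<le> divisor_degree \<iota> E"
    proof -
      have "int (N * ?l) \<le> int ?l * divisor_degree \<iota> B"
        using degB_ge mult_left_mono[of "int N" "divisor_degree \<iota> B" "int ?l"] by (simp add: mult.commute)
      then show ?thesis using degZ lB(2)[of ?l] by (simp add: E_def divisor_degree_add divisor_degree_diff)
    qed
    ultimately show ?thesis using bound_lB[of l'] by linarith
  qed
  have "divisor_degree \<iota> D - ell D \<le> \<gamma>" if D: "D \<in> divisors \<iota>" for D
  proof -
    obtain A where A: "A \<in> divisors \<iota>" "effective (A - D)" "effective (A - 0)"
      using divisors_upper_bound[OF D divisors_0] by blast
    then show ?thesis using bound_eff[of A] ell_bounds(2)[OF A(2) D A(1)] by simp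
  qed
  then show ?thesis by blast
qed

subsection \<open>The index of speciality\<close>

lemma finite_adeles_bounded:
  assumes "finite T" "T \<subseteq> adeles \<iota>"
  shows "\<exists>A\<in>divisors \<iota>. effective A \<and> T \<subseteq> bounded_adeles \<iota> A"
  using assms
proof (induction T)
  case empty
  show ?case using divisors_0 by (intro bexI[of _ 0]) (auto simp: effective_def)
next
  case (insert \<alpha> T)
  then obtain A where A: "A \<in> divisors \<iota>" "effective A" "T \<subseteq> bounded_adeles \<iota> A" by auto
  obtain E where E: "E \<in> divisors \<iota>" "effective E" "\<alpha> \<in> bounded_adeles \<iota> E"
    using adele_bounded[of \<alpha>] insert.prems by blast
  have "bounded_adeles \<iota> A \<subseteq> bounded_adeles \<iota> (A + E)" "bounded_adeles \<iota> E \<subseteq> bounded_adeles \<iota> (A + E)"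
    using A E by (auto intro!: bounded_adeles_mono)
  then show ?case
    using A E divisors_add
    by (intro bexI[of _ "A + E"]) (auto simp: effective_def lookup_add)
qed

text \<open>Finitely many adeles lie in A(A) for one effective A, and the index of
  \<open>AK 0\<close> in \<open>AK A\<close> is bounded independently of A by Riemann's theorem.
  Other divisors are reached from 0 through a common lower bound.\<close>

lemma finite_cosets_AK:
  assumes D: "D \<in> divisors \<iota>"
  shows "finite (cosets (AK D) (adeles \<iota>))"
proof -
  obtain \<gamma> where \<gamma>: "\<And>D. D \<in> divisors \<iota> \<Longrightarrow> divisor_degree \<iota> D - ell D \<le> \<gamma>"
    using riemann_inequality by blast
  define n where "n = nat \<lfloor>base powr (\<gamma> + ell 0)\<rfloor>"
  have "finite (cosets (AK 0) (adeles \<iota>))"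
  proof (rule cosets_bounded(1)[OF add_subgroup_AK, where n = n])
    fix T assume T: "finite T" "T \<subseteq> adeles \<iota>" "\<And>s t. s \<in> T \<Longrightarrow> t \<in> T \<Longrightarrow> s - t \<in> AK 0 \<Longrightarrow> s = t"
    obtain A where A: "A \<in> divisors \<iota>" "effective (A - 0)" "T \<subseteq> bounded_adeles \<iota> A"
      using finite_adeles_bounded[OF T(1,2)] by auto
    have "T \<subseteq> AK A" using A(3) sum_set_left[OF add_subgroup_principal] unfolding AK_def by blast
    then have "card T \<le> card (cosets (AK 0) (AK A))"
      using T(3) degree_split(2)[OF A(2) divisors_0 A(1)] by (intro card_incongruent_le(2) add_subgroup_AK)
    moreover have "real (card (cosets (AK 0) (AK A))) = base powr ldim (AK 0) (AK A)"
      using card_cosets_pos[OF add_subgroup_AK degree_split(2)[OF A(2) divisors_0 A(1)]] base_gt_1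
      by (simp add: ldim_def)
    moreover have "base powr ldim (AK 0) (AK A) \<le> base powr (\<gamma> + ell 0)"
      using ell_AK[OF A(2) divisors_0 A(1)] \<gamma>[OF A(1)] base_gt_1 by (simp add: divisor_degree_0)
    ultimately show "card T \<le> n" unfolding n_def by (simp add: le_nat_floor)
  qed
  moreover obtain E where E: "E \<in> divisors \<iota>" "effective (D - E)" "effective (0 - E)"
    using divisors_lower_bound[OF D divisors_0] by blast
  ultimately have "finite (cosets (AK E) (adeles \<iota>))"
    using index_tower(1)[OF add_subgroup_AK add_subgroup_AK add_subgroup_adeles AK_mono[OF E(3)] AK_subset_adeles]
      degree_split(2)[OF E(3,1) divisors_0] by blast
  then show ?thesis
    using index_tower(1)[OF add_subgroup_AK add_subgroup_AK add_subgroup_adeles AK_mono[OF E(2)] AK_subset_adeles]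
    by blast
qed

text \<open>The index of speciality i(D), taken on the adelic side and thus available before any
  canonical divisor.\<close>

definition speciality :: "'k divisor \<Rightarrow> real" where
  "speciality D = ldim (AK D) (adeles \<iota>)"

lemma speciality_nonneg: "D \<in> divisors \<iota> \<Longrightarrow> 0 \<le> speciality D"
  unfolding speciality_def using finite_cosets_AK add_subgroup_adeles by (rule ldim_nonneg[rotated])

lemma speciality_diff:
  assumes "effective (E - D)" "D \<in> divisors \<iota>" "E \<in> divisors \<iota>"
  shows "speciality D - speciality E = divisor_degree \<iota> E - divisor_degree \<iota> D - (ell E - ell D)"
  using ldim_tower[OF add_subgroup_AK add_subgroup_AK add_subgroup_adeles AK_mono[OF assms(1)]
      AK_subset_adeles finite_cosets_AK[OF assms(2)]] ell_AK[OF assms]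
  by (simp add: speciality_def)

text \<open>Both divisors are compared with a common lower bound. This is the Riemann-Roch theorem
  with i(D) in place of the dimension of L(W - D).\<close>

lemma euler_characteristic:
  assumes "D \<in> divisors \<iota>" "E \<in> divisors \<iota>"
  shows "ell D - speciality D - divisor_degree \<iota> D = ell E - speciality E - divisor_degree \<iota> E"
proof -
  obtain F where F: "F \<in> divisors \<iota>" "effective (D - F)" "effective (E - F)"
    using divisors_lower_bound[OF assms] by blast
  show ?thesis
    using speciality_diff[OF F(2,1) assms(1)] speciality_diff[OF F(3,1) assms(2)] by linarith
qed

lemma adele_mult: "\<alpha> \<in> adeles \<iota> \<Longrightarrow> (\<lambda>Q. f * \<alpha> Q) \<in> adeles \<iota>"
proof (cases "f = 0")
  case False
  assume \<alpha>: "\<alpha> \<in> adeles \<iota>"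
  have "ord_ge Q 0 (f * \<alpha> Q)" if "Q \<in> points \<iota>" "ord_ge Q 0 (\<alpha> Q)" "Q f = 0" for Q
    using ord_ge_mult_iff[OF that(1) False] that by simp
  then have "{Q \<in> points \<iota>. \<not> ord_ge Q 0 (f * \<alpha> Q)} \<subseteq>
      {Q \<in> points \<iota>. \<not> ord_ge Q 0 (\<alpha> Q)} \<union> {Q \<in> points \<iota>. Q f \<noteq> 0}" by auto
  then show ?thesis
    using \<alpha> finite_support[OF False] unfolding adeles_def by (auto intro: finite_subset)
qed (simp add: adeles_def)

lemma bounded_adele_mult:
  assumes "f \<noteq> 0" "\<And>Q. Q \<in> points \<iota> \<Longrightarrow> mult_at D Q - Q f \<le> mult_at E Q" "\<alpha> \<in> bounded_adeles \<iota> D"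
  shows "(\<lambda>Q. f * \<alpha> Q) \<in> bounded_adeles \<iota> E"
  unfolding bounded_adeles_iff
proof
  fix Q assume Q: "Q \<in> points \<iota>"
  then have "ord_ge Q (- mult_at D Q) (\<alpha> Q)" using assms(3) by (simp add: bounded_adeles_iff)
  then show "ord_ge Q (- mult_at E Q) (f * \<alpha> Q)"
    unfolding ord_ge_mult_iff[OF Q assms(1)] by (rule ord_ge_mono) (use assms(2)[OF Q] in simp)
qed

text \<open>Multiplication by \<open>f\<close> is onto on adeles, hence on the quotients.\<close>

lemma speciality_le_mult:
  assumes f: "f \<noteq> 0" and le: "\<And>Q. Q \<in> points \<iota> \<Longrightarrow> mult_at D Q - Q f \<le> mult_at E Q"
    and D: "D \<in> divisors \<iota>" and E: "E \<in> divisors \<iota>"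
  shows "speciality E \<le> speciality D"
proof -
  have "card (cosets (AK E) (adeles \<iota>)) \<le> card (cosets (AK D) (adeles \<iota>))"
  proof (rule index_surj(2)[where f = "\<lambda>\<alpha> Q. f * \<alpha> Q", OF add_subgroup_AK add_subgroup_AK finite_cosets_AK[OF D]])
    fix \<alpha> \<beta> assume "\<alpha> - \<beta> \<in> AK D"
    then obtain \<delta> g where "\<delta> \<in> bounded_adeles \<iota> D" "\<alpha> - \<beta> = \<delta> + (\<lambda>_. g)"
      unfolding AK_def by (auto elim!: sum_setE)
    then have "(\<lambda>Q. f * \<delta> Q) \<in> bounded_adeles \<iota> E"
      "(\<lambda>Q. f * \<alpha> Q) - (\<lambda>Q. f * \<beta> Q) = (\<lambda>Q. f * \<delta> Q) + (\<lambda>_. f * g)"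
      using bounded_adele_mult[OF f le]
      by (auto simp: fun_eq_iff right_diff_distrib[symmetric] distrib_left[symmetric])
    then show "(\<lambda>Q. f * \<alpha> Q) - (\<lambda>Q. f * \<beta> Q) \<in> AK E"
      unfolding AK_def by (simp only:) (intro sum_setI, auto)
  next
    fix \<alpha> assume "\<alpha> \<in> adeles \<iota>"
    then have inv: "(\<lambda>Q. inverse f * \<alpha> Q) \<in> adeles \<iota>" by (rule adele_mult)
    have "\<alpha> - (\<lambda>Q. f * (inverse f * \<alpha> Q)) = 0" using f by (simp add: fun_eq_iff)
    then have "\<alpha> - (\<lambda>Q. f * (inverse f * \<alpha> Q)) \<in> AK E"
      using add_subgroup_0[OF add_subgroup_AK] by (simp only:)
    then show "\<exists>\<beta>\<in>adeles \<iota>. \<alpha> - (\<lambda>Q. f * \<beta> Q) \<in> AK E"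
      by (rule bexI[OF _ inv])
  qed
  then show ?thesis
    unfolding speciality_def using finite_cosets_AK[OF E] by (intro ldim_mono add_subgroup_adeles)
qed

end

text \<open>A coordinate with respect to a basis modulo \<open>U\<close> is such a functional, and
  some coordinate of \<open>a\<close> is nonzero since \<open>a\<close> is outside
  \<open>U\<close>.\<close>

lemma separating_functional:
  fixes sc :: "'f::{field,finite} \<Rightarrow> 'a::ab_group_add \<Rightarrow> 'a"
  assumes vs: "vector_space sc" and U: "module.subspace sc U" and V: "module.subspace sc V"
    and UV: "U \<subseteq> V" and fin: "finite (cosets U V)" and a: "a \<in> V" "a \<notin> U"
  obtains \<omega> :: "'a \<Rightarrow> 'f" where "\<And>v w. v \<in> V \<Longrightarrow> w \<in> V \<Longrightarrow> \<omega> (v + w) = \<omega> v + \<omega> w"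
    "\<And>c v. v \<in> V \<Longrightarrow> \<omega> (sc c v) = c * \<omega> v" "\<And>u. u \<in> U \<Longrightarrow> \<omega> u = 0" "\<omega> a \<noteq> 0"
proof -
  interpret vector_space sc by fact
  obtain S where S: "basis_mod sc U V S" using basis_mod_exists[OF vs U V fin] .
  have finS: "finite S" using S by (simp add: basis_mod_def)
  define rep where "rep v c \<longleftrightarrow> c \<in> S \<rightarrow>\<^sub>E UNIV \<and> v - (\<Sum>s\<in>S. sc (c s) s) \<in> U" for v c
  have ex1: "\<exists>!c. rep v c" if "v \<in> V" for v
    using S that by (auto simp: basis_mod_def rep_def)
  define co where "co v = (THE c. rep v c)" for v
  have co: "rep v (co v)" if "v \<in> V" for v
    unfolding co_def using ex1[OF that] by (rule theI')
  have co_eq: "co v = c" if "v \<in> V" "rep v c" for v c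
    using ex1[OF that(1)] co[OF that(1)] that(2) by blast
  have co_add: "co (v + w) = restrict (\<lambda>s. co v s + co w s) S" if "v \<in> V" "w \<in> V" for v w
  proof (rule co_eq)
    show "v + w \<in> V" using subspace_add[OF V that] .
    have "(v - (\<Sum>s\<in>S. sc (co v s) s)) + (w - (\<Sum>s\<in>S. sc (co w s) s)) \<in> U"
      using co[OF that(1)] co[OF that(2)] subspace_add[OF U] unfolding rep_def by blast
    moreover have "(v - (\<Sum>s\<in>S. sc (co v s) s)) + (w - (\<Sum>s\<in>S. sc (co w s) s)) =
        v + w - (\<Sum>s\<in>S. sc (co v s + co w s) s)"
      by (simp add: scale_left_distrib sum.distrib)
    ultimately show "rep (v + w) (restrict (\<lambda>s. co v s + co w s) S)"
      by (simp add: rep_def)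
  qed
  have co_scale: "co (sc k v) = restrict (\<lambda>s. k * co v s) S" if "v \<in> V" for k v
  proof (rule co_eq)
    show "sc k v \<in> V" using subspace_scale[OF V that] .
    have "sc k (v - (\<Sum>s\<in>S. sc (co v s) s)) \<in> U"
      using co[OF that] subspace_scale[OF U] unfolding rep_def by blast
    moreover have "sc k (v - (\<Sum>s\<in>S. sc (co v s) s)) = sc k v - (\<Sum>s\<in>S. sc (k * co v s) s)"
      by (simp add: scale_right_diff_distrib scale_sum_right)
    ultimately show "rep (sc k v) (restrict (\<lambda>s. k * co v s) S)"
      by (simp add: rep_def)
  qed
  have co_U: "co u = restrict (\<lambda>_. 0) S" if "u \<in> U" for u
    by (rule co_eq) (use that UV in \<open>auto simp: rep_def\<close>)
  have "\<exists>s\<in>S. co a s \<noteq> 0"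
  proof (rule ccontr)
    assume "\<not> ?thesis"
    then have "(\<Sum>s\<in>S. sc (co a s) s) = 0" by simp
    then show False using co[OF a(1)] a(2) by (simp add: rep_def)
  qed
  then obtain s where s: "s \<in> S" "co a s \<noteq> 0" by blast
  show thesis
    by (rule that[of "\<lambda>v. co v s"]) (use s co_add co_scale co_U in auto)
qed

context curve_basis
begin

subsection \<open>Weil differentials\<close>

lemma functional_add:
  "adele_functional \<iota> \<omega> \<Longrightarrow> \<alpha> \<in> adeles \<iota> \<Longrightarrow> \<beta> \<in> adeles \<iota> \<Longrightarrow> \<omega> (\<alpha> + \<beta>) = \<omega> \<alpha> + \<omega> \<beta>"
  by (simp add: adele_functional_def plus_fun_def)

lemma functional_scale:
  "adele_functional \<iota> \<omega> \<Longrightarrow> \<alpha> \<in> adeles \<iota> \<Longrightarrow> \<omega> (\<lambda>Q. \<iota> c * \<alpha> Q) = c * \<omega> \<alpha>"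
  by (simp add: adele_functional_def)

lemma functional_zero:
  assumes "adele_functional \<iota> \<omega>"
  shows "\<omega> 0 = 0"
proof -
  have "\<omega> (0 + 0) = \<omega> 0 + \<omega> 0"
    by (rule functional_add[OF assms add_subgroup_0 add_subgroup_0]) (rule add_subgroup_adeles)+
  then show ?thesis by (metis add_cancel_right_left add_0)
qed

lemma functional_diff:
  assumes "adele_functional \<iota> \<omega>" "\<alpha> \<in> adeles \<iota>" "\<beta> \<in> adeles \<iota>"
  shows "\<omega> (\<alpha> - \<beta>) = \<omega> \<alpha> - \<omega> \<beta>"
  using functional_add[OF assms(1) add_subgroup_diff[OF add_subgroup_adeles assms(2,3)] assms(3)]
  by simp

lemma vanishes_at_iff: "vanishes_at \<iota> \<omega> D \<longleftrightarrow> (\<forall>\<alpha>\<in>AK D. \<omega> \<alpha> = 0)"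
proof -
  have "(\<lambda>Q. \<alpha> Q + f) = \<alpha> + (\<lambda>_. f)" for \<alpha> :: "'k point \<Rightarrow> 'k" and f
    by (simp add: fun_eq_iff)
  then have "vanishes_at \<iota> \<omega> D \<longleftrightarrow> (\<forall>\<alpha>\<in>bounded_adeles \<iota> D. \<forall>f. \<omega> (\<alpha> + (\<lambda>_. f)) = 0)"
    unfolding vanishes_at_def by (simp only:)
  then show ?thesis unfolding AK_def sum_set_def by blast
qed

lemma adele_mult_add: "(\<lambda>Q. f * (\<alpha> + \<beta>) Q) = (\<lambda>Q. f * \<alpha> Q) + (\<lambda>Q. f * \<beta> Q)"
  for \<alpha> \<beta> :: "'k point \<Rightarrow> 'k"
  by (simp add: fun_eq_iff distrib_left)

lemma vanishes_mult:
  assumes "vanishes_at \<iota> \<omega> D" "f \<noteq> 0"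
    and le: "\<And>Q. Q \<in> points \<iota> \<Longrightarrow> mult_at E Q - Q f \<le> mult_at D Q"
  shows "vanishes_at \<iota> (\<lambda>\<alpha>. \<omega> (\<lambda>Q. f * \<alpha> Q)) E"
  unfolding vanishes_at_iff
proof
  fix \<alpha> assume "\<alpha> \<in> AK E"
  then obtain \<delta> g where d: "\<delta> \<in> bounded_adeles \<iota> E" "\<alpha> = \<delta> + (\<lambda>_. g)"
    unfolding AK_def by (auto elim!: sum_setE)
  have "(\<lambda>Q. f * \<alpha> Q) = (\<lambda>Q. f * \<delta> Q) + (\<lambda>_. f * g)"
    using d(2) by (simp add: fun_eq_iff distrib_left)
  moreover have "(\<lambda>Q. f * \<delta> Q) \<in> bounded_adeles \<iota> D"
    using bounded_adele_mult[OF assms(2) le d(1)] .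
  ultimately have "(\<lambda>Q. f * \<alpha> Q) \<in> AK D" unfolding AK_def by (simp only:) (intro sum_setI, auto)
  then show "\<omega> (\<lambda>Q. f * \<alpha> Q) = 0" using assms(1) by (simp add: vanishes_at_iff)
qed

lemma vanishes_mult_LS:
  assumes \<omega>: "adele_functional \<iota> \<omega>" "vanishes_at \<iota> \<omega> D" and f: "f \<in> LS (D - E)"
  shows "vanishes_at \<iota> (\<lambda>\<alpha>. \<omega> (\<lambda>Q. f * \<alpha> Q)) E"
proof (cases "f = 0")
  case True
  have "(\<lambda>Q :: 'k point. 0 :: 'k) = 0" by (simp add: fun_eq_iff)
  then show ?thesis using True functional_zero[OF \<omega>(1)] by (simp add: vanishes_at_iff)
next
  case False
  show ?thesis
  proof (rule vanishes_mult[OF \<omega>(2) False])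
    fix Q assume "Q \<in> points \<iota>"
    then show "mult_at E Q - Q f \<le> mult_at D Q"
      using f False by (auto simp: LS_iff ord_ge_def lookup_minus dest: bspec[of _ _ Q])
  qed
qed

text \<open>
  The differentials \<open>f\<^sub>1 \<omega>\<^sub>1 + f\<^sub>2 \<omega>\<^sub>2\<close> with \<open>f\<^sub>i \<in> L(D\<^sub>i + m P)\<close> vanish at \<open>- m P\<close>; for large \<open>m\<close>
  there are more pairs \<open>(f\<^sub>1, f\<^sub>2)\<close> than such differentials.
\<close>

lemma differentials_dependent:
  assumes P: "P \<in> points \<iota>"
    and \<omega>: "adele_functional \<iota> \<omega>1" "vanishes_at \<iota> \<omega>1 D1" "D1 \<in> divisors \<iota>"
      "adele_functional \<iota> \<omega>2" "vanishes_at \<iota> \<omega>2 D2" "D2 \<in> divisors \<iota>"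
  obtains a b where "a \<noteq> 0 \<or> b \<noteq> 0"
    "\<And>\<alpha>. \<alpha> \<in> adeles \<iota> \<Longrightarrow> \<omega>1 (\<lambda>Q. a * \<alpha> Q) + \<omega>2 (\<lambda>Q. b * \<alpha> Q) = 0"
proof -
  define Pm where "Pm m = Poly_Mapping.single P (int m)" for m
  have Pm: "Pm m \<in> divisors \<iota>" for m unfolding Pm_def using divisors_single[OF P] .
  define \<Phi> where "\<Phi> = (\<lambda>(a, b). restrict (\<lambda>\<alpha>. \<omega>1 (\<lambda>Q. a * \<alpha> Q) + \<omega>2 (\<lambda>Q. b * \<alpha> Q)) (adeles \<iota>))"
  have not_inj: "\<exists>m. \<not> inj_on \<Phi> (LS (D1 + Pm m) \<times> LS (D2 + Pm m))"
  proof (rule ccontr)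
    assume "\<not> ?thesis"
    then have inj: "inj_on \<Phi> (LS (D1 + Pm m) \<times> LS (D2 + Pm m))" for m by blast
    define \<kappa> where "\<kappa> = ell 0 - speciality 0"
    have le: "ell (D1 + Pm m) + ell (D2 + Pm m) \<le> speciality (0 - Pm m)" for m
    proof -
      let ?X = "LS (D1 + Pm m) \<times> LS (D2 + Pm m)"
      let ?U = "AK (0 - Pm m)"
      have div: "0 - Pm m \<in> divisors \<iota>" "D1 + Pm m \<in> divisors \<iota>" "D2 + Pm m \<in> divisors \<iota>"
        using Pm \<omega>(3,6) divisors_0 divisors_diff divisors_add by blast+
      have "card (\<Phi> ` ?X) \<le> card (cosets ?U (adeles \<iota>))"
      proof (rule card_functionals_le(2)[OF vector_space_fun subspace_AK subspace_adeles
            finite_cosets_AK[OF div(1)] _ _ _ _ AK_subset_adeles])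
        fix \<eta> assume "\<eta> \<in> \<Phi> ` ?X"
        then obtain a b where ab: "a \<in> LS (D1 + Pm m)" "b \<in> LS (D2 + Pm m)"
          and \<eta>: "\<eta> = restrict (\<lambda>\<alpha>. \<omega>1 (\<lambda>Q. a * \<alpha> Q) + \<omega>2 (\<lambda>Q. b * \<alpha> Q)) (adeles \<iota>)"
          by (auto simp: \<Phi>_def)
        show "\<eta> \<in> extensional (adeles \<iota>)" by (simp add: \<eta>)
        show "\<eta> (\<alpha> + \<beta>) = \<eta> \<alpha> + \<eta> \<beta>" if "\<alpha> \<in> adeles \<iota>" "\<beta> \<in> adeles \<iota>" for \<alpha> \<beta>
          using that add_subgroup_add[OF add_subgroup_adeles that] adele_mult
          by (simp add: \<eta> adele_mult_add functional_add[OF \<omega>(1)] functional_add[OF \<omega>(4)]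
              del: plus_fun_apply)
        show "\<eta> (\<lambda>Q. \<iota> c * \<alpha> Q) = c * \<eta> \<alpha>" if "\<alpha> \<in> adeles \<iota>" for c \<alpha>
        proof -
          have "(\<lambda>Q. f * (\<iota> c * \<alpha> Q)) = (\<lambda>Q. \<iota> c * (f * \<alpha> Q))" for f
            by (simp add: fun_eq_iff mult.left_commute)
          then show ?thesis
            using that adele_mult[OF that] functional_scale[OF \<omega>(1) adele_mult[OF that]]
              functional_scale[OF \<omega>(4) adele_mult[OF that]] by (simp add: \<eta> distrib_left)
        qed
        show "\<eta> \<alpha> = 0" if "\<alpha> \<in> AK (0 - Pm m)" for \<alpha>
        proof -
          have "a \<in> LS (D1 - (0 - Pm m))" "b \<in> LS (D2 - (0 - Pm m))" using ab by simp_all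
          then have "\<omega>1 (\<lambda>Q. a * \<alpha> Q) = 0" "\<omega>2 (\<lambda>Q. b * \<alpha> Q) = 0"
            using that vanishes_mult_LS[OF \<omega>(1,2)] vanishes_mult_LS[OF \<omega>(4,5)]
            unfolding vanishes_at_iff by blast+
          moreover have "\<alpha> \<in> adeles \<iota>" using that AK_subset_adeles by blast
          ultimately show ?thesis by (simp add: \<eta>)
        qed
      qed
      moreover have "card (\<Phi> ` ?X) = card (LS (D1 + Pm m)) * card (LS (D2 + Pm m))"
        using card_image[OF inj] by (simp add: card_cartesian_product)
      ultimately have "real (card (LS (D1 + Pm m))) * real (card (LS (D2 + Pm m)))
          \<le> real (card (cosets ?U (adeles \<iota>)))" by (metis of_nat_le_iff of_nat_mult)
      then have "log base (real (card (LS (D1 + Pm m))) * real (card (LS (D2 + Pm m))))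
          \<le> speciality (0 - Pm m)"
        unfolding speciality_def ldim_def using card_LS_pos[OF div(2)] card_LS_pos[OF div(3)] base_gt_1
        by (intro log_mono) auto
      then show ?thesis
        using card_LS_pos[OF div(2)] card_LS_pos[OF div(3)] base_gt_1
        by (simp add: ell_def log_mult_pos)
    qed
    \<comment> \<open>With k the degree of m P, Riemann-Roch makes the left side of
      \<open>le\<close> at least \<open>2 * k + 2 * \<kappa>\<close> plus the degrees of
      \<open>D1\<close> and \<open>D2\<close>, and the right side at most
      \<open>k - \<kappa> + ell 0\<close>. Hence \<open>k \<le> M\<close>.\<close>
    define M where "M = ell 0 - 3 * \<kappa> - divisor_degree \<iota> D1 - divisor_degree \<iota> D2"
    have "real m \<le> M" for m
    proof -
      have div: "0 - Pm m \<in> divisors \<iota>" "D1 + Pm m \<in> divisors \<iota>" "D2 + Pm m \<in> divisors \<iota>"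
        using Pm \<omega>(3,6) divisors_0 divisors_diff divisors_add by blast+
      have \<chi>: "ell D - speciality D - divisor_degree \<iota> D = \<kappa>" if "D \<in> divisors \<iota>" for D
        using euler_characteristic[OF that divisors_0] by (simp add: \<kappa>_def divisor_degree_0)
      define k where "k = divisor_degree \<iota> (Pm m)"
      have "k = int m * int (point_degree \<iota> P)" by (simp add: k_def Pm_def divisor_degree_single)
      moreover have "int m * 1 \<le> int m * int (point_degree \<iota> P)"
        using point_degree_pos[OF P] by (intro mult_left_mono) auto
      ultimately have "real m \<le> k" by linarith
      moreover have "ell (0 - Pm m) \<le> ell 0"
        by (rule ell_bounds(1)[OF _ div(1) divisors_0])
          (auto simp: effective_def lookup_minus Pm_def lookup_single when_def)
      ultimately show ?thesis
        using \<chi>[OF div(1)] \<chi>[OF div(2)] \<chi>[OF div(3)] le[of m] speciality_nonneg[OF div(2)]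
          speciality_nonneg[OF div(3)]
        by (simp add: M_def divisor_degree_add divisor_degree_diff divisor_degree_0 k_def[symmetric]
            del: diff_0)
    qed
    then show False using reals_Archimedean2[of M] by (metis not_le)
  qed
  then obtain m a b a' b' where ne: "(a, b) \<noteq> (a', b')" and eq: "\<Phi> (a, b) = \<Phi> (a', b')"
    unfolding inj_on_def by (metis surj_pair)
  show thesis
  proof (rule that[of "a - a'" "b - b'"])
    show "a - a' \<noteq> 0 \<or> b - b' \<noteq> 0" using ne by auto
    fix \<alpha> assume \<alpha>: "\<alpha> \<in> adeles \<iota>"
    have "\<Phi> (a, b) \<alpha> = \<Phi> (a', b') \<alpha>" using eq by simp
    then have *: "\<omega>1 (\<lambda>Q. a * \<alpha> Q) + \<omega>2 (\<lambda>Q. b * \<alpha> Q) = \<omega>1 (\<lambda>Q. a' * \<alpha> Q) + \<omega>2 (\<lambda>Q. b' * \<alpha> Q)"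
      using \<alpha> by (simp add: \<Phi>_def)
    have "(\<lambda>Q. (f - f') * \<alpha> Q) = (\<lambda>Q. f * \<alpha> Q) - (\<lambda>Q. f' * \<alpha> Q)" for f f'
      by (simp add: fun_eq_iff left_diff_distrib)
    then have eqs: "\<omega>1 (\<lambda>Q. (a - a') * \<alpha> Q) = \<omega>1 (\<lambda>Q. a * \<alpha> Q) - \<omega>1 (\<lambda>Q. a' * \<alpha> Q)"
      "\<omega>2 (\<lambda>Q. (b - b') * \<alpha> Q) = \<omega>2 (\<lambda>Q. b * \<alpha> Q) - \<omega>2 (\<lambda>Q. b' * \<alpha> Q)"
      using functional_diff[OF \<omega>(1) adele_mult[OF \<alpha>] adele_mult[OF \<alpha>]]
        functional_diff[OF \<omega>(4) adele_mult[OF \<alpha>] adele_mult[OF \<alpha>]] by simp_all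
    show "\<omega>1 (\<lambda>Q. (a - a') * \<alpha> Q) + \<omega>2 (\<lambda>Q. (b - b') * \<alpha> Q) = 0"
      unfolding eqs add_diff_add[symmetric] * by simp
  qed
qed

text \<open>In the dependence relation neither coefficient is 0: multiplication by a nonzero
  function is onto the adeles, so it cannot annihilate a nonzero differential. Thus one differential
  can be solved for.\<close>

lemma differentials_one_dimensional:
  assumes P: "P \<in> points \<iota>"
    and \<omega>: "adele_functional \<iota> \<omega>1" "vanishes_at \<iota> \<omega>1 D1" "D1 \<in> divisors \<iota>"
      "adele_functional \<iota> \<omega>2" "vanishes_at \<iota> \<omega>2 D2" "D2 \<in> divisors \<iota>"
    and nz: "\<alpha>1 \<in> adeles \<iota>" "\<omega>1 \<alpha>1 \<noteq> 0" "\<alpha>2 \<in> adeles \<iota>" "\<omega>2 \<alpha>2 \<noteq> 0"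
  obtains y where "y \<noteq> 0" "\<And>\<alpha>. \<alpha> \<in> adeles \<iota> \<Longrightarrow> \<omega>2 \<alpha> = \<omega>1 (\<lambda>Q. y * \<alpha> Q)"
proof -
  obtain a b where ab: "a \<noteq> 0 \<or> b \<noteq> 0"
    and rel: "\<And>\<alpha>. \<alpha> \<in> adeles \<iota> \<Longrightarrow> \<omega>1 (\<lambda>Q. a * \<alpha> Q) + \<omega>2 (\<lambda>Q. b * \<alpha> Q) = 0"
    using differentials_dependent[OF P \<omega>] by metis
  have zero: "\<eta> (\<lambda>Q. 0 * \<alpha> Q) = 0" if "adele_functional \<iota> \<eta>" for \<eta> and \<alpha> :: "'k point \<Rightarrow> 'k"
  proof -
    have "(\<lambda>Q. 0 * \<alpha> Q) = 0" by (simp add: fun_eq_iff)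
    then show ?thesis using functional_zero[OF that] by simp
  qed
  have inv: "(\<lambda>Q. f * (inverse f * \<alpha> Q)) = \<alpha>" if "f \<noteq> 0" for f and \<alpha> :: "'k point \<Rightarrow> 'k"
    using that by (simp add: fun_eq_iff)
  have b0: "b \<noteq> 0"
  proof
    assume "b = 0"
    then show False
      using rel[OF adele_mult[OF nz(1), of "inverse a"]] ab zero[OF \<omega>(4)] inv[of a \<alpha>1] nz(2) by auto
  qed
  have a0: "a \<noteq> 0"
  proof
    assume "a = 0"
    then show False
      using rel[OF adele_mult[OF nz(3), of "inverse b"]] ab zero[OF \<omega>(1)] inv[of b \<alpha>2] nz(4) by auto
  qed
  define y where "y = - a / b"
  show thesis
  proof (rule that[of y])
    show "y \<noteq> 0" using a0 b0 by (simp add: y_def)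
    fix \<alpha> assume \<alpha>: "\<alpha> \<in> adeles \<iota>"
    have 1: "\<omega>1 (\<lambda>Q. a * (inverse b * \<alpha> Q)) + \<omega>2 \<alpha> = 0"
      using rel[OF adele_mult[OF \<alpha>, of "inverse b"]] inv[OF b0, of \<alpha>] by simp
    have 2: "(\<lambda>Q. a * (inverse b * \<alpha> Q)) = (\<lambda>Q. \<iota> (- 1) * (y * \<alpha> Q))"
      by (simp add: y_def fun_eq_iff const_minus divide_inverse mult_ac)
    have 3: "\<omega>1 (\<lambda>Q. \<iota> (- 1) * (y * \<alpha> Q)) = - 1 * \<omega>1 (\<lambda>Q. y * \<alpha> Q)"
      by (rule functional_scale[OF \<omega>(1) adele_mult[OF \<alpha>]])
    from 1[unfolded 2 3] show "\<omega>2 \<alpha> = \<omega>1 (\<lambda>Q. y * \<alpha> Q)"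
      by (simp add: add_eq_0_iff)
  qed
qed

subsection \<open>Duality for the sets \<open>\<Gamma>\<^sub>P\<close>\<close>

lemma LS_diff_pt_iff:
  assumes "Q \<in> points \<iota>" "f \<in> LS M"
  shows "f \<in> LS (M - pt Q) \<longleftrightarrow> f = 0 \<or> Q f \<noteq> - mult_at M Q"
proof -
  have *: "ord_ge R (- mult_at M R) f" if "R \<in> points \<iota>" for R using assms(2) that by (simp add: LS_iff)
  have "f \<in> LS (M - pt Q) \<longleftrightarrow> ord_ge Q (- mult_at M Q + 1) f"
  proof
    assume "f \<in> LS (M - pt Q)"
    then show "ord_ge Q (- mult_at M Q + 1) f"
      using assms(1) by (auto simp: LS_iff lookup_minus mult_at_pt dest: bspec[of _ _ Q])
  next
    assume Qf: "ord_ge Q (- mult_at M Q + 1) f"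
    show "f \<in> LS (M - pt Q)"
      unfolding LS_iff
    proof
      fix R assume "R \<in> points \<iota>"
      then show "ord_ge R (- mult_at (M - pt Q) R) f"
        using *[of R] Qf by (cases "R = Q") (auto simp: lookup_minus mult_at_pt)
    qed
  qed
  then show ?thesis using *[OF assms(1)] by (auto simp: ord_ge_def)
qed

lemma effective_pt: "effective (M - (M - pt Q))"
  by (simp add: effective_def mult_at_pt)

text \<open>The working form of \<Gamma>: a section of exactly the lowest order permitted at
  \<open>Q\<close>. Orders of products add, which the definition by unequal spaces does not
  show.\<close>

lemma Gamma_pt_iff:
  assumes Q: "Q \<in> points \<iota>" and M: "M \<in> divisors \<iota>"
  shows "M \<in> Gamma_pt \<iota> Q \<longleftrightarrow> (\<exists>f\<in>LS M. f \<noteq> 0 \<and> Q f = - mult_at M Q)"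
proof -
  have "M \<in> Gamma_pt \<iota> Q \<longleftrightarrow> (\<exists>f\<in>LS M. f \<notin> LS (M - pt Q))"
    using LS_mono[OF effective_pt[of M Q]] M by (auto simp: Gamma_pt_def)
  then show ?thesis using LS_diff_pt_iff[OF Q] by blast
qed

lemma Gamma_pt_divisor: "M \<in> Gamma_pt \<iota> Q \<Longrightarrow> M \<in> divisors \<iota>"
  by (simp add: Gamma_pt_def)

text \<open>The product of two sections of exact order would be a function \<open>h\<close> whose
  only excess over L(W) is one order at \<open>P\<close>. The differential kills \<open>h\<close>,
  hence also its component at \<open>P\<close>; as \<open>P\<close> has degree one, that component
  spans A(W + P) modulo A(W). So the differential would vanish at W + P, against the maximality of
  W.\<close>

lemma canonical_duality_imp_notin:
  assumes W: "canonical_divisor \<iota> W" and P: "P \<in> rational_points \<iota>"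
    and M: "M \<in> Gamma_pt \<iota> P"
  shows "W + pt P - M \<notin> Gamma_pt \<iota> P"
proof
  assume N: "W + pt P - M \<in> Gamma_pt \<iota> P"
  have Pp: "P \<in> points \<iota>" and deg: "point_degree \<iota> P = 1"
    using P by (auto simp: rational_points_def)
  obtain \<omega> where \<omega>: "adele_functional \<iota> \<omega>" "divisor_of_differential \<iota> \<omega> W"
    using W by (auto simp: canonical_divisor_def weil_differential_def)
  have Wd: "W \<in> divisors \<iota>" "vanishes_at \<iota> \<omega> W"
    and max: "\<And>D. D \<in> divisors \<iota> \<Longrightarrow> vanishes_at \<iota> \<omega> D \<Longrightarrow> effective (W - D)"
    using \<omega>(2) by (auto simp: divisor_of_differential_def)
  have van: "\<omega> \<alpha> = 0" if "\<alpha> \<in> AK W" for \<alpha> using Wd(2) that by (simp add: vanishes_at_iff)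
  obtain f where f: "f \<in> LS M" "f \<noteq> 0" "P f = - mult_at M P"
    using M Gamma_pt_iff[OF Pp Gamma_pt_divisor[OF M]] by blast
  obtain g where g: "g \<in> LS (W + pt P - M)" "g \<noteq> 0" "P g = - mult_at (W + pt P - M) P"
    using N Gamma_pt_iff[OF Pp Gamma_pt_divisor[OF N]] by blast
  define h where "h = f * g"
  have hP: "P h = - mult_at W P - 1" "h \<noteq> 0"
    using f g pt_mult[OF Pp f(2) g(2)] by (auto simp: h_def lookup_add lookup_minus mult_at_pt)
  have hQ: "ord_ge Q (- mult_at W Q) h" if "Q \<in> points \<iota>" "Q \<noteq> P" for Q
  proof -
    have "ord_ge Q (- mult_at M Q) f" "ord_ge Q (- mult_at (W + pt P - M) Q) g"
      using f(1) g(1) that(1) unfolding LS_iff by blast+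
    then have "ord_ge Q (- mult_at M Q + - mult_at (W + pt P - M) Q) (f * g)"
      by (rule ord_ge_mult[OF that(1)])
    then show ?thesis using that(2) by (simp add: h_def lookup_add lookup_minus mult_at_pt)
  qed
  define \<beta> where "\<beta> = (\<lambda>Q. if Q = P then h else 0)"
  have \<beta>: "\<beta> \<in> bounded_adeles \<iota> (W + pt P)"
    using hP by (auto simp: bounded_adeles_iff \<beta>_def lookup_add mult_at_pt ord_ge_def)
  have \<beta>W: "(\<lambda>_. h) - \<beta> \<in> bounded_adeles \<iota> W"
    using hQ by (auto simp: bounded_adeles_iff \<beta>_def)
  have bA: "bounded_adeles \<iota> D \<subseteq> AK D" for D
    unfolding AK_def using sum_set_left[OF add_subgroup_principal] by blast
  have pA: "(\<lambda>_. h) \<in> AK D" for h D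
    unfolding AK_def by (rule sum_set_right[OF add_subgroup_bounded_adeles rangeI])
  \<comment> \<open>The residue theorem in adelic form: \<open>h\<close> is principal and its
    components away from \<open>P\<close> lie in A(W), so the part at \<open>P\<close> contributes
    0.\<close>
  have \<omega>\<beta>: "\<omega> \<beta> = 0"
  proof -
    have "\<beta> \<in> adeles \<iota>" using \<beta> bounded_adeles_subset_adeles by blast
    then have "\<omega> ((\<lambda>_. h) - \<beta>) = \<omega> (\<lambda>_. h) - \<omega> \<beta>"
      using functional_diff[OF \<omega>(1) principal_adele] by blast
    then show ?thesis using van[OF subsetD[OF bA \<beta>W]] van[OF pA[of h]] by simp
  qed
  have "\<not> effective (W - (W + pt P))"
    by (auto simp: effective_def lookup_minus lookup_add mult_at_pt intro!: exI[of _ P])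
  then have "\<not> vanishes_at \<iota> \<omega> (W + pt P)"
    using max divisors_add[OF Wd(1) divisors_single[OF Pp]] by blast
  then obtain \<alpha>' where \<alpha>': "\<alpha>' \<in> AK (W + pt P)" "\<omega> \<alpha>' \<noteq> 0" by (auto simp: vanishes_at_iff)
  then obtain \<alpha> g' where \<alpha>: "\<alpha> \<in> bounded_adeles \<iota> (W + pt P)" "\<alpha>' = \<alpha> + (\<lambda>_. g')"
    unfolding AK_def by (auto elim!: sum_setE)
  have \<alpha>A: "\<alpha> \<in> adeles \<iota>" using \<alpha> bounded_adeles_subset_adeles by blast
  have \<omega>\<alpha>: "\<omega> \<alpha> \<noteq> 0"
    using \<alpha>'(2) functional_add[OF \<omega>(1) \<alpha>A principal_adele, of g'] van[OF pA[of g']] \<alpha>(2) by auto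
  define sc where "sc c = (\<lambda>Q. \<iota> c * \<beta> Q)" for c
  have sc_inc: "c = d" if "sc c - sc d \<in> bounded_adeles \<iota> W" for c d
  proof (rule ccontr)
    assume "c \<noteq> d"
    then have nz: "\<iota> (c - d) \<noteq> 0" by simp
    have "ord_ge P (- mult_at W P) (\<iota> (c - d) * h)"
      using bspec[OF that[unfolded bounded_adeles_iff] Pp]
      by (simp add: sc_def \<beta>_def const_diff left_diff_distrib)
    then have "ord_ge P (- mult_at W P) h"
      using ord_ge_mult_iff[OF Pp nz] pt_const[OF Pp, of "c - d"] \<open>c \<noteq> d\<close> by simp
    then show False using hP by (simp add: ord_ge_def)
  qed
  interpret vs: vector_space "\<lambda>c (\<alpha> :: 'k point \<Rightarrow> 'k) Q. \<iota> c * \<alpha> Q" by (rule vector_space_fun)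
  have scA: "sc c \<in> bounded_adeles \<iota> (W + pt P)" for c
    unfolding sc_def using vs.subspace_scale[OF subspace_bounded_adeles \<beta>] .
  \<comment> \<open>For rational \<open>P\<close> the quotient has q elements, and the q constant
    multiples of \<beta> are already incongruent; \<alpha> would be one class too many.\<close>
  have "\<exists>c. \<alpha> - sc c \<in> bounded_adeles \<iota> W"
  proof (rule ccontr)
    assume none: "\<not> ?thesis"
    note grp = add_subgroup_bounded_adeles[of W]
    have sym: "sc c - \<alpha> \<notin> bounded_adeles \<iota> W" for c
      using none add_subgroup_uminus[OF grp, of "sc c - \<alpha>"] by auto
    have "card (insert \<alpha> (range sc)) \<le> card (cosets (bounded_adeles \<iota> W) (bounded_adeles \<iota> (W + pt P)))"
    proof (rule card_incongruent_le(2)[OF grp index_bounded_adeles_pt(1)[OF Pp]])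
      show "insert \<alpha> (range sc) \<subseteq> bounded_adeles \<iota> (W + pt P)" using \<alpha> scA by auto
      fix s t assume "s \<in> insert \<alpha> (range sc)" "t \<in> insert \<alpha> (range sc)" "s - t \<in> bounded_adeles \<iota> W"
      then show "s = t" using none sym sc_inc by blast
    qed
    then have le: "card (insert \<alpha> (range sc)) \<le> CARD('f)"
      using index_bounded_adeles_pt(2)[OF Pp, of W] deg by simp
    have "\<alpha> \<notin> range sc"
    proof
      assume "\<alpha> \<in> range sc"
      then obtain c where "\<alpha> - sc c = 0" by auto
      then show False using none add_subgroup_0[OF grp] by metis
    qed
    moreover have "inj sc"
    proof (rule injI)
      fix c d assume "sc c = sc d"
      then have "sc c - sc d = 0" by simp
      then show "c = d" using sc_inc add_subgroup_0[OF grp] by metis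
    qed
    ultimately show False using le by (simp add: card_image)
  qed
  then obtain c where c: "\<alpha> - sc c \<in> bounded_adeles \<iota> W" by blast
  have "sc c \<in> adeles \<iota>" using scA bounded_adeles_subset_adeles by blast
  then have "\<omega> (\<alpha> - sc c) = \<omega> \<alpha> - \<omega> (sc c)" using functional_diff[OF \<omega>(1) \<alpha>A] by blast
  moreover have "\<omega> (sc c) = c * \<omega> \<beta>"
    unfolding sc_def using functional_scale[OF \<omega>(1)] \<beta> bounded_adeles_subset_adeles by blast
  ultimately show False using van[OF subsetD[OF bA c]] \<omega>\<beta> \<omega>\<alpha> by simp
qed

text \<open>If L does not grow from M - P to M, then A(M) + k does. A functional that sees this
  growth is a differential vanishing at M - P but not at M, hence \<open>y\<close> times the given
  one, and this \<open>y\<close> lies in L(W + P - M) but not in L(W - M).\<close>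

lemma canonical_duality_imp_in:
  assumes W: "canonical_divisor \<iota> W" and P: "P \<in> points \<iota>"
    and M: "M \<in> divisors \<iota>" "M \<notin> Gamma_pt \<iota> P"
  shows "W + pt P - M \<in> Gamma_pt \<iota> P"
proof -
  obtain \<omega> \<alpha>1 where \<omega>: "adele_functional \<iota> \<omega>" "divisor_of_differential \<iota> \<omega> W"
    and \<alpha>1: "\<alpha>1 \<in> adeles \<iota>" "\<omega> \<alpha>1 \<noteq> 0"
    using W by (auto simp: canonical_divisor_def weil_differential_def)
  have Wd: "W \<in> divisors \<iota>" "vanishes_at \<iota> \<omega> W"
    and max: "\<And>D. D \<in> divisors \<iota> \<Longrightarrow> vanishes_at \<iota> \<omega> D \<Longrightarrow> effective (W - D)"
    using \<omega>(2) by (auto simp: divisor_of_differential_def)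
  have MP: "M - pt P \<in> divisors \<iota>" using M(1) divisors_single[OF P] divisors_diff by blast
  have LSeq: "LS M = LS (M - pt P)" using M by (simp add: Gamma_pt_def)
  have "AK (M - pt P) \<noteq> AK M"
  proof
    assume eq: "AK (M - pt P) = AK M"
    have "ldim (AK (M - pt P)) (AK M) = point_degree \<iota> P"
      using ell_AK[OF effective_pt MP M(1)] LSeq
      by (simp add: ell_def divisor_degree_diff divisor_degree_single)
    moreover have "ldim (AK M) (AK M) = 0"
      by (simp add: ldim_def card_cosets_self[OF add_subgroup_AK])
    ultimately show False using eq point_degree_pos[OF P] by simp
  qed
  then obtain \<alpha> where \<alpha>: "\<alpha> \<in> AK M" "\<alpha> \<notin> AK (M - pt P)"
    using AK_mono[OF effective_pt[of M P]] by blast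
  have \<alpha>A: "\<alpha> \<in> adeles \<iota>" using \<alpha> AK_subset_adeles by blast
  obtain \<eta> :: "('k point \<Rightarrow> 'k) \<Rightarrow> 'f"
    where \<eta>: "\<And>\<alpha> \<beta>. \<alpha> \<in> adeles \<iota> \<Longrightarrow> \<beta> \<in> adeles \<iota> \<Longrightarrow> \<eta> (\<alpha> + \<beta>) = \<eta> \<alpha> + \<eta> \<beta>"
      "\<And>c \<alpha>. \<alpha> \<in> adeles \<iota> \<Longrightarrow> \<eta> (\<lambda>Q. \<iota> c * \<alpha> Q) = c * \<eta> \<alpha>"
      "\<And>\<alpha>. \<alpha> \<in> AK (M - pt P) \<Longrightarrow> \<eta> \<alpha> = 0" "\<eta> \<alpha> \<noteq> 0"
    using separating_functional[OF vector_space_fun subspace_AK subspace_adeles AK_subset_adeles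
        finite_cosets_AK[OF MP] \<alpha>A \<alpha>(2)] by blast
  have \<eta>f: "adele_functional \<iota> \<eta>"
    using \<eta>(1,2) by (simp add: adele_functional_def plus_fun_def)
  have \<eta>v: "vanishes_at \<iota> \<eta> (M - pt P)" using \<eta>(3) by (simp add: vanishes_at_iff)
  obtain y where y: "y \<noteq> 0" "\<And>\<alpha>. \<alpha> \<in> adeles \<iota> \<Longrightarrow> \<eta> \<alpha> = \<omega> (\<lambda>Q. y * \<alpha> Q)"
    using differentials_one_dimensional[OF P \<omega>(1) Wd(2,1) \<eta>f \<eta>v MP \<alpha>1 \<alpha>A \<eta>(4)] by metis
  have "finite {Q \<in> points \<iota>. mult_at (M - pt P) Q - Q y \<noteq> 0}"
    by (rule finite_subset[OF _ finite_UnI[OF finite_support_divisor[of "M - pt P"] finite_support[OF y(1)]]])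
      auto
  \<comment> \<open>Dividing the new differential by \<open>y\<close> shows that the given one
    vanishes at M - P minus the divisor of \<open>y\<close>, so this divisor lies below W.\<close>
  then obtain E where E: "E \<in> divisors \<iota>" "\<And>Q. Q \<in> points \<iota> \<Longrightarrow> mult_at E Q = mult_at (M - pt P) Q - Q y"
    using divisor_exists[of "\<lambda>Q. mult_at (M - pt P) Q - Q y"] by blast
  have "vanishes_at \<iota> (\<lambda>\<alpha>. \<eta> (\<lambda>Q. inverse y * \<alpha> Q)) E"
  proof (rule vanishes_mult[OF \<eta>v])
    fix Q assume "Q \<in> points \<iota>"
    then show "mult_at E Q - Q (inverse y) \<le> mult_at (M - pt P) Q"
      using E(2) pt_inverse[of Q y] by simp
  qed (use y in simp)
  moreover have "\<eta> (\<lambda>Q. inverse y * \<beta> Q) = \<omega> \<beta>" if "\<beta> \<in> adeles \<iota>" for \<beta>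
  proof -
    have "(\<lambda>Q. y * (inverse y * \<beta> Q)) = \<beta>" using y(1) by (simp add: fun_eq_iff)
    then show ?thesis using y(2)[OF adele_mult[OF that, of "inverse y"]] by simp
  qed
  ultimately have "vanishes_at \<iota> \<omega> E"
    unfolding vanishes_at_iff using subsetD[OF AK_subset_adeles] by metis
  then have eff: "effective (W - E)" using max E(1) by blast
  have yLS: "y \<in> LS (W + pt P - M)"
    unfolding LS_iff
  proof
    fix Q assume Q: "Q \<in> points \<iota>"
    have "0 \<le> mult_at W Q - mult_at E Q" using eff by (simp add: effective_def lookup_minus)
    then show "ord_ge Q (- mult_at (W + pt P - M) Q) y"
      using E(2)[OF Q] by (simp add: ord_ge_def lookup_add lookup_minus)
  qed
  have "y \<notin> LS (W - M)"
  proof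
    assume "y \<in> LS (W - M)"
    then have "vanishes_at \<iota> (\<lambda>\<alpha>. \<omega> (\<lambda>Q. y * \<alpha> Q)) M"
      by (rule vanishes_mult_LS[OF \<omega>(1) Wd(2)])
    then show False using \<alpha>(1) \<eta>(4) y(2)[OF \<alpha>A] by (simp add: vanishes_at_iff)
  qed
  moreover have "W + pt P - M - pt P = W - M" by simp
  moreover have "W + pt P - M \<in> divisors \<iota>"
    using Wd(1) M(1) divisors_single[OF P] divisors_add divisors_diff by blast
  ultimately show ?thesis using yLS by (auto simp: Gamma_pt_def)
qed

end

subsection \<open>The coset bound\<close>

context curve_basis
begin

text \<open>Sections of exact order multiply. With D - C in \<Gamma>, this transfers non-membership
  from M - C to M - D.\<close>

lemma Gamma_pt_add:
  assumes Q: "Q \<in> points \<iota>" and M: "M \<in> Gamma_pt \<iota> Q" and M': "M' \<in> Gamma_pt \<iota> Q"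
  shows "M + M' \<in> Gamma_pt \<iota> Q"
proof -
  note div = Gamma_pt_divisor[OF M] Gamma_pt_divisor[OF M']
  obtain f where f: "f \<in> LS M" "f \<noteq> 0" "Q f = - mult_at M Q"
    using M Gamma_pt_iff[OF Q div(1)] by blast
  obtain f' where f': "f' \<in> LS M'" "f' \<noteq> 0" "Q f' = - mult_at M' Q"
    using M' Gamma_pt_iff[OF Q div(2)] by blast
  have "f * f' \<in> LS (M + M')"
    unfolding LS_iff
  proof
    fix R assume R: "R \<in> points \<iota>"
    have "ord_ge R (- mult_at M R) f" "ord_ge R (- mult_at M' R) f'"
      using f(1) f'(1) R unfolding LS_iff by blast+
    then have "ord_ge R (- mult_at M R + - mult_at M' R) (f * f')" by (rule ord_ge_mult[OF R])
    then show "ord_ge R (- mult_at (M + M') R) (f * f')" by (simp add: lookup_add)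
  qed
  moreover have "Q (f * f') = - mult_at (M + M') Q" using pt_mult[OF Q f(2) f'(2)] f f' by (simp add: lookup_add)
  moreover have "f * f' \<noteq> 0" using f f' by simp
  ultimately show ?thesis using Gamma_pt_iff[OF Q divisors_add[OF div]] by blast
qed

text \<open>Multiplication by \<open>f\<close> carries sections of \<open>M\<close> to sections of
  \<open>M'\<close> and keeps exactness at \<open>Q\<close>. It is needed because K + C is
  decomposed only up to linear equivalence.\<close>

lemma Gamma_pt_linear_equivalence:
  assumes Q: "Q \<in> points \<iota>" and M: "M \<in> Gamma_pt \<iota> Q" and M': "M' \<in> divisors \<iota>"
    and f: "f \<noteq> 0" "\<And>R. R \<in> points \<iota> \<Longrightarrow> mult_at M R = mult_at M' R + R f"
  shows "M' \<in> Gamma_pt \<iota> Q"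
proof -
  obtain h where h: "h \<in> LS M" "h \<noteq> 0" "Q h = - mult_at M Q"
    using M Gamma_pt_iff[OF Q Gamma_pt_divisor[OF M]] by blast
  have "f * h \<in> LS M'" by (rule LS_mult[OF f(1) _ h(1)]) (simp add: f(2))
  moreover have "Q (f * h) = - mult_at M' Q" using pt_mult[OF Q f(1) h(2)] h(3) f(2)[OF Q] by simp
  moreover have "f * h \<noteq> 0" using f h by simp
  ultimately show ?thesis using Gamma_pt_iff[OF Q M'] by blast
qed

text \<open>The q constant multiples of a section of exact order at \<open>Q\<close> are incongruent
  modulo L(M - Q).\<close>

lemma ell_step_ge_1:
  assumes Q: "Q \<in> points \<iota>" and M: "M \<in> Gamma_pt \<iota> Q"
  shows "1 \<le> ell M - ell (M - pt Q)"
proof -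
  note Md = Gamma_pt_divisor[OF M]
  have MQ: "M - pt Q \<in> divisors \<iota>" using Md divisors_single[OF Q] divisors_diff by blast
  obtain h where h: "h \<in> LS M" "h \<noteq> 0" "Q h = - mult_at M Q"
    using M Gamma_pt_iff[OF Q Md] by blast
  note fin = degree_split(1)[OF effective_pt MQ Md]
  have inc: "c = d" if "\<iota> c * h - \<iota> d * h \<in> LS (M - pt Q)" for c d
  proof (rule ccontr)
    assume "c \<noteq> d"
    then have nz: "\<iota> (c - d) \<noteq> 0" by simp
    have "\<iota> (c - d) * h \<in> LS (M - pt Q)" using that by (simp add: const_diff left_diff_distrib)
    moreover have "Q (\<iota> (c - d) * h) = - mult_at M Q"
      using pt_mult[OF Q nz h(2)] pt_const[OF Q, of "c - d"] \<open>c \<noteq> d\<close> h(3) by simp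
    ultimately show False
      using LS_diff_pt_iff[OF Q LS_scale[OF h(1)]] nz h(2) by auto
  qed
  have "inj (\<lambda>c. \<iota> c * h)"
  proof (rule injI)
    fix c d assume "\<iota> c * h = \<iota> d * h"
    then have "\<iota> c * h - \<iota> d * h = 0" by simp
    then show "c = d" using inc add_subgroup_0[OF add_subgroup_LS] by metis
  qed
  then have "CARD('f) = card (range (\<lambda>c. \<iota> c * h))" by (simp add: card_image)
  also have "\<dots> \<le> card (cosets (LS (M - pt Q)) (LS M))"
    using LS_scale[OF h(1)] inc by (intro card_incongruent_le(2)[OF add_subgroup_LS fin]) auto
  finally have "log base base \<le> ldim (LS (M - pt Q)) (LS M)"
    unfolding ldim_def base_eq[symmetric] using base_gt_1 by (intro log_mono) (auto simp: base_eq)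
  then show ?thesis using ell_diff[OF effective_pt MQ Md] base_gt_1 by simp
qed

lemma ell_step_mono:
  assumes Q: "Q \<in> points \<iota>" and D: "D \<in> Gamma_pt \<iota> Q" and M: "M \<in> divisors \<iota>"
  shows "ell (M - D) - ell (M - D - pt Q) \<le> ell M - ell (M - pt Q)"
proof -
  note Dd = Gamma_pt_divisor[OF D]
  have div: "M - D \<in> divisors \<iota>" "M - D - pt Q \<in> divisors \<iota>" "M - pt Q \<in> divisors \<iota>"
    using Dd M divisors_single[OF Q] divisors_diff by blast+
  obtain f where f: "f \<in> LS D" "f \<noteq> 0" "Q f = - mult_at D Q"
    using D Gamma_pt_iff[OF Q Dd] by blast
  have fR: "- mult_at D R \<le> R f" if "R \<in> points \<iota>" for R
    using f(1,2) that by (auto simp: LS_iff ord_ge_def dest: bspec[of _ _ R])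
  have f1: "f * v \<in> LS M" if "v \<in> LS (M - D)" for v
  proof (rule LS_mult[OF f(2) _ that])
    show "mult_at (M - D) R - R f \<le> mult_at M R" if "R \<in> points \<iota>" for R
      using fR[OF that] by (simp add: lookup_minus)
  qed
  have f2: "v - w \<in> LS (M - D - pt Q)"
    if "v \<in> LS (M - D)" "w \<in> LS (M - D)" "f * v - f * w \<in> LS (M - pt Q)" for v w
  proof -
    have vw: "v - w \<in> LS (M - D)" using add_subgroup_diff[OF add_subgroup_LS that(1,2)] .
    have "f * (v - w) \<in> LS (M - pt Q)" using that(3) by (simp add: right_diff_distrib)
    then have "f * (v - w) = 0 \<or> Q (f * (v - w)) \<noteq> - mult_at M Q"
      using LS_diff_pt_iff[OF Q f1[OF vw]] by blast
    then have "v - w = 0 \<or> Q (v - w) \<noteq> - mult_at (M - D) Q"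
      using f(2,3) pt_mult[OF Q f(2), of "v - w"] by (cases "v - w = 0") (auto simp: lookup_minus)
    then show ?thesis using LS_diff_pt_iff[OF Q vw] by blast
  qed
  note fin = degree_split(1)[OF effective_pt div(3) M]
  note idx = index_inj[where f = "(*) f", OF add_subgroup_LS add_subgroup_LS fin f1 f2]
  have "ldim (LS (M - D - pt Q)) (LS (M - D)) \<le> ldim (LS (M - pt Q)) (LS M)"
    using idx by (intro ldim_mono add_subgroup_LS)
  then show ?thesis
    using ell_diff[OF effective_pt div(2,1)] ell_diff[OF effective_pt div(3) M] by simp
qed

text \<open>The function \<phi> of the overview, with \<open>D\<close> as its parameter.\<close>

definition gap :: "'k divisor \<Rightarrow> 'k divisor \<Rightarrow> real" where
  "gap D M = ell M - ell (M - D)"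

lemma gap_step:
  assumes "Q \<in> points \<iota>" "D \<in> Gamma_pt \<iota> Q" "M \<in> divisors \<iota>"
  shows "gap D M \<le> gap D (M + pt Q)"
proof -
  have "M + pt Q \<in> divisors \<iota>" using assms divisors_single divisors_add by blast
  from ell_step_mono[OF assms(1,2) this] show ?thesis
    by (simp add: gap_def algebra_simps)
qed

lemma gap_step_strict:
  assumes Q: "Q \<in> points \<iota>" and D: "D \<in> divisors \<iota>"
    and M: "M + pt Q \<in> Gamma_pt \<iota> Q" "M + pt Q - D \<notin> Gamma_pt \<iota> Q"
  shows "gap D M + 1 \<le> gap D (M + pt Q)"
proof -
  have "M + pt Q - D \<in> divisors \<iota>" using Gamma_pt_divisor[OF M(1)] D divisors_diff by blast
  then have "LS (M + pt Q - D) = LS (M + pt Q - D - pt Q)" using M(2) by (simp add: Gamma_pt_def)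
  then have "ell (M + pt Q - D) = ell (M - D)" by (simp add: ell_def algebra_simps)
  moreover have "ell M + 1 \<le> ell (M + pt Q)" using ell_step_ge_1[OF Q M(1)] by simp
  ultimately show ?thesis by (simp add: gap_def)
qed

lemma gap_add_effective:
  assumes "effective Z" "Poly_Mapping.keys Z \<subseteq> S" "S \<subseteq> points \<iota>"
    and D: "\<And>Q. Q \<in> S \<Longrightarrow> D \<in> Gamma_pt \<iota> Q" and M: "M \<in> divisors \<iota>"
  shows "gap D M \<le> gap D (M + Z)"
  using assms(1,2)
proof (induction rule: effective_induct)
  case (add Z Q)
  have "Z \<in> divisors \<iota>" using add(3) assms(3) by (auto simp: divisors_def)
  then have "gap D (M + Z) \<le> gap D (M + Z + pt Q)"
    using add(1) assms(3) D M divisors_add by (intro gap_step) auto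
  then show ?case using add(4) by (simp add: add.assoc)
qed simp

text \<open>A nonzero section of \<open>D\<close> embeds L(M - D) into L(M), which gives the lower
  bound. By Riemann-Roch the gap is deg D + i(M) - i(M - D), and the same section shows i(M) \<le>
  i(M - D).\<close>

lemma gap_bounds:
  assumes Q: "Q \<in> points \<iota>" and D: "D \<in> Gamma_pt \<iota> Q" and M: "M \<in> divisors \<iota>"
  shows "0 \<le> gap D M" "gap D M \<le> divisor_degree \<iota> D"
proof -
  note Dd = Gamma_pt_divisor[OF D]
  have MD: "M - D \<in> divisors \<iota>" using M Dd divisors_diff by blast
  obtain f where f: "f \<in> LS D" "f \<noteq> 0" using D Gamma_pt_iff[OF Q Dd] by blast
  have fR: "mult_at (M - D) R - R f \<le> mult_at M R" if "R \<in> points \<iota>" for R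
    using f that by (auto simp: LS_iff ord_ge_def lookup_minus dest: bspec[of _ _ R])
  show "0 \<le> gap D M" using ell_le_mult[OF f(2) fR MD M] by (simp add: gap_def)
  have "speciality M \<le> speciality (M - D)" using speciality_le_mult[OF f(2) fR MD M] .
  then show "gap D M \<le> divisor_degree \<iota> D"
    using euler_characteristic[OF M MD] by (simp add: gap_def divisor_degree_diff)
qed

text \<open>An index \<open>i\<close> stands for the step from M + (i - 1) P to M + i P, which is
  why the interval is open on the left.\<close>

lemma gap_count:
  assumes P: "P \<in> points \<iota>" and D: "D \<in> Gamma_pt \<iota> P" and M: "M \<in> divisors \<iota>"
    and I: "I \<subseteq> {a<..a + int n}"
      "\<And>i. i \<in> I \<Longrightarrow> M + Poly_Mapping.single P i \<in> Gamma_pt \<iota> P"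
      "\<And>i. i \<in> I \<Longrightarrow> M - D + Poly_Mapping.single P i \<notin> Gamma_pt \<iota> P"
  shows "gap D (M + Poly_Mapping.single P a) + card I \<le> gap D (M + Poly_Mapping.single P (a + int n))"
  using I
proof (induction n arbitrary: I)
  case (Suc n)
  let ?M = "M + Poly_Mapping.single P (a + int n)"
  have Md: "?M \<in> divisors \<iota>" using M divisors_single[OF P] divisors_add by blast
  have eq: "M + Poly_Mapping.single P (a + int (Suc n)) = ?M + pt P"
    by (simp add: add.assoc single_add[symmetric] add.commute[of 1])
  let ?J = "I - {a + int (Suc n)}"
  have J: "?J \<subseteq> {a<..a + int n}" using Suc.prems(1) by auto
  have IH: "gap D (M + Poly_Mapping.single P a) + card ?J \<le> gap D ?M"
    by (rule Suc.IH[OF J]) (use Suc.prems in auto)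
  have finI: "finite I" using Suc.prems(1) finite_subset by blast
  show ?case
  proof (cases "a + int (Suc n) \<in> I")
    case True
    have "?M + pt P - D = M - D + Poly_Mapping.single P (a + int (Suc n))"
      unfolding eq[symmetric] by (simp only: diff_add_eq)
    then have "?M + pt P - D \<notin> Gamma_pt \<iota> P" using Suc.prems(3)[OF True] by (simp only: not_False_eq_True)
    moreover have "?M + pt P \<in> Gamma_pt \<iota> P" using Suc.prems(2)[OF True] unfolding eq .
    ultimately have "gap D ?M + 1 \<le> gap D (?M + pt P)"
      using Gamma_pt_divisor[OF D] by (intro gap_step_strict P)
    moreover have "card I = Suc (card ?J)" by (rule card_Suc_Diff1[OF finI True, symmetric])
    ultimately show ?thesis using IH unfolding eq by simp
  next
    case False
    then have "?J = I" by auto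
    then show ?thesis using IH gap_step[OF P D Md] unfolding eq by simp
  qed
qed simp

text \<open>Finitely many representatives of the adeles modulo \<open>AK 0\<close> fit into one
  A(E), so i(E) = 0. For large m the divisor M + m P - E has a nonzero section, and multiplication
  by it gives i(M + m P) \<le> i(E).\<close>

lemma speciality_zero_eventually:
  assumes P: "P \<in> points \<iota>" and M: "M \<in> divisors \<iota>"
  shows "\<exists>m0. \<forall>m\<ge>m0. speciality (M + Poly_Mapping.single P (int m)) = 0"
proof -
  obtain T where T: "transversal (AK 0) (adeles \<iota>) T" using transversal_exists[OF add_subgroup_AK] .
  have Tf: "finite T" "T \<subseteq> adeles \<iota>"
    using T card_transversal(2)[OF add_subgroup_AK T] finite_cosets_AK[OF divisors_0]
    by (auto simp: transversal_def)
  obtain E where E: "E \<in> divisors \<iota>" "effective (E - 0)" "T \<subseteq> bounded_adeles \<iota> E"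
    using finite_adeles_bounded[OF Tf] by auto
  have "adeles \<iota> \<subseteq> AK E"
  proof
    fix \<alpha> assume "\<alpha> \<in> adeles \<iota>"
    then obtain t where t: "t \<in> T" "\<alpha> - t \<in> AK 0" using T by (auto simp: transversal_def)
    have "t \<in> AK E" unfolding AK_def using t(1) E(3) sum_set_left[OF add_subgroup_principal] by blast
    moreover have "\<alpha> - t \<in> AK E" using t(2) AK_mono[OF E(2)] by blast
    ultimately have "(\<alpha> - t) + t \<in> AK E" using add_subgroup_add[OF add_subgroup_AK] by blast
    then show "\<alpha> \<in> AK E" by simp
  qed
  then have AE: "AK E = adeles \<iota>" using AK_subset_adeles by blast
  have specE: "speciality E = 0"
    unfolding speciality_def ldim_def AE by (simp add: card_cosets_self[OF add_subgroup_adeles])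
  \<comment> \<open>By Riemann-Roch the dimension of L(M + m P - E) is at least
    \<open>c + m\<close>.\<close>
  define c where "c = ell 0 - speciality 0 + divisor_degree \<iota> (M - E)"
  have "speciality (M + Poly_Mapping.single P (int m)) = 0" if m: "real m > - c" for m
  proof -
    let ?Pm = "Poly_Mapping.single P (int m)" and ?F = "M + Poly_Mapping.single P (int m) - E"
    have Md: "M + ?Pm \<in> divisors \<iota>" using M divisors_single[OF P] divisors_add by blast
    have F: "?F \<in> divisors \<iota>" using Md E(1) divisors_diff by blast
    have "int m * 1 \<le> int m * int (point_degree \<iota> P)"
      using point_degree_pos[OF P] by (intro mult_left_mono) auto
    then have "int m \<le> divisor_degree \<iota> ?Pm" by (simp add: divisor_degree_single)
    then have "0 < ell ?F"
      using euler_characteristic[OF F divisors_0] speciality_nonneg[OF F] m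
      by (simp add: c_def divisor_degree_add divisor_degree_diff divisor_degree_0)
    then have "card (LS ?F) > 1"
      using card_LS_pos[OF F] base_gt_1 by (simp add: ell_def)
    then have "LS ?F \<noteq> {0}" by auto
    then obtain f where f: "f \<in> LS ?F" "f \<noteq> 0" using add_subgroup_0[OF add_subgroup_LS] by blast
    have "mult_at E R - R f \<le> mult_at (M + ?Pm) R" if "R \<in> points \<iota>" for R
      using f that by (auto simp: LS_iff ord_ge_def lookup_minus dest: bspec[of _ _ R])
    from speciality_le_mult[OF f(2) this E(1) Md] show ?thesis
      using specE speciality_nonneg[OF Md] by simp
  qed
  moreover obtain m0 :: nat where "real m0 > - c" using reals_Archimedean2 by blast
  ultimately show ?thesis by (intro exI[of _ m0]) auto
qed

text \<open>If L did not grow at this step, the index of speciality would drop by the degree of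
  \<open>Q\<close> and become negative.\<close>

lemma Gamma_pt_if_speciality_zero:
  assumes Q: "Q \<in> points \<iota>" and M: "M \<in> divisors \<iota>" and s: "speciality (M - pt Q) = 0"
  shows "M \<in> Gamma_pt \<iota> Q"
proof (rule ccontr)
  assume "M \<notin> Gamma_pt \<iota> Q"
  then have "ell M = ell (M - pt Q)" using M by (simp add: Gamma_pt_def ell_def)
  moreover have MQ: "M - pt Q \<in> divisors \<iota>" using M divisors_single[OF Q] divisors_diff by blast
  ultimately show False
    using speciality_diff[OF effective_pt MQ M] s speciality_nonneg[OF M] point_degree_pos[OF Q]
    by (simp add: divisor_degree_diff divisor_degree_single)
qed

text \<open>A sufficiently large multiple of \<open>P\<close> meets all the finitely many
  conditions. Without an element, the \<open>LEAST\<close> in \<open>gamma_min\<close> would say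
  nothing.\<close>

lemma Gamma_rel_nonempty:
  assumes P: "P \<in> points \<iota>" and C: "C \<in> divisors \<iota>" and S: "finite S" "S \<subseteq> points \<iota>" "P \<in> S"
  shows "Gamma_rel \<iota> P C S \<noteq> {}"
proof -
  let ?Pm = "\<lambda>m. Poly_Mapping.single P (int m)"
  have neg: "0 - pt Q \<in> divisors \<iota>" if "Q \<in> points \<iota>" for Q
    using divisors_diff[OF divisors_0 divisors_single[OF that]] .
  have "\<forall>Q\<in>S. \<exists>m0. \<forall>m\<ge>m0. speciality (0 - pt Q + ?Pm m) = 0"
    using speciality_zero_eventually[OF P neg] S(2) by blast
  then obtain m1 where m1: "\<And>Q m. Q \<in> S \<Longrightarrow> m \<ge> m1 Q \<Longrightarrow> speciality (0 - pt Q + ?Pm m) = 0"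
    by metis
  have "0 - C - pt P \<in> divisors \<iota>"
    using C divisors_0 divisors_diff divisors_single[OF P] by blast
  then obtain m2 where m2: "\<And>m. m \<ge> m2 \<Longrightarrow> speciality (0 - C - pt P + ?Pm m) = 0"
    using speciality_zero_eventually[OF P] by blast
  define m where "m = m2 + (\<Sum>Q\<in>S. m1 Q)"
  have Pm: "?Pm m \<in> divisors \<iota>" using divisors_single[OF P] .
  have "?Pm m \<in> Gamma_pt \<iota> Q" if "Q \<in> S" for Q
  proof (rule Gamma_pt_if_speciality_zero)
    show "Q \<in> points \<iota>" using that S by blast
    have "m1 Q \<le> m" unfolding m_def using member_le_sum[OF that, of m1] S(1) by simp
    then show "speciality (?Pm m - pt Q) = 0" using m1[OF that] by (simp add: algebra_simps)
  qed (rule Pm)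
  moreover have "?Pm m - C \<in> Gamma_pt \<iota> P"
  proof (rule Gamma_pt_if_speciality_zero[OF P])
    show "?Pm m - C \<in> divisors \<iota>" using Pm C divisors_diff by blast
    have "speciality (0 - C - pt P + ?Pm m) = 0" by (rule m2) (simp add: m_def)
    then show "speciality (?Pm m - C - pt P) = 0" by (simp add: algebra_simps)
  qed
  ultimately have "?Pm m \<in> Gamma_rel \<iota> P C S" by (simp add: Gamma_rel_def Gamma_set_def)
  then show ?thesis by blast
qed

section \<open>Counting the jumps and the final estimate\<close>

lemma card_Delta_le:
  "card (Delta_le \<iota> P B C) = card {i. i \<le> 0 \<and> B + Poly_Mapping.single P i \<in> Gamma_pt \<iota> P
     \<and> B - C + Poly_Mapping.single P i \<notin> Gamma_pt \<iota> P}"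
proof -
  have "inj (\<lambda>i :: int. B + Poly_Mapping.single P i)"
    by (rule injI) (metis add_left_cancel lookup_single_eq)
  then have "inj_on (\<lambda>i :: int. B + Poly_Mapping.single P i) X" for X by (rule inj_on_subset) simp
  moreover have "Delta_le \<iota> P B C = (\<lambda>i. B + Poly_Mapping.single P i) `
      {i. i \<le> 0 \<and> B + Poly_Mapping.single P i \<in> Gamma_pt \<iota> P
        \<and> B - C + Poly_Mapping.single P i \<notin> Gamma_pt \<iota> P}"
    by (auto simp: Delta_le_def)
  ultimately show ?thesis by (simp add: card_image)
qed

lemma degree_ge_card_Delta:
  assumes W: "canonical_divisor \<iota> K" and P: "P \<in> rational_points \<iota>"
    and div: "C \<in> divisors \<iota>" "A \<in> divisors \<iota>" "B \<in> divisors \<iota>" "Z \<in> divisors \<iota>"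
    and Z: "effective Z" and lin: "linearly_equivalent \<iota> (K + C) (A + B + Z)"
    and D: "D \<in> Gamma_rel \<iota> P C ({P} \<union> Poly_Mapping.keys Z)"
  shows "int (card (Delta_le \<iota> P A C)) + int (card (Delta_le \<iota> P B C)) \<le> divisor_degree \<iota> D"
proof -
  let ?s = "Poly_Mapping.single P" and ?\<Gamma> = "Gamma_pt \<iota> P"
  have Pp: "P \<in> points \<iota>" using P by (simp add: rational_points_def)
  have DS: "D \<in> Gamma_pt \<iota> Q" if "Q \<in> {P} \<union> Poly_Mapping.keys Z" for Q
    using D that by (auto simp: Gamma_rel_def Gamma_set_def)
  have DP: "D \<in> ?\<Gamma>" and DC: "D - C \<in> ?\<Gamma>" using DS D by (auto simp: Gamma_rel_def)
  note Dd = Gamma_pt_divisor[OF DP]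
  have Kd: "K \<in> divisors \<iota>" using W by (auto simp: canonical_divisor_def divisor_of_differential_def)
  have sd: "?s i \<in> divisors \<iota>" for i using divisors_single[OF Pp] .
  have shift: "M - D + ?s i \<notin> ?\<Gamma>" if "M - C + ?s i \<notin> ?\<Gamma>" for M i
  proof
    assume "M - D + ?s i \<in> ?\<Gamma>"
    then have "(M - D + ?s i) + (D - C) \<in> ?\<Gamma>" using Gamma_pt_add[OF Pp _ DC] by blast
    then show False using that by (simp add: algebra_simps)
  qed
  have countA: "real (card (Delta_le \<iota> P A C)) \<le> gap D A"
  proof -
    define I where "I = {i. i \<le> 0 \<and> A + ?s i \<in> ?\<Gamma> \<and> A - C + ?s i \<notin> ?\<Gamma>}"
    have "real (card I) \<le> gap D A"
    \<comment> \<open>In the infinite case \<open>card I\<close> is 0 and nonnegativity of the gap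
      is enough; in the finite case a window of length \<open>n\<close> below \<open>A\<close>
      contains every index.\<close>
    proof (cases "finite I")
      case True
      define n where "n = nat (1 + (\<Sum>i\<in>I. \<bar>i\<bar>))"
      have n: "int n = 1 + (\<Sum>i\<in>I. \<bar>i\<bar>)" by (simp add: n_def sum_nonneg)
      have "\<bar>i\<bar> < int n" if "i \<in> I" for i
        using member_le_sum[OF that, of abs] True n by simp
      then have I: "I \<subseteq> {- int n<..- int n + int n}" by (force simp: I_def)
      have "gap D (A + ?s (- int n)) + card I \<le> gap D (A + ?s (- int n + int n))"
        by (rule gap_count[OF Pp DP div(2) I]) (use shift in \<open>auto simp: I_def\<close>)
      moreover have "0 \<le> gap D (A + ?s (- int n))"
        using gap_bounds(1)[OF Pp DP divisors_add[OF div(2) sd]] .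
      ultimately show ?thesis by simp
    qed (use gap_bounds(1)[OF Pp DP div(2)] in simp)
    then show ?thesis unfolding card_Delta_le I_def .
  qed
  have ZS: "gap D A \<le> gap D (A + Z)"
    using Z Pp DS div(2,4) by (intro gap_add_effective[of Z "{P} \<union> Poly_Mapping.keys Z"]) (auto simp: divisors_def)
  have AZ: "A + Z \<in> divisors \<iota>" using div divisors_add by blast
  obtain f where f: "f \<noteq> 0"
    "\<And>Q. Q \<in> points \<iota> \<Longrightarrow> mult_at (K + C) Q = mult_at (A + B + Z) Q + Q f"
    using lin by (auto simp: linearly_equivalent_def)
  have dual_in: "A + Z + ?s (1 - i) \<in> ?\<Gamma>" if "B - C + ?s i \<notin> ?\<Gamma>" for i
  proof (rule Gamma_pt_linear_equivalence[OF Pp _ _ f(1)])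
    have "B - C + ?s i \<in> divisors \<iota>" using div sd divisors_add divisors_diff by blast
    then show "K + pt P - (B - C + ?s i) \<in> ?\<Gamma>" using canonical_duality_imp_in[OF W Pp _ that] by blast
    show "A + Z + ?s (1 - i) \<in> divisors \<iota>" using AZ sd divisors_add by blast
    fix R assume "R \<in> points \<iota>"
    then show "mult_at (K + pt P - (B - C + ?s i)) R = mult_at (A + Z + ?s (1 - i)) R + R f"
      using f(2)[of R] by (simp add: lookup_add lookup_minus lookup_single when_def)
  qed
  have dual_notin: "A + Z - C + ?s (1 - i) \<notin> ?\<Gamma>" if "B + ?s i \<in> ?\<Gamma>" for i
  proof
    assume in\<Gamma>: "A + Z - C + ?s (1 - i) \<in> ?\<Gamma>"
    have "K + pt P - (B + ?s i) \<in> ?\<Gamma>"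
    proof (rule Gamma_pt_linear_equivalence[OF Pp in\<Gamma>, of _ "inverse f"])
      show "K + pt P - (B + ?s i) \<in> divisors \<iota>"
        by (intro divisors_diff divisors_add Kd div sd)
      show "inverse f \<noteq> 0" using f by simp
      fix R assume "R \<in> points \<iota>"
      then show "mult_at (A + Z - C + ?s (1 - i)) R = mult_at (K + pt P - (B + ?s i)) R + R (inverse f)"
        using f(2)[of R] pt_inverse[of R f] by (simp add: lookup_add lookup_minus lookup_single when_def)
    qed
    then show False using canonical_duality_imp_notin[OF W P that] by blast
  qed
  have countB: "gap D (A + Z) + card (Delta_le \<iota> P B C) \<le> divisor_degree \<iota> D"
  proof -
    define I where "I = {i. i \<le> 0 \<and> B + ?s i \<in> ?\<Gamma> \<and> B - C + ?s i \<notin> ?\<Gamma>}"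
    \<comment> \<open>Duality sends \<open>i\<close> to \<open>1 - i\<close>. As
      \<open>i \<le> 0\<close>, the new index is at least 1, so these jumps lie strictly beyond A +
      Z and none is counted twice.\<close>
    define J where "J = (\<lambda>i. 1 - i) ` I"
    have cardJ: "card J = card I" unfolding J_def by (intro card_image) (auto simp: inj_on_def)
    have "gap D (A + Z) + card J \<le> divisor_degree \<iota> D"
    proof (cases "finite J")
      case True
      define n where "n = nat (\<Sum>i\<in>J. \<bar>i\<bar>)"
      have n: "int n = (\<Sum>i\<in>J. \<bar>i\<bar>)" by (simp add: n_def sum_nonneg)
      have "\<bar>i\<bar> \<le> int n" if "i \<in> J" for i
        using member_le_sum[OF that, of abs] True n by simp
      then have J: "J \<subseteq> {0<..0 + int n}" by (force simp: J_def I_def)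
      have "gap D (A + Z + ?s 0) + card J \<le> gap D (A + Z + ?s (0 + int n))"
        by (rule gap_count[OF Pp DP AZ J]) (use shift dual_in dual_notin in \<open>auto simp: J_def I_def\<close>)
      moreover have "gap D (A + Z + ?s (0 + int n)) \<le> divisor_degree \<iota> D"
        using gap_bounds(2)[OF Pp DP divisors_add[OF AZ sd]] .
      ultimately show ?thesis by simp
    qed (use gap_bounds(2)[OF Pp DP AZ] in simp)
    then show ?thesis unfolding cardJ card_Delta_le I_def .
  qed
  have "real (card (Delta_le \<iota> P A C)) + real (card (Delta_le \<iota> P B C)) \<le> real_of_int (divisor_degree \<iota> D)"
    using countA ZS countB by linarith
  then show ?thesis by linarith
qed

end

text \<open>The integers are not well-ordered, so \<open>LEAST\<close> is meaningful only with a
  lower bound; shifting by the bound reduces the claim to the natural numbers.\<close>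

lemma int_Least_mem:
  fixes X :: "int set"
  assumes "X \<noteq> {}" "\<And>d. d \<in> X \<Longrightarrow> l \<le> d"
  shows "(LEAST d. d \<in> X) \<in> X"
proof -
  obtain d where d: "d \<in> X" using assms(1) by blast
  then have "\<exists>n. l + int n \<in> X" using assms(2)[OF d] by (intro exI[of _ "nat (d - l)"]) simp
  define n where "n = (LEAST n. l + int n \<in> X)"
  have n: "l + int n \<in> X" unfolding n_def by (rule LeastI_ex) fact
  have "(LEAST d. d \<in> X) = l + int n"
  proof (rule Least_equality)
    show "l + int n \<in> X" by (rule n)
    fix e assume e: "e \<in> X"
    then have "n \<le> nat (e - l)"
      unfolding n_def using assms(2)[OF e] by (intro Least_le) simp
    then show "l + int n \<le> e" using assms(2)[OF e] by simp
  qed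
  then show ?thesis using n by simp
qed

theorem theorem6p6:
  fixes \<iota> :: "'f::{field,finite} \<Rightarrow> 'k::field"
    and g :: nat
    and K C A B Z :: "'k divisor"
    and P :: "'k point"
    and S :: "'k point set"
  assumes "curve \<iota>"
    and "genus \<iota> = g"
    and "canonical_divisor \<iota> K"
    and "C \<in> divisors \<iota>"
    and "P \<in> rational_points \<iota>"
    and "A \<in> divisors \<iota>"
    and "B \<in> divisors \<iota>"
    and "Z \<in> divisors \<iota>"
    and "effective Z"
    and "linearly_equivalent \<iota> (K + C) (A + B + Z)"
    and "S = {P} \<union> Poly_Mapping.keys Z"
  shows "gamma_min \<iota> P C S \<ge> int (card (Delta_le \<iota> P A C)) + int (card (Delta_le \<iota> P B C))"
proof -
  obtain x Bs where "curve_basis \<iota> x Bs" using curve.curve_basis_exists[OF assms(1)] .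
  then interpret curve_basis \<iota> x Bs .
  have P: "P \<in> points \<iota>" using assms(5) by (simp add: rational_points_def)
  let ?X = "divisor_degree \<iota> ` Gamma_rel \<iota> P C S"
  have ge: "int (card (Delta_le \<iota> P A C)) + int (card (Delta_le \<iota> P B C)) \<le> d" if "d \<in> ?X" for d
    using that degree_ge_card_Delta[OF assms(3,5,4,6,7,8,9,10)] assms(11) by auto
  have "finite S" "S \<subseteq> points \<iota>" "P \<in> S" using assms(8,11) P by (auto simp: divisors_def)
  then have "?X \<noteq> {}" using Gamma_rel_nonempty[OF P assms(4)] by blast
  \<comment> \<open>The inequality to be proved is itself the lower bound that makes the minimum
    exist.\<close>
  then have "(LEAST d. d \<in> ?X) \<in> ?X" using ge by (rule int_Least_mem)
  moreover have "gamma_min \<iota> P C S = (LEAST d. d \<in> ?X)"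
    unfolding gamma_min_def by (rule arg_cong[of _ _ Least]) auto
  ultimately show ?thesis using ge by simp
qed

end
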